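(* Let $\bar u:\mathbb{R}\to\mathbb{R}$ be an absolutely continuous function with derivative $\bar u_x\in L^2(\mathbb{R})$. Define, for $y\in\mathbb{R}$, $$\varphi(t,y)=\frac14\int_{\{x\in\mathbb{R}:\ \bar u_x(x)>-2/t\}}\operatorname{sign}(y-x)\,\bar u_x^2(x)\,dx\quad(t>0),\qquad \varphi(0,y)=\frac14\int_{\mathbb{R}}\operatorname{sign}(y-x)\,\bar u_x^2(x)\,dx,$$ and, for $t\ge 0$ and $y\in\mathbb{R}$, $$\xi(t,y)=y+t\,\bar u(y)+\int_0^t(t-s)\,\varphi(s,y)\,ds .$$ Then the formula $$u\big(t,\xi(t,y)\big)=\bar u(y)+\int_0^t\varphi(s,y)\,ds,\qquad t\ge 0,\ y\in\mathbb{R},$$ provides (i.e. well-defines) a function $u:[0,\infty)\times\mathbb{R}\to\mathbb{R}$ which is a dissipative solution, defined for all times $t\ge0$, of the Cauchy problem $$u_t+\Big(\frac{u^2}{2}\Big)_x=\frac14\Big(\int_{-\infty}^x-\int_x^\infty\Big)u_x^2\,dx,\qquad u(0,x)=\bar u(x).$$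
   Context: Notation: the right-hand side of the equation at $(t,x)$ is $\frac14\left(\int_{-\infty}^x u_x^2(t,z)\,dz-\int_x^\infty u_x^2(t,z)\,dz\right)$. Solution: a function $u(t,x)$ on $[0,T]\times\mathbb{R}$ is a solution of the Cauchy problem if (i) $u\in C([0,T]\times\mathbb{R};\mathbb{R})$ and $u(0,x)=\bar u(x)$ pointwise on $\mathbb{R}$; (ii) for each $t\in[0,T]$ the map $x\mapsto u(t,x)$ is absolutely continuous with $u_x(t,\cdot)\in L^2(\mathbb{R})$, and the map $t\mapsto u_x(t,\cdot)$ belongs to $L^\infty([0,T];L^2(\mathbb{R}))$; (iii) the map $t\mapsto u(t,\cdot)\in L^2_{loc}(\mathbb{R})$ is absolutely continuous (meaning that for every bounded interval $[a,b]$ the map $t\mapsto u(t,\cdot)|_{[a,b]}$ is absolutely continuous from $[0,T]$ into $L^2([a,b])$) and satisfies the equation for a.e. $t\in[0,T]$. A solution defined for all times $t\ge0$ is a function on $[0,\infty)\times\mathbb{R}$ whose restriction to $[0,T]\times\mathbb{R}$ is a solution for every $T>0$. "Absolutely continuous on $\mathbb{R}$" is understood on bounded intervals. Dissipative: a solution $u$ is dissipative if for every $t_2>t_1>0$ and every nonnegative test function $\phi\in C^1_c(\mathbb{R}_+\times\mathbb{R})$, $$\int_{\mathbb{R}}u_x^2(t_2,x)\,\phi(t_2,x)\,dx-\int_{\mathbb{R}}u_x^2(t_1,x)\,\phi(t_1,x)\,dx\le\int_{t_1}^{t_2}\int_{\mathbb{R}}\big\{u_x^2\,\phi_t+u\,u_x^2\,\phi_x\big\}\,dx\,dt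 .$$ *)

theory Defs
  imports "HOL-Analysis.Analysis"
begin

text \<open>
  Conventions.  A function of time and space is curried, \<open>u t x\<close>; only its values for \<open>t \<ge> 0\<close> matter.
  The spatial derivative of an absolutely continuous function is the library's \<open>deriv\<close>.  It has
  its intended value wherever the function is differentiable, hence almost everywhere; on the
  exceptional null set it takes one fixed unspecified value, which no integral sees.
  Elements of \<open>L\<^sup>2\<close> are represented by functions and compared only through \<open>L2norm\<close>.
\<close>

text \<open>
  Absolute continuity of a map into a space with (pseudo-)distance \<open>d\<close>; the finite family
  consists of the nonoverlapping intervals \<open>[p i, q i]\<close>, \<open>i < n\<close>.
\<close>

definition abs_cont_on :: "('a \<Rightarrow> 'a \<Rightarrow> real) \<Rightarrow> real set \<Rightarrow> (real \<Rightarrow> 'a) \<Rightarrow> bool" where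
  "abs_cont_on d I F \<longleftrightarrow>
     (\<forall>\<epsilon>>0. \<exists>\<delta>>0. \<forall>(n::nat) (p::nat \<Rightarrow> real) (q::nat \<Rightarrow> real).
        (\<forall>i<n. p i \<in> I \<and> q i \<in> I \<and> p i \<le> q i) \<longrightarrow>
        (\<forall>i<n. \<forall>j<n. i \<noteq> j \<longrightarrow> {p i<..<q i} \<inter> {p j<..<q j} = {}) \<longrightarrow>
        (\<Sum>i<n. q i - p i) < \<delta> \<longrightarrow>
        (\<Sum>i<n. d (F (p i)) (F (q i))) < \<epsilon>)"

definition abs_cont :: "(real \<Rightarrow> real) \<Rightarrow> bool" where
  "abs_cont f \<longleftrightarrow> (\<forall>a b. abs_cont_on dist {a..b} f)"

definition L2 :: "real set \<Rightarrow> (real \<Rightarrow> real) set" where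
  "L2 S = {f. set_borel_measurable lebesgue S f \<and> set_integrable lebesgue S (\<lambda>x. (f x)\<^sup>2)}"

definition L2norm :: "real set \<Rightarrow> (real \<Rightarrow> real) \<Rightarrow> real" where
  "L2norm S f = sqrt (LINT x:S|lebesgue. (f x)\<^sup>2)"

definition L2dist :: "real set \<Rightarrow> (real \<Rightarrow> real) \<Rightarrow> (real \<Rightarrow> real) \<Rightarrow> real" where
  "L2dist S f g = L2norm S (\<lambda>x. f x - g x)"

text \<open>
  The Bochner space \<open>L\<^sup>\<infinity>(I; L\<^sup>2(\<real>))\<close>: strongly measurable (almost everywhere a limit
  of simple functions with values in \<open>L\<^sup>2\<close>) and essentially bounded.
\<close>

definition L2_simple :: "(real \<Rightarrow> real \<Rightarrow> real) \<Rightarrow> bool" where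
  "L2_simple s \<longleftrightarrow>
     (\<exists>(n::nat) A g. (\<forall>i<n. A i \<in> sets lebesgue \<and> g i \<in> L2 UNIV) \<and>
        s = (\<lambda>t x. \<Sum>i<n. indicator (A i) t * g i x))"

definition L2_strongly_measurable_on :: "real set \<Rightarrow> (real \<Rightarrow> real \<Rightarrow> real) \<Rightarrow> bool" where
  "L2_strongly_measurable_on I F \<longleftrightarrow>
     (\<exists>s :: nat \<Rightarrow> real \<Rightarrow> real \<Rightarrow> real. (\<forall>k. L2_simple (s k)) \<and>
        (AE t in lebesgue. t \<in> I \<longrightarrow> (\<lambda>k. L2dist UNIV (s k t) (F t)) \<longlonglongrightarrow> 0))"

definition Linf_L2 :: "real set \<Rightarrow> (real \<Rightarrow> real \<Rightarrow> real) \<Rightarrow> bool" where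
  "Linf_L2 I F \<longleftrightarrow>
     (AE t in lebesgue. t \<in> I \<longrightarrow> F t \<in> L2 UNIV) \<and>
     L2_strongly_measurable_on I F \<and>
     (\<exists>C. AE t in lebesgue. t \<in> I \<longrightarrow> L2norm UNIV (F t) \<le> C)"

definition abs_cont_L2loc :: "real set \<Rightarrow> (real \<Rightarrow> real \<Rightarrow> real) \<Rightarrow> bool" where
  "abs_cont_L2loc I u \<longleftrightarrow>
     (\<forall>a b. (\<forall>t\<in>I. u t \<in> L2 {a..b}) \<and> abs_cont_on (L2dist {a..b}) I u)"

text \<open>\<open>w\<close> is the derivative at time \<open>t\<close> of the \<open>L\<^sup>2\<^sub>l\<^sub>o\<^sub>c\<close>-valued map \<open>u\<close> defined on \<open>I\<close>.\<close>

definition has_L2loc_derivative ::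
  "real set \<Rightarrow> (real \<Rightarrow> real \<Rightarrow> real) \<Rightarrow> real \<Rightarrow> (real \<Rightarrow> real) \<Rightarrow> bool" where
  "has_L2loc_derivative I u t w \<longleftrightarrow>
     (\<forall>a b. w \<in> L2 {a..b} \<and>
        ((\<lambda>s. L2dist {a..b} (\<lambda>x. (u s x - u t x) / (s - t)) w) \<longlongrightarrow> 0) (at t within I))"

definition HS_rhs :: "(real \<Rightarrow> real) \<Rightarrow> real \<Rightarrow> real" where
  "HS_rhs v x =
     1/4 * ((LINT z:{..x}|lebesgue. (deriv v z)\<^sup>2) - (LINT z:{x..}|lebesgue. (deriv v z)\<^sup>2))"

definition HS_solution :: "real \<Rightarrow> (real \<Rightarrow> real) \<Rightarrow> (real \<Rightarrow> real \<Rightarrow> real) \<Rightarrow> bool" where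
  "HS_solution T ubar u \<longleftrightarrow>
     continuous_on ({0..T} \<times> UNIV) (\<lambda>(t, x). u t x) \<and>
     (\<forall>x. u 0 x = ubar x) \<and>
     (\<forall>t\<in>{0..T}. abs_cont (u t) \<and> deriv (u t) \<in> L2 UNIV) \<and>
     Linf_L2 {0..T} (\<lambda>t. deriv (u t)) \<and>
     abs_cont_L2loc {0..T} u \<and>
     (AE t in lebesgue. t \<in> {0..T} \<longrightarrow>
        (\<exists>u_t. has_L2loc_derivative {0..T} u t u_t \<and>
          (AE x in lebesgue. u_t x + deriv (\<lambda>z. (u t z)\<^sup>2 / 2) x = HS_rhs (u t) x)))"

definition HS_global_solution :: "(real \<Rightarrow> real) \<Rightarrow> (real \<Rightarrow> real \<Rightarrow> real) \<Rightarrow> bool" where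
  "HS_global_solution ubar u \<longleftrightarrow> (\<forall>T>0. HS_solution T ubar u)"

text \<open>
  \<open>\<phi> \<in> C\<^sup>1\<^sub>c([0,\<infinity>) \<times> \<real>)\<close> with partial derivatives \<open>\<phi>\<^sub>t\<close>, \<open>\<phi>\<^sub>x\<close>, one-sided in time at \<open>t = 0\<close>.
  Every element of \<open>C\<^sup>1\<^sub>c((0,\<infinity>) \<times> \<real>)\<close>, extended by zero, is such a function.
\<close>

definition C1c_test ::
  "(real \<Rightarrow> real \<Rightarrow> real) \<Rightarrow> (real \<Rightarrow> real \<Rightarrow> real) \<Rightarrow> (real \<Rightarrow> real \<Rightarrow> real) \<Rightarrow> bool" where
  "C1c_test \<phi> \<phi>t \<phi>x \<longleftrightarrow>
     (\<forall>t\<ge>0. \<forall>x. ((\<lambda>(s, y). \<phi> s y) has_derivative (\<lambda>(h, k). \<phi>t t x * h + \<phi>x t x * k))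
        (at (t, x) within {0..} \<times> UNIV)) \<and>
     continuous_on ({0..} \<times> UNIV) (\<lambda>(t, x). \<phi>t t x) \<and>
     continuous_on ({0..} \<times> UNIV) (\<lambda>(t, x). \<phi>x t x) \<and>
     (\<exists>K. compact K \<and> K \<subseteq> {0..} \<times> UNIV \<and> (\<forall>t\<ge>0. \<forall>x. (t, x) \<notin> K \<longrightarrow> \<phi> t x = 0))"

definition HS_dissipative :: "(real \<Rightarrow> real \<Rightarrow> real) \<Rightarrow> bool" where
  "HS_dissipative u \<longleftrightarrow>
     (\<forall>t1 t2 \<phi> \<phi>t \<phi>x. 0 < t1 \<and> t1 < t2 \<and> C1c_test \<phi> \<phi>t \<phi>x \<and> (\<forall>t\<ge>0. \<forall>x. 0 \<le> \<phi> t x) \<longrightarrow>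
        (LINT x|lebesgue. (deriv (u t2) x)\<^sup>2 * \<phi> t2 x)
          - (LINT x|lebesgue. (deriv (u t1) x)\<^sup>2 * \<phi> t1 x)
        \<le> (LINT t:{t1..t2}|lebesgue. (LINT x|lebesgue.
              (deriv (u t) x)\<^sup>2 * \<phi>t t x + u t x * (deriv (u t) x)\<^sup>2 * \<phi>x t x)))"

text \<open>The case distinction is needed because \<open>-2/0 = 0\<close> in HOL, whereas \<open>-2/t\<close> means \<open>-\<infinity>\<close> at \<open>t = 0\<close>.\<close>

definition HS_phi :: "(real \<Rightarrow> real) \<Rightarrow> real \<Rightarrow> real \<Rightarrow> real" where
  "HS_phi ubar t y =
     (if t = 0 then 1/4 * (LINT x|lebesgue. sgn (y - x) * (deriv ubar x)\<^sup>2)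
      else 1/4 * (LINT x:{x. deriv ubar x > - 2 / t}|lebesgue. sgn (y - x) * (deriv ubar x)\<^sup>2))"

definition HS_xi :: "(real \<Rightarrow> real) \<Rightarrow> real \<Rightarrow> real \<Rightarrow> real" where
  "HS_xi ubar t y =
     y + t * ubar y + (LINT s:{0..t}|lebesgue. (t - s) * HS_phi ubar s y)"

definition HS_value :: "(real \<Rightarrow> real) \<Rightarrow> real \<Rightarrow> real \<Rightarrow> real" where
  "HS_value ubar t y = ubar y + (LINT s:{0..t}|lebesgue. HS_phi ubar s y)"

end

theory Submission
  imports Defs
begin

text \<open>
  Write \<open>a\<close> for the derivative of the initial datum and \<open>q(t,y) = max 0 (1 + t a(y)/2)\<close>.  Fubini's theorem
  and an explicit integration in time give \<open>\<xi>\<^sub>y = q\<^sup>2\<close> and \<open>V\<^sub>y = a q\<close> for the prescribed values \<open>V\<close> along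
  characteristics.  Hence \<open>\<xi>(t,\<cdot>)\<close> is nondecreasing and onto and carries the measure \<open>q\<^sup>2 dy\<close> to \<open>dx\<close>, and by
  Young's inequality \<open>V\<close> is constant on the level sets of \<open>\<xi>\<close> and \<open>u(t,\<cdot>)\<close> is absolutely continuous.  The chain
  rule gives \<open>u\<^sub>x = a/q\<close> at \<open>\<xi>(t,y)\<close> whenever \<open>q > 0\<close>, so that \<open>u\<^sub>x\<^sup>2 dx\<close> is the image of \<open>a\<^sup>2 dy\<close> restricted to
  \<open>{a > -2/t}\<close>: the source term becomes \<open>\<phi>\<close>, and the energy \<open>M(t)\<close> on this shrinking set can only drop,
    which together
  with the fundamental theorem of calculus along characteristics yields the dissipation inequality.

  At the continuity points of the monotone function \<open>M\<close>, hence for almost every \<open>t\<close>, the map \<open>t \<mapsto>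
    u\<^sub>x(t)\<close> is continuous
  in \<open>L\<^sup>2\<close>: the distance of \<open>u\<^sub>x(t)\<close> to a test function is \<open>M(t)\<close> plus a term that is continuous by dominated
  convergence.  At such times the difference quotients of \<open>u\<close> converge in \<open>L\<^sup>2\<^sub>l\<^sub>o\<^sub>c\<close>.
\<close>

text \<open>For a smooth solution, differentiating the equation in x gives w' = -w^2/2 for w = u_x
  along a characteristic, because the source contributes u_x^2/2. Hence w = a/(1 + t*a/2): this is
  the origin of \<open>q\<close>, of the collapse time -2/a and of the threshold in
  \<open>alive\<close>. The stretching satisfies (X_y)' = w * X_y, so u_x^2 * X_y = a^2 stays
  constant until q reaches 0. This computation only motivates; the proof takes the explicit formulas
  as definitions and verifies them, since u has no second derivative to work with. Two obstacles
  shape the rest. \<open>X t\<close> may be constant on whole intervals of labels, so each transfer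
  between positions and labels must tolerate the set where q = 0; the weights q^2 and
  \<open>alive\<close> vanish there. And if {a = -2/t} has positive measure, \<open>M\<close> jumps
  at t and the source may jump with it, so time derivatives are sought only away from countably many
  times. All space derivatives exist merely almost everywhere, starting from an epsilon-delta
  hypothesis. Lebesgue differentiation and the fundamental theorem for absolutely continuous
  functions are the link between such derivatives and integrals.\<close>

lemma emeasure_countable_UN_le:
  assumes "countable C" "\<And>i. i \<in> C \<Longrightarrow> A i \<in> sets M"
    and le: "\<And>F. finite F \<Longrightarrow> F \<subseteq> C \<Longrightarrow> emeasure M (\<Union>i\<in>F. A i) \<le> b"
  shows "emeasure M (\<Union>i\<in>C. A i) \<le> b"
proof (cases "C = {}")
  case False
  define e where "e = from_nat_into C"
  have e: "range e = C"
    using False assms(1) by (simp add: e_def range_from_nat_into)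
  define B where "B n = (\<Union>i\<in>e ` {..<n}. A i)" for n :: nat
  have "emeasure M (\<Union>n. B n) = (SUP n. emeasure M (B n))"
  proof (rule SUP_emeasure_incseq[symmetric])
    show "range B \<subseteq> sets M"
      using e assms(2) unfolding B_def by (auto intro!: sets.finite_UN)
    show "incseq B"
      unfolding B_def incseq_def by (auto; meson lessThan_iff less_le_trans)
  qed
  also have "\<dots> \<le> b"
    unfolding B_def using e by (intro SUP_least le) auto
  also have "(\<Union>n. B n) = (\<Union>i\<in>C. A i)"
    unfolding B_def e[symmetric] by auto
  finally show ?thesis .
qed auto

lemma sum_set_integral_le_integral:
  fixes f :: "'a \<Rightarrow> real"
  assumes "integrable M f" "\<And>x. 0 \<le> f x" "finite I" "disjoint_family_on A I"
    and "\<And>i. i \<in> I \<Longrightarrow> A i \<in> sets M"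
  shows "(\<Sum>i\<in>I. LINT x:A i|M. f x) \<le> integral\<^sup>L M f"
proof -
  have int: "set_integrable M (A i) f" if "i \<in> I" for i
    using integrable_mult_indicator[OF assms(5)[OF that] assms(1)] by (simp add: set_integrable_def)
  have "(\<Sum>i\<in>I. LINT x:A i|M. f x) = (LINT x:(\<Union>i\<in>I. A i)|M. f x)"
    using assms int by (subst set_integral_finite_Union) auto
  also have "\<dots> \<le> integral\<^sup>L M f"
    unfolding set_lebesgue_integral_def using assms
    by (intro integral_mono integrable_mult_indicator) (auto simp: indicator_def intro!: sets.finite_UN)
  finally show ?thesis .
qed

section \<open>Integrals over subsets of the line and approximation by test functions\<close>

lemma set_integrable_lborel:
  "integrable lborel f \<Longrightarrow> A \<in> sets borel \<Longrightarrow> set_integrable lborel A (f :: real \<Rightarrow> real)"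
  using integrable_mult_indicator[of A lborel f] by (simp add: set_integrable_def)

lemma set_integral_le_integral:
  fixes f :: "real \<Rightarrow> real"
  assumes "integrable lborel f" "\<And>x. 0 \<le> f x" "A \<in> sets borel"
  shows "(LBINT x:A. f x) \<le> integral\<^sup>L lborel f"
  using sum_set_integral_le_integral[OF assms(1,2), of "{()}" "\<lambda>_. A"] assms(3)
  by (simp add: disjoint_family_on_def)

lemma set_integral_nonneg_real: "(\<And>x. 0 \<le> f x) \<Longrightarrow> 0 \<le> (LBINT x:A. f x :: real)"
  unfolding set_lebesgue_integral_def by (intro integral_nonneg_AE) auto

lemma abs_set_integral_le: "\<bar>LBINT x:A. f x :: real\<bar> \<le> (LBINT x:A. \<bar>f x\<bar>)"
  unfolding set_lebesgue_integral_def by (rule order_trans[OF integral_abs_bound]) (simp add: abs_mult)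

lemma integrable_indicator_Icc: "integrable lborel (indicator {l..r::real} :: real \<Rightarrow> real)"
  by (intro integrable_real_indicator) (auto simp: emeasure_lborel_Icc_eq)

lemma set_integrable_const_Icc: "set_integrable lborel {l..r::real} (\<lambda>_. c :: real)"
  unfolding set_integrable_def by (intro integrable_scaleR_left integrable_indicator_Icc)

lemma set_integral_const_Icc: "l \<le> r \<Longrightarrow> (LBINT x:{l..r::real}. c) = (r - l) * (c :: real)"
  by (simp add: set_lebesgue_integral_def)

lemma set_integral_Icc_split:
  fixes f :: "real \<Rightarrow> real"
  assumes "set_integrable lborel {l..r} f" "l \<le> m" "m \<le> r"
  shows "(LBINT x:{l..r}. f x) = (LBINT x:{l..m}. f x) + (LBINT x:{m..r}. f x)"
proof -
  have "{l..r} = {l..m} \<union> {m..r}" using assms by auto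
  moreover have "AE x in lborel. x \<noteq> m" by (rule AE_lborel_singleton)
  moreover have "set_integrable lborel {l..m} f" "set_integrable lborel {m..r} f"
    by (rule set_integrable_subset[OF assms(1)]; use assms in auto)+
  ultimately show ?thesis
    by (simp only:) (rule set_integral_Un_AE, auto elim!: eventually_mono)
qed

text \<open>Source of the first order expansions below: it is applied in time to
  \<open>\<phi>\<close> and \<open>V\<close> along characteristics and in space to a test function,
  usually with \<open>c\<close> the value at the base point.\<close>

lemma set_integral_const_dist:
  fixes f :: "real \<Rightarrow> real"
  assumes "s \<le> t" "set_integrable lborel {s..t} f" "\<And>r. s \<le> r \<Longrightarrow> r \<le> t \<Longrightarrow> \<bar>f r - c\<bar> \<le> d"
  shows "\<bar>(LBINT r:{s..t}. f r) - (t - s) * c\<bar> \<le> d * (t - s)"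
proof -
  have "\<bar>(LBINT r:{s..t}. f r) - (t - s) * c\<bar> = \<bar>LBINT r:{s..t}. f r - c\<bar>"
    using assms set_integrable_const_Icc by (simp add: set_integral_const_Icc)
  also have "\<dots> \<le> (LBINT r:{s..t}. \<bar>f r - c\<bar>)"
    by (rule abs_set_integral_le)
  also have "\<dots> \<le> (LBINT r:{s..t}. d)"
    using assms set_integrable_const_Icc by (intro set_integral_mono set_integrable_abs set_integral_diff) auto
  finally show ?thesis using assms(1) by (simp add: set_integral_const_Icc mult.commute)
qed

lemma set_integral_Icc_Ioo:
  fixes f :: "real \<Rightarrow> real"
  shows "(LBINT z:{x..y}. f z) = (LBINT z:{x<..<y}. f z)"
  unfolding set_lebesgue_integral_def
  by (intro integral_discrete_difference[where X = "{x, y}"]) (auto simp: indicator_def)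

lemma power_add_le_two_power:
  fixes x y :: real
  assumes "0 \<le> x" "0 \<le> y"
  shows "(x + y) ^ p \<le> 2 ^ p * (x ^ p + y ^ p)"
proof -
  have "(x + y) ^ p \<le> (2 * max x y) ^ p"
    using assms by (intro power_mono) auto
  also have "\<dots> = 2 ^ p * max x y ^ p"
    by (simp add: power_mult_distrib)
  also have "\<dots> \<le> 2 ^ p * (x ^ p + y ^ p)"
    using assms by (intro mult_left_mono) (auto simp: max_def)
  finally show ?thesis .
qed

text \<open>Truncation in argument and value reduces to a bounded function of bounded support. Such
  a function is almost everywhere a limit of continuous functions, which a clamp and a cutoff make
  uniformly dominated. The exponent will be 1 for Lebesgue differentiation and 2 for
  \<open>ux\<close>.\<close>

lemma continuous_compact_support_dense:
  fixes f :: "real \<Rightarrow> real"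
  assumes [measurable]: "f \<in> borel_measurable borel"
    and int: "integrable lborel (\<lambda>x. \<bar>f x\<bar> ^ p)" and "0 < p" "0 < \<epsilon>"
  obtains g R where "continuous_on UNIV g" "\<And>x. R < \<bar>x\<bar> \<Longrightarrow> g x = 0"
    "integrable lborel (\<lambda>x. \<bar>f x - g x\<bar> ^ p)" "(LBINT x. \<bar>f x - g x\<bar> ^ p) < \<epsilon>"
proof -
  \<comment> \<open>Two errors of size \<delta>, each multiplied by 2^p in
    \<open>power_add_le_two_power\<close>, add up to \<epsilon>.\<close>
  define \<delta> where "\<delta> = \<epsilon> / (2 * 2 ^ p)"
  have "\<delta> > 0" using assms by (simp add: \<delta>_def)
  define F where "F M x = (if \<bar>x\<bar> \<le> real M \<and> \<bar>f x\<bar> \<le> real M then f x else 0)" for M x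
  have [measurable]: "F M \<in> borel_measurable borel" for M
    unfolding F_def by measurable
  have "(\<lambda>M. LBINT x. \<bar>f x - F M x\<bar> ^ p) \<longlonglongrightarrow> (LINT (x::real)|lborel. (0::real))"
  proof (rule integral_dominated_convergence[where w = "\<lambda>x. \<bar>f x\<bar> ^ p"])
    show "AE x in lborel. (\<lambda>M. \<bar>f x - F M x\<bar> ^ p) \<longlonglongrightarrow> 0"
    proof (rule AE_I2)
      fix x
      have "eventually (\<lambda>M. \<bar>f x - F M x\<bar> ^ p = 0) sequentially"
        using eventually_ge_at_top[of "nat \<lceil>max \<bar>x\<bar> \<bar>f x\<bar>\<rceil>"]
        by eventually_elim (use \<open>0 < p\<close> in \<open>auto simp: F_def; linarith\<close>)
      then show "(\<lambda>M. \<bar>f x - F M x\<bar> ^ p) \<longlonglongrightarrow> 0"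
        by (rule tendsto_eventually)
    qed
    show "AE x in lborel. norm (\<bar>f x - F M x\<bar> ^ p) \<le> \<bar>f x\<bar> ^ p" for M
      using \<open>0 < p\<close> by (auto simp: F_def zero_power)
  qed (use int in auto)
  then have "eventually (\<lambda>M. (LBINT x. \<bar>f x - F M x\<bar> ^ p) < \<delta>) sequentially"
    by (rule order_tendstoD) (use \<open>\<delta> > 0\<close> in simp)
  then obtain M where M: "(LBINT x. \<bar>f x - F M x\<bar> ^ p) < \<delta>"
    by (auto simp: eventually_sequentially)
  have intM: "integrable lborel (\<lambda>x. \<bar>f x - F M x\<bar> ^ p)"
    by (rule Bochner_Integration.integrable_bound[OF int]) (use \<open>0 < p\<close> in \<open>auto simp: F_def zero_power\<close>)
  have "F M measurable_on UNIV"
    by (rule lebesgue_measurable_imp_measurable_on_real) (auto intro: measurable_completion)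
  then obtain N h where N: "negligible N" and h: "\<And>n::nat. continuous_on UNIV (h n)"
    and lim: "\<And>x. x \<notin> N \<Longrightarrow> (\<lambda>n. h n x) \<longlonglongrightarrow> F M x"
    unfolding measurable_on_def by auto
  \<comment> \<open>The cutoff equals 1 where \<open>F M\<close> can be nonzero and vanishes for |x|
    > M + 1, so the limit is unchanged and all \<open>G n\<close> live on one bounded
    interval.\<close>
  define c where "c x = max 0 (min 1 (real M + 1 - \<bar>x\<bar>))" for x
  define G where "G n x = max (- real M) (min (real M) (h n x)) * c x" for n x
  have G: "continuous_on UNIV (G n)" for n
    unfolding G_def c_def by (intro continuous_intros h)
  have [measurable]: "G n \<in> borel_measurable borel" for n
    using G by (rule borel_measurable_continuous_onI)
  have N': "AE x in lborel. x \<notin> N"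
    using N by (metis AE_completion_iff AE_not_in negligible_iff_null_sets)
  have Gb: "\<bar>F M x - G n x\<bar> \<le> 2 * real M * indicator {-(real M + 1)..real M + 1} x" for n x
  proof -
    have "\<bar>max (- real M) (min (real M) (h n x))\<bar> * \<bar>c x\<bar> \<le> real M * 1"
      by (intro mult_mono) (auto simp: c_def)
    then have "\<bar>G n x\<bar> \<le> real M" by (simp add: G_def abs_mult)
    moreover have "\<bar>F M x\<bar> \<le> real M" by (simp add: F_def)
    moreover have "x \<notin> {-(real M + 1)..real M + 1} \<Longrightarrow> F M x = 0 \<and> G n x = 0"
      by (auto simp: F_def G_def c_def)
    ultimately show ?thesis by (auto simp: indicator_def)
  qed
  have Gp: "\<bar>F M x - G n x\<bar> ^ p \<le> (2 * real M) ^ p * indicator {-(real M + 1)..real M + 1} x" for n x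
    using power_mono[OF Gb abs_ge_zero, of x n p] \<open>0 < p\<close>
    by (auto simp: indicator_def zero_power power_mult_distrib split: if_splits)
  have intd: "integrable lborel (\<lambda>x. (2 * real M) ^ p * indicator {-(real M + 1)..real M + 1} x)"
    by (intro integrable_mult_right integrable_indicator_Icc)
  have "(\<lambda>n. LBINT x. \<bar>F M x - G n x\<bar> ^ p) \<longlonglongrightarrow> (LINT (x::real)|lborel. (0::real))"
  proof (rule integral_dominated_convergence[where w = "\<lambda>x. (2 * real M) ^ p * indicator {-(real M +
    1)..real M + 1} x"])
    show "AE x in lborel. (\<lambda>n. \<bar>F M x - G n x\<bar> ^ p) \<longlonglongrightarrow> 0"
      using N'
    proof eventually_elim
      fix x assume "x \<notin> N"
      have "(\<lambda>n. \<bar>F M x - G n x\<bar> ^ p) \<longlonglongrightarrow> \<bar>F M x - max (- real M) (min (real M) (F M x)) * c x\<bar> ^ p"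
        unfolding G_def by (intro tendsto_intros lim \<open>x \<notin> N\<close>)
      also have "F M x - max (- real M) (min (real M) (F M x)) * c x = 0"
        by (auto simp: F_def c_def)
      finally show "(\<lambda>n. \<bar>F M x - G n x\<bar> ^ p) \<longlonglongrightarrow> 0"
        using \<open>0 < p\<close> by (simp add: zero_power)
    qed
    show "AE x in lborel. norm (\<bar>F M x - G n x\<bar> ^ p) \<le> (2 * real M) ^ p * indicator {-(real M +
      1)..real M + 1} x" for n
      using Gp by auto
  qed (use intd in auto)
  then have "eventually (\<lambda>n. (LBINT x. \<bar>F M x - G n x\<bar> ^ p) < \<delta>) sequentially"
    by (rule order_tendstoD) (use \<open>\<delta> > 0\<close> in simp)
  then obtain n where n: "(LBINT x. \<bar>F M x - G n x\<bar> ^ p) < \<delta>"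
    by (auto simp: eventually_sequentially)
  have intn: "integrable lborel (\<lambda>x. \<bar>F M x - G n x\<bar> ^ p)"
    by (rule Bochner_Integration.integrable_bound[OF intd]) (use Gp in auto)
  have le: "\<bar>f x - G n x\<bar> ^ p \<le> 2 ^ p * (\<bar>f x - F M x\<bar> ^ p + \<bar>F M x - G n x\<bar> ^ p)" for x
    using power_add_le_two_power[of "\<bar>f x - F M x\<bar>" "\<bar>F M x - G n x\<bar>" p]
      power_mono[of "\<bar>f x - G n x\<bar>" "\<bar>f x - F M x\<bar> + \<bar>F M x - G n x\<bar>" p] by linarith
  have intr: "integrable lborel (\<lambda>x. 2 ^ p * (\<bar>f x - F M x\<bar> ^ p + \<bar>F M x - G n x\<bar> ^ p))"
    using intn intM by auto
  have intG: "integrable lborel (\<lambda>x. \<bar>f x - G n x\<bar> ^ p)"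
    by (rule Bochner_Integration.integrable_bound[OF intr]) (use le in auto)
  have "(LBINT x. \<bar>f x - G n x\<bar> ^ p) \<le> (LBINT x. 2 ^ p * (\<bar>f x - F M x\<bar> ^ p + \<bar>F M x - G n x\<bar> ^ p))"
    using intG intr le by (intro integral_mono)
  also have "\<dots> = 2 ^ p * ((LBINT x. \<bar>f x - F M x\<bar> ^ p) + (LBINT x. \<bar>F M x - G n x\<bar> ^ p))"
    using intn intM by simp
  also have "\<dots> < 2 ^ p * (\<delta> + \<delta>)"
    using n M by (intro mult_strict_left_mono) auto
  also have "\<dots> = \<epsilon>" by (simp add: \<delta>_def)
  finally have "(LBINT x. \<bar>f x - G n x\<bar> ^ p) < \<epsilon>" .
  moreover have "G n x = 0" if "real M + 1 < \<bar>x\<bar>" for x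
    using that by (simp add: G_def c_def)
  ultimately show ?thesis using G intG that by blast
qed

text \<open>Weak type (1,1) bound of Hardy and Littlewood. Among the balls with large mean, Vitali
  selects disjoint ones whose fivefold enlargements cover all of them; a ball of radius r has length
  2*r, and r is less than 1/c times its integral, hence the constant 10. The open set
  \<open>W\<close> stands in for the superlevel set of the maximal function, so no measurability
  question arises.\<close>

lemma maximal_weak_type:
  fixes f :: "real \<Rightarrow> real"
  assumes f: "integrable lborel f" "\<And>x. 0 \<le> f x" and "0 < c"
  obtains W where "open W" "emeasure lborel W \<le> ennreal (10 / c * integral\<^sup>L lborel f)"
    "\<And>x r. 0 < r \<Longrightarrow> c * r < (LBINT z:ball x r. f z) \<Longrightarrow> x \<in> W"
proof -
  let ?I = "integral\<^sup>L lborel f"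
  define K where "K = {(x, r). 0 < r \<and> c * r < (LBINT z:ball x r. f z)}"
  have le: "(LBINT z:ball x r. f z) \<le> ?I" for x r
    by (rule set_integral_le_integral[OF f]) simp
  \<comment> \<open>The integral over any ball is at most \<open>?I\<close>, so the radii are
    bounded, as the covering lemma requires.\<close>
  have r: "0 < snd i \<and> snd i \<le> ?I / c" if "i \<in> K" for i
    using that le[of "fst i" "snd i"] \<open>0 < c\<close> by (auto simp: K_def field_simps)
  obtain C where C: "countable C" "C \<subseteq> K"
    "pairwise (\<lambda>i j. disjnt (ball (fst i) (snd i)) (ball (fst j) (snd j))) C"
    "(\<Union>i\<in>K. ball (fst i) (snd i)) \<subseteq> (\<Union>i\<in>C. ball (fst i) (5 * snd i))"
    by (rule Vitali_covering_lemma_balls[OF order_refl, of K snd "?I / c" fst]) (use r in auto)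
  define W where "W = (\<Union>i\<in>C. ball (fst i) (5 * snd i))"
  have "emeasure lborel W \<le> ennreal (10 / c * ?I)"
    unfolding W_def
  proof (rule emeasure_countable_UN_le[OF C(1)])
    fix F assume F: "finite F" "F \<subseteq> C"
    have disj: "disjoint_family_on (\<lambda>i. ball (fst i) (snd i)) F"
      using C(3) F(2) unfolding disjoint_family_on_def pairwise_def disjnt_def by blast
    have pos: "0 < snd i" if "i \<in> F" for i using that F C r by blast
    have "emeasure lborel (\<Union>i\<in>F. ball (fst i) (5 * snd i)) \<le> (\<Sum>i\<in>F. emeasure lborel (ball (fst i) (5 * snd i)))"
      using F by (intro emeasure_subadditive_finite) auto
    also have "\<dots> = (\<Sum>i\<in>F. ennreal (10 * snd i))"
    proof (intro sum.cong refl)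
      fix i assume "i \<in> F"
      then show "emeasure lborel (ball (fst i) (5 * snd i)) = ennreal (10 * snd i)"
        using pos[of i] by (simp add: ball_eq_greaterThanLessThan)
    qed
    also have "\<dots> = ennreal (\<Sum>i\<in>F. 10 * snd i)"
      by (rule sum_ennreal) (use pos in \<open>auto intro: less_imp_le\<close>)
    also have "\<dots> \<le> ennreal (10 / c * ?I)"
    proof (rule ennreal_leI)
      have "(\<Sum>i\<in>F. 10 * snd i) \<le> (\<Sum>i\<in>F. 10 / c * (LBINT z:ball (fst i) (snd i). f z))"
        using F C(2) \<open>0 < c\<close> by (intro sum_mono) (force simp: K_def field_simps)
      also have "\<dots> = 10 / c * (\<Sum>i\<in>F. LBINT z:ball (fst i) (snd i). f z)"
        by (simp add: sum_distrib_left)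
      also have "\<dots> \<le> 10 / c * ?I"
        using F \<open>0 < c\<close> by (intro mult_left_mono sum_set_integral_le_integral f disj) auto
      finally show "(\<Sum>i\<in>F. 10 * snd i) \<le> 10 / c * ?I" .
    qed
    finally show "emeasure lborel (\<Union>i\<in>F. ball (fst i) (5 * snd i)) \<le> ennreal (10 / c * ?I)" .
  qed auto
  moreover have "x \<in> W" if "0 < r" "c * r < (LBINT z:ball x r. f z)" for x r
  proof -
    have "(x, r) \<in> K" using that by (simp add: K_def)
    then have "x \<in> (\<Union>i\<in>K. ball (fst i) (snd i))" using \<open>0 < r\<close> by force
    then show ?thesis using C(4) unfolding W_def by blast
  qed
  moreover have "open W" by (auto simp: W_def)
  ultimately show ?thesis using that by blast
qed

section \<open>Lebesgue differentiation\<close>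

text \<open>Meant for exceptional sets whose measurability is unknown: covers of arbitrarily small
  measure make such a set negligible, hence null for the completed measure.\<close>

lemma AE_lborel_outerI:
  fixes P :: "real \<Rightarrow> bool"
  assumes "\<And>e. 0 < e \<Longrightarrow> \<exists>T\<in>sets borel. emeasure lborel T \<le> ennreal e \<and> {x. \<not> P x} \<subseteq> T"
  shows "AE x in lborel. P x"
proof -
  have "negligible {x. \<not> P x}"
    unfolding negligible_outer_le
  proof (intro allI impI)
    fix e :: real assume "0 < e"
    then obtain T where T: "T \<in> sets borel" "emeasure lborel T \<le> ennreal e" "{x. \<not> P x} \<subseteq> T"
      using assms by blast
    have "emeasure lborel T < \<infinity>"
      using T(2) by (simp add: le_less_trans)
    then have "T \<in> lmeasurable"
      using T(1) by (intro fmeasurableI) auto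
    moreover have "measure lebesgue T \<le> e"
      using T(1,2) \<open>0 < e\<close> by (simp add: measure_def enn2real_leI)
    ultimately show "\<exists>T. {x. \<not> P x} \<subseteq> T \<and> T \<in> lmeasurable \<and> measure lebesgue T \<le> e"
      using T(3) by blast
  qed
  then have "{x. \<not> P x} \<in> null_sets lebesgue"
    by (simp add: negligible_iff_null_sets)
  then have "AE x in lebesgue. P x"
    by (auto dest: AE_not_in)
  then show ?thesis by (simp add: AE_completion_iff)
qed

text \<open>Split \<open>g\<close> into a continuous \<open>h\<close> and a remainder small in L^1.
  Outside a set of measure at most \<open>e\<close> the remainder is at most \<open>c\<close> both
  at the point and, relative to the radius, over balls. The 4 collects \<open>c\<close> from the
  oscillation of \<open>h\<close>, \<open>c\<close> from the remainder at \<open>x\<close>, and 2*c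
  from its integral over a ball of radius 2*|y - x|.\<close>

lemma lebesgue_differentiation_approx:
  fixes F g :: "real \<Rightarrow> real"
  assumes int: "integrable lborel g"
    and F: "\<And>x y. x \<le> y \<Longrightarrow> F y - F x = (LBINT z:{x..y}. g z)" and "0 < c"
  shows "AE x in lborel. \<exists>\<delta>>0. \<forall>y. \<bar>y - x\<bar> < \<delta> \<longrightarrow> \<bar>F y - F x - g x * (y - x)\<bar> \<le> 4 * c * \<bar>y - x\<bar>"
proof (rule AE_lborel_outerI)
  fix e :: real assume "0 < e"
  have [measurable]: "g \<in> borel_measurable borel"
    using int by (simp add: borel_measurable_integrable)
  \<comment> \<open>Chosen so that 11/c * \<kappa> is at most \<open>e\<close>: the maximal
    inequality contributes 10 and Markov's inequality 1.\<close>
  define \<kappa> where "\<kappa> = e * c / 20"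
  have "0 < \<kappa>" using \<open>0 < e\<close> \<open>0 < c\<close> by (simp add: \<kappa>_def)
  obtain h R where h: "continuous_on UNIV h" "\<And>x. R < \<bar>x\<bar> \<Longrightarrow> h x = (0::real)"
    and k: "integrable lborel (\<lambda>x. \<bar>g x - h x\<bar>)" "(LBINT x. \<bar>g x - h x\<bar>) < \<kappa>"
    using continuous_compact_support_dense[of g 1 \<kappa>] int \<open>0 < \<kappa>\<close> by (auto simp: integrable_abs)
  let ?k = "\<lambda>x. \<bar>g x - h x\<bar>"
  have [measurable]: "h \<in> borel_measurable borel"
    using h(1) by (rule borel_measurable_continuous_onI)
  obtain W where W: "open W" "emeasure lborel W \<le> ennreal (10 / c * integral\<^sup>L lborel ?k)"
    "\<And>x r. 0 < r \<Longrightarrow> c * r < (LBINT z:ball x r. ?k z) \<Longrightarrow> x \<in> W"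
    using maximal_weak_type[OF k(1) _ \<open>0 < c\<close>] by auto
  define V where "V = {x \<in> space lborel. ?k x \<ge> c}"
  have V: "V \<in> sets borel" "emeasure lborel V \<le> ennreal (1 / c * integral\<^sup>L lborel ?k)"
    unfolding V_def using integral_Markov_inequality[OF k(1) _ \<open>0 < c\<close>] by auto
  have "emeasure lborel (W \<union> V) \<le> emeasure lborel W + emeasure lborel V"
    using W V by (intro emeasure_subadditive) auto
  also have "\<dots> \<le> ennreal (10 / c * integral\<^sup>L lborel ?k) + ennreal (1 / c * integral\<^sup>L lborel ?k)"
    by (intro add_mono W V)
  also have "\<dots> = ennreal (10 / c * integral\<^sup>L lborel ?k + 1 / c * integral\<^sup>L lborel ?k)"
    using \<open>0 < c\<close> by (subst ennreal_plus) auto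
  also have "\<dots> \<le> ennreal e"
  proof (rule ennreal_leI)
    have "10 / c * integral\<^sup>L lborel ?k + 1 / c * integral\<^sup>L lborel ?k = 11 / c * integral\<^sup>L lborel ?k"
      by (simp add: field_simps)
    also have "\<dots> \<le> 11 / c * \<kappa>" using k(2) \<open>0 < c\<close> by (intro mult_left_mono) auto
    also have "\<dots> \<le> e" using \<open>0 < c\<close> \<open>0 < e\<close> by (simp add: \<kappa>_def)
    finally show "10 / c * integral\<^sup>L lborel ?k + 1 / c * integral\<^sup>L lborel ?k \<le> e" .
  qed
  finally have "emeasure lborel (W \<union> V) \<le> ennreal e" .
  moreover have "W \<union> V \<in> sets borel" using W V by auto
  moreover have "\<exists>\<delta>>0. \<forall>y. \<bar>y - x\<bar> < \<delta> \<longrightarrow> \<bar>F y - F x - g x * (y - x)\<bar> \<le> 4 * c * \<bar>y - x\<bar>"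
    if x: "x \<notin> W \<union> V" for x
  proof -
    obtain \<delta> where \<delta>: "\<delta> > 0" "\<And>z. \<bar>z - x\<bar> < \<delta> \<Longrightarrow> \<bar>h z - h x\<bar> \<le> c"
      using h(1) \<open>0 < c\<close> unfolding continuous_on_iff dist_real_def by (metis UNIV_I less_imp_le)
    have "\<bar>F y - F x - g x * (y - x)\<bar> \<le> 4 * c * \<bar>y - x\<bar>" if y: "\<bar>y - x\<bar> < \<delta>" for y
    proof (cases "y = x")
      case False
      define l u where "l = min x y" and "u = max x y"
      have lu: "l \<le> u" "u - l = \<bar>y - x\<bar>" by (auto simp: l_def u_def)
      have ig: "set_integrable lborel {l..u} g" and ik: "set_integrable lborel {l..u} ?k"
        and ik2: "set_integrable lborel (ball x (2 * \<bar>y - x\<bar>)) ?k"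
        by (auto intro: set_integrable_lborel int k(1))
      note ic = set_integrable_const_Icc[of l u] and cst = set_integral_const_Icc[OF lu(1)]
      have "\<bar>F y - F x - g x * (y - x)\<bar> = \<bar>(F u - F l) - (u - l) * g x\<bar>"
        by (auto simp: l_def u_def min_def max_def algebra_simps abs_if)
      also have "\<dots> = \<bar>LBINT z:{l..u}. g z - g x\<bar>"
        using ig ic by (simp add: F[OF lu(1)] cst)
      also have "\<dots> \<le> (LBINT z:{l..u}. \<bar>g z - g x\<bar>)"
        by (rule abs_set_integral_le)
      also have "\<dots> \<le> (LBINT z:{l..u}. ?k z + 2 * c)"
      proof (rule set_integral_mono)
        show "set_integrable lborel {l..u} (\<lambda>z. \<bar>g z - g x\<bar>)"
          using ig ic by (intro set_integrable_abs set_integral_diff)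
        show "set_integrable lborel {l..u} (\<lambda>z. ?k z + 2 * c)"
          using ik ic by (intro set_integral_add)
        fix z assume "z \<in> {l..u}"
        then have "\<bar>z - x\<bar> < \<delta>" using y by (auto simp: l_def u_def)
        then have "\<bar>h z - h x\<bar> \<le> c" by (rule \<delta>(2))
        moreover have "\<bar>g x - h x\<bar> < c" using x by (auto simp: V_def)
        ultimately show "\<bar>g z - g x\<bar> \<le> ?k z + 2 * c" by linarith
      qed
      also have "\<dots> = (LBINT z:{l..u}. ?k z) + (u - l) * (2 * c)"
        using ik ic by (simp add: cst)
      \<comment> \<open>The doubled radius puts the end point \<open>y\<close> inside the open
        ball.\<close>
      also have "(LBINT z:{l..u}. ?k z) \<le> (LBINT z:ball x (2 * \<bar>y - x\<bar>). ?k z)"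
      proof -
        have "z \<in> ball x (2 * \<bar>y - x\<bar>)" if "z \<in> {l..u}" for z
          using that False by (auto simp: l_def u_def dist_real_def min_def max_def split: if_splits)
        then show ?thesis
          using ik ik2 unfolding set_lebesgue_integral_def set_integrable_def
          by (intro integral_mono) (auto simp: indicator_def simp del: mem_ball)
      qed
      also have "\<dots> \<le> c * (2 * \<bar>y - x\<bar>)"
        using W(3)[of "2 * \<bar>y - x\<bar>" x] False x by (cases "c * (2 * \<bar>y - x\<bar>) < (LBINT z:ball x (2 * \<bar>y -
          x\<bar>). ?k z)") auto
      finally show ?thesis using lu by (simp add: algebra_simps)
    qed auto
    then show ?thesis using \<delta>(1) by blast
  qed
  ultimately show "\<exists>T\<in>sets borel. emeasure lborel T \<le> ennreal e \<and>
    {x. \<not> (\<exists>\<delta>>0. \<forall>y. \<bar>y - x\<bar> < \<delta> \<longrightarrow> \<bar>F y - F x - g x * (y - x)\<bar> \<le> 4 * c * \<bar>y - x\<bar>)} \<subseteq> T"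
    by blast
qed

theorem lebesgue_differentiation:
  fixes F g :: "real \<Rightarrow> real"
  assumes "integrable lborel g" "\<And>x y. x \<le> y \<Longrightarrow> F y - F x = (LBINT z:{x..y}. g z)"
  shows "AE x in lborel. (F has_real_derivative g x) (at x)"
proof -
  have "AE x in lborel. \<forall>n. \<exists>\<delta>>0. \<forall>y. \<bar>y - x\<bar> < \<delta> \<longrightarrow>
      \<bar>F y - F x - g x * (y - x)\<bar> \<le> 4 * inverse (real (Suc n)) * \<bar>y - x\<bar>"
    unfolding AE_all_countable
    by (intro allI lebesgue_differentiation_approx[OF assms]) auto
  then show ?thesis
  proof eventually_elim
    fix x
    assume *: "\<forall>n. \<exists>\<delta>>0. \<forall>y. \<bar>y - x\<bar> < \<delta> \<longrightarrow>
      \<bar>F y - F x - g x * (y - x)\<bar> \<le> 4 * inverse (real (Suc n)) * \<bar>y - x\<bar>"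
    have "\<exists>d>0. \<forall>y. norm (y - x) < d \<longrightarrow> norm (F y - F x - g x * (y - x)) \<le> e * norm (y - x)" if "0 < e" for e
    proof -
      obtain n where n: "inverse (real (Suc n)) < e / 4"
        using reals_Archimedean[of "e / 4"] \<open>0 < e\<close> by auto
      obtain \<delta> where \<delta>: "\<delta> > 0" "\<And>y. \<bar>y - x\<bar> < \<delta> \<Longrightarrow> \<bar>F y - F x - g x * (y - x)\<bar> \<le>
        4 * inverse (real (Suc n)) * \<bar>y - x\<bar>"
        using * by blast
      have "4 * inverse (real (Suc n)) * \<bar>y - x\<bar> \<le> e * \<bar>y - x\<bar>" for y
        using n by (intro mult_right_mono) auto
      with \<delta> show ?thesis unfolding real_norm_def by (meson order_trans)
    qed
    then show "(F has_real_derivative g x) (at x)"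
      unfolding has_field_derivative_def has_derivative_at_alt by (auto simp: bounded_linear_mult_right)
  qed
qed

text \<open>Freezing \<open>F\<close> outside the interval corresponds to extending \<open>g\<close>
  by zero, which reduces the claim to the global theorem; in the open interval nothing has
  changed.\<close>

lemma lebesgue_differentiation_local:
  fixes F g :: "real \<Rightarrow> real"
  assumes int: "set_integrable lborel {a..b} g"
    and F: "\<And>x y. a \<le> x \<Longrightarrow> x \<le> y \<Longrightarrow> y \<le> b \<Longrightarrow> F y - F x = (LBINT z:{x..y}. g z)"
  shows "AE x in lborel. a < x \<longrightarrow> x < b \<longrightarrow> (F has_real_derivative g x) (at x)"
proof (cases "a < b")
  case True
  define C where "C x = max a (min b x)" for x
  have "AE x in lborel. ((\<lambda>x. F (C x)) has_real_derivative indicator {a..b} x * g x) (at x)"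
  proof (rule lebesgue_differentiation)
    show "integrable lborel (\<lambda>x. indicator {a..b} x * g x)"
      using int by (simp add: set_integrable_def)
    fix x y :: real assume "x \<le> y"
    then have C: "a \<le> C x" "C x \<le> C y" "C y \<le> b" using True by (auto simp: C_def)
    have "F (C y) - F (C x) = (LBINT z:{C x..C y}. g z)"
      by (rule F[OF C])
    also have "\<dots> = (LBINT z:{x..y}. indicator {a..b} z * g z)"
      unfolding set_lebesgue_integral_def
    proof (rule Bochner_Integration.integral_cong_AE)
      have m: "(\<lambda>z. indicator {a..b} z * g z) \<in> borel_measurable lborel"
        using borel_measurable_integrable[OF int[unfolded set_integrable_def]] by simp
      have "(\<lambda>z. indicator {C x..C y} z * (indicator {a..b} z * g z)) \<in> borel_measurable lborel"
        by (intro borel_measurable_times m) simp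
      also have "(\<lambda>z. indicator {C x..C y} z * (indicator {a..b} z * g z)) =
        (\<lambda>z. indicator {C x..C y} z *\<^sub>R g z)"
        using C by (auto simp: fun_eq_iff indicator_def)
      finally show "(\<lambda>z. indicator {C x..C y} z *\<^sub>R g z) \<in> borel_measurable lborel" .
      show "(\<lambda>z. indicator {x..y} z *\<^sub>R (indicator {a..b} z * g z)) \<in> borel_measurable lborel"
        by (intro borel_measurable_scaleR m) simp
      have "AE z in lborel. z \<noteq> a \<and> z \<noteq> b" by (auto intro: AE_conjI AE_lborel_singleton)
      then show "AE z in lborel. indicator {C x..C y} z *\<^sub>R g z =
        indicator {x..y} z *\<^sub>R (indicator {a..b} z * g z)"
        by eventually_elim (use \<open>x \<le> y\<close> True in \<open>auto simp: indicator_def C_def max_def min_def split: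
          if_splits\<close>)
    qed
    finally show "F (C y) - F (C x) = (LBINT z:{x..y}. indicator {a..b} z * g z)" .
  qed
  then show ?thesis
  proof eventually_elim
    fix x assume *: "((\<lambda>x. F (C x)) has_real_derivative indicator {a..b} x * g x) (at x)"
    show "a < x \<longrightarrow> x < b \<longrightarrow> (F has_real_derivative g x) (at x)"
    proof (intro impI)
      assume x: "a < x" "x < b"
      show "(F has_real_derivative g x) (at x)"
      proof (rule has_field_derivative_transform_within_open[of _ _ _ "{a<..<b}"])
        show "((\<lambda>x. F (C x)) has_real_derivative g x) (at x)" using * x by simp
      qed (use x in \<open>auto simp: C_def\<close>)
    qed
  qed
qed auto

corollary lebesgue_differentiation_locally_integrable:
  fixes F g :: "real \<Rightarrow> real"
  assumes "\<And>a b. set_integrable lborel {a..b} g"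
    and "\<And>x y. x \<le> y \<Longrightarrow> F y - F x = (LBINT z:{x..y}. g z)"
  shows "AE x in lborel. (F has_real_derivative g x) (at x)"
proof -
  have "AE x in lborel. \<forall>n::nat. - real n < x \<longrightarrow> x < real n \<longrightarrow> (F has_real_derivative g x) (at x)"
    unfolding AE_all_countable using assms by (intro allI lebesgue_differentiation_local) auto
  then show ?thesis
    by eventually_elim (metis abs_less_iff minus_less_iff reals_Archimedean2)
qed

section \<open>Absolutely continuous functions\<close>

text \<open>The index type is arbitrary, whereas \<open>abs_cont_on\<close> counts with natural
  numbers. Cells of a covering and pairs of indices can thus serve as indices directly;
  \<open>abs_cont_modulusD\<close> does the renumbering.\<close>

definition interval_family :: "'i set \<Rightarrow> ('i \<Rightarrow> real) \<Rightarrow> ('i \<Rightarrow> real) \<Rightarrow> bool" where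
  "interval_family I p q \<longleftrightarrow> finite I \<and> (\<forall>i\<in>I. p i \<le> q i) \<and>
     (\<forall>i\<in>I. \<forall>j\<in>I. i \<noteq> j \<longrightarrow> {p i<..<q i} \<inter> {p j<..<q j} = {})"

definition abs_cont_modulus :: "('a \<Rightarrow> 'a \<Rightarrow> real) \<Rightarrow> real set \<Rightarrow> (real \<Rightarrow> 'a) \<Rightarrow> real \<Rightarrow> real \<Rightarrow> bool" where
  "abs_cont_modulus d S f \<epsilon> \<delta> \<longleftrightarrow> (\<forall>n p q. interval_family {..<n::nat} p q \<longrightarrow>
     (\<forall>i<n. p i \<in> S \<and> q i \<in> S) \<longrightarrow> (\<Sum>i<n. q i - p i) < \<delta> \<longrightarrow> (\<Sum>i<n. d (f (p i)) (f (q i))) < \<epsilon>)"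

lemma abs_cont_on_iff: "abs_cont_on d S f \<longleftrightarrow> (\<forall>\<epsilon>>0. \<exists>\<delta>>0. abs_cont_modulus d S f \<epsilon> \<delta>)"
proof -
  have *: "abs_cont_modulus d S f \<epsilon> \<delta> \<longleftrightarrow> (\<forall>(n::nat) p q. (\<forall>i<n. p i \<in> S \<and> q i \<in> S \<and> p i \<le> q i) \<longrightarrow>
        (\<forall>i<n. \<forall>j<n. i \<noteq> j \<longrightarrow> {p i<..<q i} \<inter> {p j<..<q j} = {}) \<longrightarrow>
        (\<Sum>i<n. q i - p i) < \<delta> \<longrightarrow> (\<Sum>i<n. d (f (p i)) (f (q i))) < \<epsilon>)" for \<epsilon> \<delta>
    unfolding abs_cont_modulus_def interval_family_def Ball_def lessThan_iff
    by (intro iff_allI) (simp only: finite_lessThan, blast)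
  show ?thesis unfolding abs_cont_on_def * by blast
qed

lemma abs_cont_modulusD:
  fixes I :: "'i set"
  assumes *: "abs_cont_modulus d S f \<epsilon> \<delta>"
    and "interval_family I p q" "\<And>i. i \<in> I \<Longrightarrow> p i \<in> S \<and> q i \<in> S" "(\<Sum>i\<in>I. q i - p i) < \<delta>"
  shows "(\<Sum>i\<in>I. d (f (p i)) (f (q i))) < \<epsilon>"
proof -
  obtain h where h: "bij_betw h {..<card I} I"
    using ex_bij_betw_nat_finite[of I] assms(2) by (auto simp: interval_family_def atLeast0LessThan)
  then have hI: "h i \<in> I" if "i < card I" for i
    using that by (auto simp: bij_betw_def)
  have "interval_family {..<card I} (\<lambda>i. p (h i)) (\<lambda>i. q (h i))"
    using assms(2) hI inj_on_eq_iff[OF bij_betw_imp_inj_on[OF h]]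
    unfolding interval_family_def by (metis finite_lessThan lessThan_iff)
  moreover have "(\<Sum>i<card I. q (h i) - p (h i)) < \<delta>"
    using assms(4) sum.reindex_bij_betw[OF h, of "\<lambda>i. q i - p i"] by simp
  ultimately have "(\<Sum>i<card I. d (f (p (h i))) (f (q (h i)))) < \<epsilon>"
    using * assms(3) hI unfolding abs_cont_modulus_def by blast
  then show ?thesis
    using sum.reindex_bij_betw[OF h, of "\<lambda>i. d (f (p i)) (f (q i))"] by simp
qed

lemma interval_family_sum_le:
  assumes "interval_family I p q" "U \<in> sets borel" "emeasure lborel U < \<infinity>"
    and "\<And>i. i \<in> I \<Longrightarrow> {p i<..<q i} \<subseteq> U"
  shows "(\<Sum>i\<in>I. q i - p i) \<le> measure lborel U"
proof -
  have "(\<Sum>i\<in>I. q i - p i) = (\<Sum>i\<in>I. LBINT z:{p i<..<q i}. indicator U z)"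
  proof (intro sum.cong refl)
    fix i assume i: "i \<in> I"
    have "(LBINT z:{p i<..<q i}. indicator U z) = (LBINT z. indicator {p i<..<q i} z :: real)"
      unfolding set_lebesgue_integral_def using assms(4)[OF i]
      by (intro Bochner_Integration.integral_cong) (auto simp: indicator_def)
    then show "q i - p i = (LBINT z:{p i<..<q i}. indicator U z)"
      using assms(1) i by (simp add: interval_family_def)
  qed
  also have "\<dots> \<le> integral\<^sup>L lborel (indicator U)"
    using assms by (intro sum_set_integral_le_integral integrable_real_indicator)
      (auto simp: interval_family_def disjoint_family_on_def)
  finally show ?thesis using assms by simp
qed

definition clamp_to :: "real \<Rightarrow> real \<Rightarrow> real \<Rightarrow> real" where
  "clamp_to a b z = max a (min b z)"

lemma clamp_to_inside: "a \<le> z \<Longrightarrow> z \<le> b \<Longrightarrow> clamp_to a b z = z"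
  and clamp_to_left: "z \<le> a \<Longrightarrow> a \<le> b \<Longrightarrow> clamp_to a b z = a"
  and clamp_to_right: "b \<le> z \<Longrightarrow> a \<le> b \<Longrightarrow> clamp_to a b z = b"
  by (auto simp: clamp_to_def)

lemma interval_family_clamp:
  assumes "interval_family I p q" "a \<le> b"
  shows "interval_family I (\<lambda>i. clamp_to a b (p i)) (\<lambda>i. clamp_to a b (q i))"
    "i \<in> I \<Longrightarrow> clamp_to a b (q i) - clamp_to a b (p i) \<le> q i - p i"
proof -
  have "{clamp_to a b (p i)<..<clamp_to a b (q i)} \<subseteq> {p i<..<q i}" for i
    by (auto simp: clamp_to_def max_def min_def split: if_splits)
  then have "{clamp_to a b (p i)<..<clamp_to a b (q i)} \<inter> {clamp_to a b (p j)<..<clamp_to a b (q j)} = {}"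
    if "{p i<..<q i} \<inter> {p j<..<q j} = {}" for i j
    using that by blast
  moreover have "clamp_to a b (p i) \<le> clamp_to a b (q i)" if "p i \<le> q i" for i
    using that by (auto simp: clamp_to_def)
  ultimately show "interval_family I (\<lambda>i. clamp_to a b (p i)) (\<lambda>i. clamp_to a b (q i))"
    using assms(1) unfolding interval_family_def by presburger
  show "i \<in> I \<Longrightarrow> clamp_to a b (q i) - clamp_to a b (p i) \<le> q i - p i"
    using assms unfolding interval_family_def clamp_to_def by (auto simp: min_def max_def)
qed

text \<open>Clamping shortens intervals and keeps them nonoverlapping. The extension by constants to
  the whole line prepares for the measure generated by a monotone function.\<close>

lemma abs_cont_on_clamp:
  assumes "abs_cont_on d {a..b} f" "a \<le> b"
  shows "abs_cont_on d UNIV (\<lambda>x. f (clamp_to a b x))"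
proof (unfold abs_cont_on_iff, intro allI impI)
  fix \<epsilon> :: real assume "0 < \<epsilon>"
  obtain \<delta> where \<delta>: "0 < \<delta>" "abs_cont_modulus d {a..b} f \<epsilon> \<delta>"
    using assms(1) \<open>0 < \<epsilon>\<close> unfolding abs_cont_on_iff by blast
  have "(\<Sum>i<n. d (f (clamp_to a b (p i))) (f (clamp_to a b (q i)))) < \<epsilon>"
    if "interval_family {..<n} p q" "(\<Sum>i<n. q i - p i) < \<delta>" for n :: nat and p q
  proof (rule abs_cont_modulusD[OF \<delta>(2)])
    show "interval_family {..<n} (\<lambda>i. clamp_to a b (p i)) (\<lambda>i. clamp_to a b (q i))"
      by (rule interval_family_clamp[OF that(1) assms(2)])
    have "(\<Sum>i<n. clamp_to a b (q i) - clamp_to a b (p i)) \<le> (\<Sum>i<n. q i - p i)"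
      by (intro sum_mono interval_family_clamp(2)[OF that(1) assms(2)])
    then show "(\<Sum>i<n. clamp_to a b (q i) - clamp_to a b (p i)) < \<delta>"
      using that(2) by linarith
  qed (use assms(2) in \<open>auto simp: clamp_to_def\<close>)
  then show "\<exists>\<delta>>0. abs_cont_modulus d UNIV (\<lambda>x. f (clamp_to a b x)) \<epsilon> \<delta>"
    using \<delta>(1) unfolding abs_cont_modulus_def by blast
qed

lemma abs_cont_on_imp_continuous_on:
  fixes f :: "real \<Rightarrow> real"
  assumes "abs_cont_on dist S f"
  shows "continuous_on S f"
  unfolding continuous_on_iff
proof (intro ballI allI impI)
  fix x \<epsilon> :: real assume x: "x \<in> S" and "0 < \<epsilon>"
  obtain \<delta> where \<delta>: "0 < \<delta>" "abs_cont_modulus dist S f \<epsilon> \<delta>"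
    using assms \<open>0 < \<epsilon>\<close> unfolding abs_cont_on_iff by blast
  have "dist (f y) (f x) < \<epsilon>" if y: "y \<in> S" "dist y x < \<delta>" for y
  proof -
    have "dist (f l) (f u) < \<epsilon>" if "l \<in> S" "u \<in> S" "l \<le> u" "u - l < \<delta>" for l u
      using abs_cont_modulusD[OF \<delta>(2), of "{..<1::nat}" "\<lambda>_. l" "\<lambda>_. u"] that
      by (simp add: interval_family_def)
    from this[of x y] this[of y x] x y show ?thesis
      by (cases "x \<le> y") (auto simp: dist_real_def abs_minus_commute)
  qed
  then show "\<exists>d>0. \<forall>x'\<in>S. dist x' x < d \<longrightarrow> dist (f x') (f x) < \<epsilon>"
    using \<delta>(1) by blast
qed

text \<open>The supremum of this set is the positive variation of \<open>f\<close>. The families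
  need not fill the interval, so enlarging the interval only enlarges the set.\<close>

definition pos_variation_sums :: "(real \<Rightarrow> real) \<Rightarrow> real \<Rightarrow> real \<Rightarrow> real set" where
  "pos_variation_sums f x y = {s. \<exists>(n::nat) p q. interval_family {..<n} p q \<and> (\<forall>i<n. x \<le> p i \<and> q i \<le> y) \<and>
     s = (\<Sum>i<n. max 0 (f (q i) - f (p i)))}"

lemma pos_variation_sums_0: "0 \<in> pos_variation_sums f x y"
  unfolding pos_variation_sums_def interval_family_def
  by (intro CollectI exI[of _ "0::nat"] exI[of _ "\<lambda>_. 0"]) simp

lemma pos_variation_sums_mono: "y \<le> z \<Longrightarrow> pos_variation_sums f x y \<subseteq> pos_variation_sums f x z"
  unfolding pos_variation_sums_def by (intro Collect_mono ex_mono impI) (auto intro: order_trans)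

lemma pos_variation_sums_append:
  assumes "s \<in> pos_variation_sums f x y" "x \<le> y" "y \<le> z"
  shows "s + max 0 (f z - f y) \<in> pos_variation_sums f x z"
proof -
  obtain n :: nat and p q where n: "interval_family {..<n} p q" "\<forall>i<n. x \<le> p i \<and> q i \<le> y"
    "s = (\<Sum>i<n. max 0 (f (q i) - f (p i)))"
    using assms(1) by (auto simp: pos_variation_sums_def)
  let ?p = "\<lambda>i. if i < n then p i else y" and ?q = "\<lambda>i. if i < n then q i else z"
  have "interval_family {..<Suc n} ?p ?q"
    using n assms unfolding interval_family_def by (auto simp: less_Suc_eq)
  moreover have "\<forall>i<Suc n. x \<le> ?p i \<and> ?q i \<le> z"
    using n(2) assms by force
  moreover have "s + max 0 (f z - f y) = (\<Sum>i<Suc n. max 0 (f (?q i) - f (?p i)))"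
    by (simp add: n(3))
  ultimately show ?thesis unfolding pos_variation_sums_def by blast
qed

text \<open>Clamping every interval to the two halves produces two admissible families, and the
  positive part of a sum is at most the sum of the positive parts.\<close>

lemma pos_variation_sums_split:
  assumes "s \<in> pos_variation_sums f x z" "x \<le> y" "y \<le> z"
  obtains s1 s2 where "s1 \<in> pos_variation_sums f x y" "s2 \<in> pos_variation_sums f y z" "s \<le> s1 + s2"
proof -
  obtain n :: nat and p q where n: "interval_family {..<n} p q" "\<forall>i<n. x \<le> p i \<and> q i \<le> z"
    "s = (\<Sum>i<n. max 0 (f (q i) - f (p i)))"
    using assms(1) by (auto simp: pos_variation_sums_def)
  have pq: "p i \<le> q i" if "i < n" for i using n that by (auto simp: interval_family_def)
  define S where "S a b = (\<Sum>i<n. max 0 (f (clamp_to a b (q i)) - f (clamp_to a b (p i))))" for a b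
  have mem: "S a b \<in> pos_variation_sums f a b" if "a \<le> b" for a b
    unfolding S_def pos_variation_sums_def using interval_family_clamp(1)[OF n(1) that] that
    by (intro CollectI exI conjI) (auto simp: clamp_to_def)
  have "s \<le> S x y + S y z"
    unfolding n(3) S_def sum.distrib[symmetric]
  proof (rule sum_mono)
    fix i assume "i \<in> {..<n}"
    then have i: "x \<le> p i" "p i \<le> q i" "q i \<le> z" using n pq by auto
    then show "max 0 (f (q i) - f (p i)) \<le> max 0 (f (clamp_to x y (q i)) - f (clamp_to x y (p i)))
        + max 0 (f (clamp_to y z (q i)) - f (clamp_to y z (p i)))"
    proof -
      consider "q i \<le> y" | "y \<le> p i" | "p i < y" "y < q i" by linarith
      then show ?thesis
      proof cases
        case 1 then show ?thesis using i assms(2,3) by (simp add: clamp_to_inside clamp_to_left)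
      next
        case 2 then show ?thesis using i assms(2,3) by (simp add: clamp_to_inside clamp_to_right)
      next
        case 3 then show ?thesis using i assms(2,3)
          by (simp add: clamp_to_inside clamp_to_right clamp_to_left)
      qed
    qed
  qed
  then show ?thesis using that mem assms by blast
qed

text \<open>On pieces shorter than the \<delta> that belongs to 1 every sum is at most 1, and
  finitely many such pieces fill the interval.\<close>

lemma pos_variation_sums_bdd:
  assumes "abs_cont_on dist {a..b} f"
  shows "\<exists>C. \<forall>s\<in>pos_variation_sums f a b. s \<le> C"
proof -
  obtain \<delta> where \<delta>: "0 < \<delta>" "abs_cont_modulus dist {a..b} f 1 \<delta>"
    using assms zero_less_one unfolding abs_cont_on_iff by blast
  have small: "s \<le> 1" if s: "s \<in> pos_variation_sums f x y" and xy: "a \<le> x" "x \<le> y" "y \<le> b" "y - x < \<delta>" for s x y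
  proof -
    obtain n :: nat and p q where n: "interval_family {..<n} p q" "\<forall>i<n. x \<le> p i \<and> q i \<le> y"
      "s = (\<Sum>i<n. max 0 (f (q i) - f (p i)))"
      using s by (auto simp: pos_variation_sums_def)
    have "(\<Sum>i<n. q i - p i) \<le> measure lborel {x..y}"
      using n by (intro interval_family_sum_le) (auto simp: emeasure_lborel_Icc_eq)
    then have "(\<Sum>i<n. q i - p i) < \<delta>" using xy by simp
    then have "(\<Sum>i<n. dist (f (p i)) (f (q i))) < 1"
    proof (intro abs_cont_modulusD[OF \<delta>(2) n(1)])
      fix i assume "i \<in> {..<n}"
      then have "x \<le> p i" "q i \<le> y" "p i \<le> q i" using n by (auto simp: interval_family_def)
      then show "p i \<in> {a..b} \<and> q i \<in> {a..b}" using xy by auto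
    qed
    moreover have "s \<le> (\<Sum>i<n. dist (f (p i)) (f (q i)))"
      unfolding n(3) by (intro sum_mono) (auto simp: dist_real_def)
    ultimately show ?thesis by simp
  qed
  \<comment> \<open>Steps of \<delta>/2 remain strictly below \<delta>. The degenerate interval at k
    = 0 is already charged with 1, hence \<open>Suc k\<close>.\<close>
  have "\<forall>s\<in>pos_variation_sums f a y. s \<le> real (Suc k)" if "a \<le> y" "y \<le> b" "y \<le> a + real k * (\<delta> / 2)" for k y
    using that
  proof (induction k arbitrary: y)
    case 0
    then show ?case using small[of _ a y] \<delta>(1) by auto
  next
    case (Suc k)
    define x where "x = max a (y - \<delta> / 2)"
    have x: "a \<le> x" "x \<le> y" "x \<le> b" "y - x < \<delta>" "x \<le> a + real k * (\<delta> / 2)"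
      using Suc.prems \<delta>(1) unfolding x_def of_nat_Suc distrib_right by auto
    show ?case
    proof
      fix s assume "s \<in> pos_variation_sums f a y"
      then obtain s1 s2 where "s1 \<in> pos_variation_sums f a x" "s2 \<in> pos_variation_sums f x y" "s \<le> s1 + s2"
        by (rule pos_variation_sums_split[OF _ x(1,2)])
      moreover have "s1 \<le> real (Suc k)" using Suc.IH[OF x(1,3,5)] calculation by blast
      moreover have "s2 \<le> 1" using small calculation x Suc.prems by blast
      ultimately show "s \<le> real (Suc (Suc k))" by simp
    qed
  qed
  moreover obtain k :: nat where "(b - a) / (\<delta> / 2) \<le> real k"
    using real_arch_simple by blast
  ultimately have *: "a \<le> b \<Longrightarrow> \<forall>s\<in>pos_variation_sums f a b. s \<le> real (Suc k)"
    using \<delta>(1) by (auto simp: field_simps)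
  show ?thesis
  proof (cases "a \<le> b")
    case False
    then have "s \<le> 0" if s: "s \<in> pos_variation_sums f a b" for s
    proof -
      obtain n :: nat and p q where n: "interval_family {..<n} p q" "\<forall>i<n. a \<le> p i \<and> q i \<le> b"
        "s = (\<Sum>i<n. max 0 (f (q i) - f (p i)))"
        using s by (auto simp: pos_variation_sums_def)
      have "n = 0"
      proof (rule ccontr)
        assume "n \<noteq> 0"
        then have "a \<le> p 0" "q 0 \<le> b" "p 0 \<le> q 0" using n by (auto simp: interval_family_def)
        then show False using False by linarith
      qed
      then show ?thesis using n by simp
    qed
    then show ?thesis by blast
  next
    case True
    show ?thesis using *[OF True] by (rule exI)
  qed
qed

text \<open>Jordan decomposition: with \<open>P\<close> the positive variation from
  \<open>a\<close>, both \<open>P\<close> and \<open>P - f\<close> increase. Absolute continuity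
  passes to \<open>P\<close> because each increment of \<open>P\<close> is nearly a variation sum of
  \<open>f\<close> over intervals inside the given one, and all these intervals together have no
  larger total length than the given family.\<close>

lemma abs_cont_on_pos_variation:
  assumes ac: "abs_cont_on dist {a..b} f"
  obtains P :: "real \<Rightarrow> real" where
    "\<And>x y. a \<le> x \<Longrightarrow> x \<le> y \<Longrightarrow> y \<le> b \<Longrightarrow> P x \<le> P y \<and> f y - f x \<le> P y - P x"
    "abs_cont_on dist {a..b} P"
proof -
  define P where "P x = Sup (pos_variation_sums f a x)" for x
  obtain C where C: "\<forall>s\<in>pos_variation_sums f a b. s \<le> C"
    using pos_variation_sums_bdd[OF ac] by blast
  have bdd: "bdd_above (pos_variation_sums f a x)" if "x \<le> b" for x
    using C pos_variation_sums_mono[OF that, of f a] by (meson bdd_aboveI subsetD)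
  have ne: "pos_variation_sums f a x \<noteq> {}" for x
    using pos_variation_sums_0 by blast
  have up: "s \<le> P x" if "s \<in> pos_variation_sums f a x" "x \<le> b" for s x
    unfolding P_def by (rule cSup_upper[OF that(1) bdd[OF that(2)]])
  have inc: "P x + max 0 (f y - f x) \<le> P y" if "a \<le> x" "x \<le> y" "y \<le> b" for x y
  proof -
    have "s \<le> P y - max 0 (f y - f x)" if "s \<in> pos_variation_sums f a x" for s
      using up[OF pos_variation_sums_append[OF that \<open>a \<le> x\<close> \<open>x \<le> y\<close>] \<open>y \<le> b\<close>] by linarith
    then have "P x \<le> P y - max 0 (f y - f x)"
      unfolding P_def[of x] using ne by (intro cSup_least) auto
    then show ?thesis by linarith
  qed
  have near: "\<exists>s\<in>pos_variation_sums f x y. P y - P x \<le> s + \<eta>"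
    if xy: "a \<le> x" "x \<le> y" "y \<le> b" "0 < \<eta>" for x y \<eta>
  proof -
    have "P y - \<eta> < Sup (pos_variation_sums f a y)" using that by (simp add: P_def)
    then obtain s where s: "s \<in> pos_variation_sums f a y" "P y - \<eta> < s"
      by (auto simp: less_cSup_iff[OF ne bdd[OF xy(3)]])
    obtain s1 s2 where "s1 \<in> pos_variation_sums f a x" "s2 \<in> pos_variation_sums f x y" "s \<le> s1 + s2"
      using pos_variation_sums_split[OF s(1) xy(1,2)] by blast
    moreover have "s1 \<le> P x" using calculation(1) xy by (intro up) auto
    ultimately show ?thesis using s(2) by (intro bexI[of _ s2]) auto
  qed
  have "abs_cont_on dist {a..b} P"
  proof (unfold abs_cont_on_iff, intro allI impI)
    fix \<epsilon> :: real assume "0 < \<epsilon>"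
    obtain \<delta> where \<delta>: "0 < \<delta>" "abs_cont_modulus dist {a..b} f (\<epsilon> / 2) \<delta>"
    using ac[unfolded abs_cont_on_iff, rule_format, OF half_gt_zero[OF \<open>0 < \<epsilon>\<close>]] by blast
    have "(\<Sum>i<n. dist (P (p i)) (P (q i))) < \<epsilon>"
      if fam: "interval_family {..<n} p q" and S: "\<forall>i<n. p i \<in> {a..b} \<and> q i \<in> {a..b}"
        and small: "(\<Sum>i<n. q i - p i) < \<delta>" for n :: nat and p q
    proof -
      have pq: "p i \<le> q i" if "i < n" for i using fam that by (auto simp: interval_family_def)
      \<comment> \<open>The n approximation errors together cost at most \<epsilon>/2.\<close>
      define \<eta> where "\<eta> = \<epsilon> / (2 * real (Suc n))"
      have "0 < \<eta>" using \<open>0 < \<epsilon>\<close> by (simp add: \<eta>_def)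
      have "\<forall>i\<in>{..<n}. \<exists>t::nat \<times> (nat \<Rightarrow> real) \<times> (nat \<Rightarrow> real). case t of (m, p', q') \<Rightarrow>
          interval_family {..<m} p' q' \<and> (\<forall>j<m. p i \<le> p' j \<and> q' j \<le> q i) \<and>
          P (q i) - P (p i) \<le> (\<Sum>j<m. max 0 (f (q' j) - f (p' j))) + \<eta>"
      proof
        fix i assume "i \<in> {..<n}"
        then obtain s where "s \<in> pos_variation_sums f (p i) (q i)" "P (q i) - P (p i) \<le> s + \<eta>"
          using near[of "p i" "q i" \<eta>] S pq[of i] \<open>0 < \<eta>\<close> by auto
        then obtain m :: nat and p' q' where "interval_family {..<m} p' q'" "\<forall>j<m. p i \<le> p' j \<and> q' j \<le> q i"
          "P (q i) - P (p i) \<le> (\<Sum>j<m. max 0 (f (q' j) - f (p' j))) + \<eta>"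
          unfolding pos_variation_sums_def by blast
        then show "\<exists>t::nat \<times> (nat \<Rightarrow> real) \<times> (nat \<Rightarrow> real). case t of (m, p', q') \<Rightarrow>
          interval_family {..<m} p' q' \<and> (\<forall>j<m. p i \<le> p' j \<and> q' j \<le> q i) \<and>
          P (q i) - P (p i) \<le> (\<Sum>j<m. max 0 (f (q' j) - f (p' j))) + \<eta>"
          by (intro exI[of _ "(m, p', q')"]) simp
      qed
      from bchoice[OF this] obtain T :: "nat \<Rightarrow> nat \<times> (nat \<Rightarrow> real) \<times> (nat \<Rightarrow> real)"
        where T: "\<forall>i\<in>{..<n}. case T i of (m, p', q') \<Rightarrow>
          interval_family {..<m} p' q' \<and> (\<forall>j<m. p i \<le> p' j \<and> q' j \<le> q i) \<and>
          P (q i) - P (p i) \<le> (\<Sum>j<m. max 0 (f (q' j) - f (p' j))) + \<eta>"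
        by blast
      define m where "m i = fst (T i)" for i
      define p' where "p' t = fst (snd (T (fst t))) (snd t)" for t
      define q' where "q' t = snd (snd (T (fst t))) (snd t)" for t
      have T': "interval_family {..<m i} (\<lambda>j. p' (i, j)) (\<lambda>j. q' (i, j))"
        "j < m i \<Longrightarrow> p i \<le> p' (i, j) \<and> q' (i, j) \<le> q i"
        "P (q i) - P (p i) \<le> (\<Sum>j<m i. max 0 (f (q' (i, j)) - f (p' (i, j)))) + \<eta>" if "i < n" for i j
        using bspec[OF T, of i, unfolded case_prod_beta] that unfolding m_def p'_def q'_def fst_conv
          snd_conv by blast+
      \<comment> \<open>All refined families as one family, indexed by pairs. Members with different
        outer indices are disjoint because the outer intervals are.\<close>
      let ?I = "SIGMA i:{..<n}. {..<m i}"
      have fam': "interval_family ?I p' q'"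
        unfolding interval_family_def
      proof (intro conjI ballI impI)
        fix s t assume s: "s \<in> ?I"
        then show "p' s \<le> q' s" using T'(1)[of "fst s"] by (auto simp: interval_family_def)
        assume t: "t \<in> ?I" and "s \<noteq> t"
        show "{p' s<..<q' s} \<inter> {p' t<..<q' t} = {}"
        proof (cases "fst s = fst t")
          case True
          then show ?thesis using s t \<open>s \<noteq> t\<close> T'(1)[of "fst s"] unfolding interval_family_def
            by (cases s; cases t) auto
        next
          case False
          have "{p' s<..<q' s} \<subseteq> {p (fst s)<..<q (fst s)}" "{p' t<..<q' t} \<subseteq> {p (fst t)<..<q (fst t)}"
            using s t T'(2)[of "fst s" "snd s"] T'(2)[of "fst t" "snd t"] by auto
          moreover have "{p (fst s)<..<q (fst s)} \<inter> {p (fst t)<..<q (fst t)} = {}"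
            using fam s t False by (auto simp: interval_family_def)
          ultimately show ?thesis by blast
        qed
      qed auto
      have sumI: "(\<Sum>t\<in>?I. g t) = (\<Sum>i<n. \<Sum>j<m i. g (i, j))" for g :: "nat \<times> nat \<Rightarrow> real"
        using sum.Sigma[of "{..<n}" "\<lambda>i. {..<m i}" "\<lambda>i j. g (i, j)"] by simp
      have "(\<Sum>t\<in>?I. dist (f (p' t)) (f (q' t))) < \<epsilon> / 2"
      proof (rule abs_cont_modulusD[OF \<delta>(2) fam'])
        show "p' t \<in> {a..b} \<and> q' t \<in> {a..b}" if tI: "t \<in> ?I" for t
        proof -
          obtain i j where t: "t = (i, j)" "i < n" "j < m i" using tI by auto
          have "p' t \<le> q' t" using fam' tI unfolding interval_family_def by blast
          moreover have "a \<le> p i" "q i \<le> b" using spec[OF S, of i] t(2) by simp_all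
          moreover have "p i \<le> p' t" "q' t \<le> q i" using T'(2)[OF t(2,3)] t(1) by auto
          ultimately show ?thesis by simp
        qed
        have "(\<Sum>t\<in>?I. q' t - p' t) = (\<Sum>i<n. \<Sum>j<m i. q' (i, j) - p' (i, j))"
          by (rule sumI)
        also have "\<dots> \<le> (\<Sum>i<n. measure lborel {p i..q i})"
        proof (rule sum_mono, rule interval_family_sum_le)
          fix i assume i: "i \<in> {..<n}"
          then show "interval_family {..<m i} (\<lambda>j. p' (i, j)) (\<lambda>j. q' (i, j))" using T' by auto
          fix j assume "j \<in> {..<m i}"
          then show "{p' (i, j)<..<q' (i, j)} \<subseteq> {p i..q i}" using T'(2)[of i j] i by auto
        qed (auto simp: emeasure_lborel_Icc_eq)
        also have "\<dots> = (\<Sum>i<n. q i - p i)" using pq by (intro sum.cong) auto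
        finally show "(\<Sum>t\<in>?I. q' t - p' t) < \<delta>" using small by simp
      qed
      moreover have "(\<Sum>i<n. dist (P (p i)) (P (q i))) \<le> (\<Sum>i<n. (\<Sum>j<m i. dist (f (p' (i, j))) (f (q' (i,
        j)))) + \<eta>)"
      proof (rule sum_mono)
        fix i assume "i \<in> {..<n}"
        then have i: "i < n" by simp
        have "dist (P (p i)) (P (q i)) = P (q i) - P (p i)"
          using inc[of "p i" "q i"] S i pq[OF i] by (auto simp: dist_real_def)
        also have "\<dots> \<le> (\<Sum>j<m i. max 0 (f (q' (i, j)) - f (p' (i, j)))) + \<eta>" by (rule T'(3)[OF i])
        also have "\<dots> \<le> (\<Sum>j<m i. dist (f (p' (i, j))) (f (q' (i, j)))) + \<eta>"
          by (intro add_right_mono sum_mono) (auto simp: dist_real_def)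
        finally show "dist (P (p i)) (P (q i)) \<le> (\<Sum>j<m i. dist (f (p' (i, j))) (f (q' (i, j)))) + \<eta>" .
      qed
      moreover have "(\<Sum>i<n. (\<Sum>j<m i. dist (f (p' (i, j))) (f (q' (i, j)))) + \<eta>)
          = (\<Sum>t\<in>?I. dist (f (p' t)) (f (q' t))) + real n * \<eta>"
        by (simp only: sum.distrib sumI) simp
      moreover have "real n * \<eta> \<le> \<epsilon> / 2"
        using \<open>0 < \<epsilon>\<close> by (simp add: \<eta>_def divide_le_eq)
      ultimately show ?thesis by (smt (verit) field_sum_of_halves)
    qed
    then have "abs_cont_modulus dist {a..b} P \<epsilon> \<delta>"
      unfolding abs_cont_modulus_def by simp
    with \<delta>(1) show "\<exists>\<delta>>0. abs_cont_modulus dist {a..b} P \<epsilon> \<delta>"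
      by (intro exI[of _ \<delta>]) simp
  qed
  moreover have "P x \<le> P y \<and> f y - f x \<le> P y - P x" if "a \<le> x" "x \<le> y" "y \<le> b" for x y
    using inc[OF that] by linarith
  ultimately show ?thesis using that by blast
qed

text \<open>Radon-Nikodym for the Stieltjes measure of \<open>F\<close>. This measure vanishes on a
  null set N: an open U around N of measure below \<delta> contains nonoverlapping intervals that
  cover the bounded part of N, and the modulus bounds the total increment over any finitely many of
  them.\<close>

lemma mono_abs_cont_density:
  fixes F :: "real \<Rightarrow> real"
  assumes mono: "\<And>x y. x \<le> y \<Longrightarrow> F x \<le> F y" and ac: "abs_cont_on dist UNIV F"
  shows "\<exists>g. \<forall>x y. x \<le> y \<longrightarrow> set_integrable lborel {x..y} g \<and> F y - F x = (LBINT z:{x..y}. g z)"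
proof -
  define \<mu> where "\<mu> = interval_measure F"
  have cont: "continuous_on UNIV F"
    by (rule abs_cont_on_imp_continuous_on[OF ac])
  have Icc: "emeasure \<mu> {x..y} = ennreal (F y - F x)" if "x \<le> y" for x y
    unfolding \<mu>_def by (rule emeasure_interval_measure_Icc[OF that mono cont])
  have sets: "sets \<mu> = sets borel" by (simp add: \<mu>_def)
  \<comment> \<open>Bounded pieces, because the covering lemma works inside a box; m = 0 is treated
    apart since that box has empty interior.\<close>
  have null: "emeasure \<mu> (N \<inter> {-real m..real m}) = 0" if N: "N \<in> null_sets lborel" for N m
  proof (cases "m = 0")
    case True
    have "emeasure \<mu> (N \<inter> {-real m..real m}) \<le> emeasure \<mu> {0..0}"
      using True by (intro emeasure_mono) (auto simp: sets)
    then show ?thesis using Icc[of 0 0] by simp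
  next
    case False
    have le: "emeasure \<mu> (N \<inter> {-real m..real m}) \<le> ennreal \<epsilon>" if eps: "0 < \<epsilon>" for \<epsilon>
    proof -
      obtain \<delta> where \<delta>: "0 < \<delta>" "abs_cont_modulus dist UNIV F \<epsilon> \<delta>"
        using ac eps unfolding abs_cont_on_iff by blast
      obtain U where U: "open U" "N \<subseteq> U" "emeasure lborel (U - N) < \<delta>"
        using outer_regular_lborel[of N \<delta>] N \<delta>(1) by (auto simp: null_sets_def)
      have "emeasure lborel U = emeasure lborel (U - N)"
        using U(1) N by (simp add: emeasure_Diff_null_set)
      then have Uf: "emeasure lborel U < ennreal \<delta>" using U(3) by simp
      then have "emeasure lborel U < \<infinity>" by (rule order.strict_trans) simp
      then have Um: "measure lborel U < \<delta>"
        using Uf by (simp add: emeasure_eq_ennreal_measure ennreal_less_iff)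
      \<comment> \<open>Each cell lies in the gauge set of one of its points of N. The gauge assigns
        U to such a point, so all cells are contained in U.\<close>
      obtain D where D: "countable D" "\<Union>D \<subseteq> cbox (-real m) (real m)"
        "\<And>K. K \<in> D \<Longrightarrow> interior K \<noteq> {} \<and> (\<exists>c d. K = cbox c d)"
        "pairwise (\<lambda>A B. interior A \<inter> interior B = {}) D"
        "\<And>K. K \<in> D \<Longrightarrow> \<exists>x \<in> (N \<inter> {-real m..real m}) \<inter> K. K \<subseteq> (if x \<in> U then U else UNIV)"
        "N \<inter> {-real m..real m} \<subseteq> \<Union>D"
        by (rule covering_lemma[of "N \<inter> {-real m..real m}" "-real m" "real m" "\<lambda>x. if x \<in> U then U else UNIV"])
          (use False U(1) in \<open>auto simp: gauge_def box_real\<close>)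
      have "\<forall>K\<in>D. \<exists>t. K = {fst t..snd t} \<and> fst t \<le> snd t"
        using D(3) by (fastforce simp: cbox_interval)
      from bchoice[OF this] obtain t where t: "\<forall>K\<in>D. K = {fst (t K)..snd (t K)} \<and> fst (t K) \<le> snd (t K)"
        by blast
      define p q where "p K = fst (t K)" and "q K = snd (t K)" for K
      have pq: "K = {p K..q K}" "p K \<le> q K" if "K \<in> D" for K
        using bspec[OF t that] by (auto simp: p_def q_def)
      have int: "{p K<..<q K} = interior K" if "K \<in> D" for K
        using pq(1)[OF that] interior_atLeastAtMost_real by metis
      have "emeasure \<mu> (\<Union>K\<in>D. {p K..q K}) \<le> ennreal \<epsilon>"
      proof (rule emeasure_countable_UN_le[OF D(1)])
        fix E assume E: "finite E" "E \<subseteq> D"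
        have fam: "interval_family E p q"
          unfolding interval_family_def
        proof (intro conjI ballI impI)
          fix K L assume "K \<in> E" "L \<in> E" "K \<noteq> L"
          then show "{p K<..<q K} \<inter> {p L<..<q L} = {}"
            using D(4) E int unfolding pairwise_def by (metis subsetD)
        qed (use E pq in auto)
        have "(\<Sum>K\<in>E. q K - p K) \<le> measure lborel U"
        proof (rule interval_family_sum_le[OF fam])
          fix K assume "K \<in> E"
          then have "K \<in> D" using E by auto
          then have "K \<subseteq> U" using D(5)[of K] U(2) by (auto split: if_splits)
          then show "{p K<..<q K} \<subseteq> U" using pq(1)[OF \<open>K \<in> D\<close>] by fastforce
        qed (use U Uf \<open>emeasure lborel U < \<infinity>\<close> in auto)
        then have small: "(\<Sum>K\<in>E. dist (F (p K)) (F (q K))) < \<epsilon>"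
          using Um by (intro abs_cont_modulusD[OF \<delta>(2) fam]) auto
        have "emeasure \<mu> (\<Union>K\<in>E. {p K..q K}) \<le> (\<Sum>K\<in>E. emeasure \<mu> {p K..q K})"
          using E by (intro emeasure_subadditive_finite) (auto simp: sets)
        also have "\<dots> = (\<Sum>K\<in>E. ennreal (dist (F (p K)) (F (q K))))"
        proof (intro sum.cong refl)
          fix K assume "K \<in> E"
          then have "p K \<le> q K" using E pq by auto
          then show "emeasure \<mu> {p K..q K} = ennreal (dist (F (p K)) (F (q K)))"
            using Icc[of "p K" "q K"] mono[of "p K" "q K"] by (simp add: dist_real_def abs_if)
        qed
        also have "\<dots> \<le> ennreal \<epsilon>"
          using small by (subst sum_ennreal) (auto intro: ennreal_leI)
        finally show "emeasure \<mu> (\<Union>K\<in>E. {p K..q K}) \<le> ennreal \<epsilon>" .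
      qed (auto simp: sets)
      moreover have "N \<inter> {-real m..real m} \<subseteq> (\<Union>K\<in>D. {p K..q K})"
        using D(6) pq(1) by blast
      moreover have "(\<Union>K\<in>D. {p K..q K}) \<in> sets \<mu>"
        using D(1) by (auto simp: sets intro!: sets.countable_UN')
      ultimately show ?thesis by (meson emeasure_mono order_trans)
    qed
    have "emeasure \<mu> (N \<inter> {-real m..real m}) \<le> 0"
      by (rule ennreal_le_epsilon) (simp only: add_0_left le)
    then show ?thesis by (simp only: le_zero_eq)
  qed
  have "absolutely_continuous lborel \<mu>"
    unfolding absolutely_continuous_def
  proof
    fix N assume N: "N \<in> null_sets (lborel :: real measure)"
    have "emeasure \<mu> (\<Union>m. N \<inter> {-real m..real m}) = 0"
      using null[OF N] N by (intro emeasure_UN_eq_0) (auto simp: sets null_sets_def)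
    moreover have "(\<Union>m. N \<inter> {-real m..real m}) = N"
    proof -
      have "\<exists>m. -real m \<le> x \<and> x \<le> real m" for x
        using real_arch_simple[of "\<bar>x\<bar>"] by (auto simp: abs_le_iff minus_le_iff)
      then show ?thesis by auto
    qed
    ultimately show "N \<in> null_sets \<mu>" using N by (auto simp: null_sets_def sets)
  qed
  then obtain h where h: "h \<in> borel_measurable lborel" "density lborel h = \<mu>"
    using sigma_finite_measure.Radon_Nikodym[OF sigma_finite_lborel, of \<mu>] sets by auto
  have [measurable]: "h \<in> borel_measurable borel" using h(1) by simp
  show ?thesis
  proof (intro exI[of _ "\<lambda>x. enn2real (h x)"] allI impI)
    fix x y :: real assume "x \<le> y"
    have nn: "(\<integral>\<^sup>+z. h z * indicator {x..y} z \<partial>lborel) = ennreal (F y - F x)"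
      using Icc[OF \<open>x \<le> y\<close>] unfolding h(2)[symmetric] by (subst (asm) emeasure_density) auto
    have "AE z in lborel. h z * indicator {x..y} z \<noteq> \<infinity>"
      using nn by (intro nn_integral_PInf_AE) auto
    then have ae: "AE z in lborel. h z * indicator {x..y} z = ennreal (indicator {x..y} z *\<^sub>R enn2real (h z))"
      by eventually_elim (auto simp: indicator_def less_top)
    have nn2: "(\<integral>\<^sup>+z. ennreal (indicator {x..y} z *\<^sub>R enn2real (h z)) \<partial>lborel) = ennreal (F y - F x)"
      by (rule trans[OF nn_integral_cong_AE[OF ae, symmetric] nn])
    have "has_bochner_integral lborel (\<lambda>z. indicator {x..y} z *\<^sub>R enn2real (h z)) (F y - F x)"
      using nn2 mono[OF \<open>x \<le> y\<close>] by (intro has_bochner_integral_nn_integral) auto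
    then show "set_integrable lborel {x..y} (\<lambda>x. enn2real (h x)) \<and> F y - F x = (LBINT z:{x..y}. enn2real (h z))"
      by (auto simp: set_integrable_def set_lebesgue_integral_def has_bochner_integral_iff)
  qed
qed

text \<open>Both parts of the Jordan decomposition are monotone and absolutely continuous. Once
  clamped, each has a density on the line, and \<open>f\<close> receives the difference.\<close>

lemma abs_cont_on_density:
  fixes f :: "real \<Rightarrow> real"
  assumes ac: "abs_cont_on dist {a..b} f" and "a \<le> b"
  obtains g where "set_integrable lborel {a..b} g"
    "\<And>x y. a \<le> x \<Longrightarrow> x \<le> y \<Longrightarrow> y \<le> b \<Longrightarrow> f y - f x = (LBINT z:{x..y}. g z)"
proof -
  obtain P where P: "\<And>x y. a \<le> x \<Longrightarrow> x \<le> y \<Longrightarrow> y \<le> b \<Longrightarrow> P x \<le> P y \<and> f y - f x \<le> P y - P x"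
    "abs_cont_on dist {a..b} P"
    using abs_cont_on_pos_variation[OF ac] by metis
  have acQ: "abs_cont_on dist {a..b} (\<lambda>x. P x - f x)"
    unfolding abs_cont_on_iff
  proof (intro allI impI)
    fix \<epsilon> :: real assume "0 < \<epsilon>"
    obtain \<delta>1 \<delta>2 where \<delta>: "0 < \<delta>1" "abs_cont_modulus dist {a..b} P (\<epsilon> / 2) \<delta>1"
      "0 < \<delta>2" "abs_cont_modulus dist {a..b} f (\<epsilon> / 2) \<delta>2"
      using ac[unfolded abs_cont_on_iff, rule_format, OF half_gt_zero[OF \<open>0 < \<epsilon>\<close>]]
        P(2)[unfolded abs_cont_on_iff, rule_format, OF half_gt_zero[OF \<open>0 < \<epsilon>\<close>]] by blast
    have "abs_cont_modulus dist {a..b} (\<lambda>x. P x - f x) \<epsilon> (min \<delta>1 \<delta>2)"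
      unfolding abs_cont_modulus_def
    proof (intro allI impI)
      fix n p q assume *: "interval_family {..<n::nat} p q" "\<forall>i<n. p i \<in> {a..b} \<and> q i \<in> {a..b}"
        "(\<Sum>i<n. q i - p i) < min \<delta>1 \<delta>2"
      have "(\<Sum>i<n. dist (P (p i)) (P (q i))) < \<epsilon> / 2" "(\<Sum>i<n. dist (f (p i)) (f (q i))) < \<epsilon> / 2"
        using * \<delta>(2,4) by (auto simp: abs_cont_modulus_def)
      moreover have "(\<Sum>i<n. dist (P (p i) - f (p i)) (P (q i) - f (q i))) \<le>
          (\<Sum>i<n. dist (P (p i)) (P (q i)) + dist (f (p i)) (f (q i)))"
        by (intro sum_mono) (auto simp: dist_real_def)
      ultimately show "(\<Sum>i<n. dist (P (p i) - f (p i)) (P (q i) - f (q i))) < \<epsilon>"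
        by (simp add: sum.distrib)
    qed
    then show "\<exists>\<delta>>0. abs_cont_modulus dist {a..b} (\<lambda>x. P x - f x) \<epsilon> \<delta>"
      using \<delta> by (intro exI[of _ "min \<delta>1 \<delta>2"]) auto
  qed
  have C: "a \<le> clamp_to a b x" "clamp_to a b x \<le> b" "x \<le> y \<Longrightarrow> clamp_to a b x \<le> clamp_to a b y" for x y
    using \<open>a \<le> b\<close> by (auto simp: clamp_to_def)
  have "P (clamp_to a b x) \<le> P (clamp_to a b y)"
    "P (clamp_to a b x) - f (clamp_to a b x) \<le> P (clamp_to a b y) - f (clamp_to a b y)" if "x \<le> y" for x y
    using P(1)[of "clamp_to a b x" "clamp_to a b y"] C(1,2)[of x] C(1,2)[of y] C(3)[OF that] by auto
  note mono = this
  obtain g where g: "\<forall>x y. x \<le> y \<longrightarrow> set_integrable lborel {x..y} g \<and>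
      P (clamp_to a b y) - P (clamp_to a b x) = (LBINT z:{x..y}. g z)"
    using mono_abs_cont_density[OF mono(1) abs_cont_on_clamp[OF P(2) \<open>a \<le> b\<close>]] by blast
  obtain h where h: "\<forall>x y. x \<le> y \<longrightarrow> set_integrable lborel {x..y} h \<and>
      (P (clamp_to a b y) - f (clamp_to a b y)) - (P (clamp_to a b x) - f (clamp_to a b x)) =
        (LBINT z:{x..y}. h z)"
    using mono_abs_cont_density[OF mono(2) abs_cont_on_clamp[OF acQ \<open>a \<le> b\<close>]] by blast
  show ?thesis
  proof (rule that[of "\<lambda>z. g z - h z"])
    show "set_integrable lborel {a..b} (\<lambda>z. g z - h z)"
      using g h \<open>a \<le> b\<close> by (intro set_integral_diff) auto
    fix x y assume xy: "a \<le> x" "x \<le> y" "y \<le> b"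
    then show "f y - f x = (LBINT z:{x..y}. g z - h z)"
      using g[rule_format, OF xy(2)] h[rule_format, OF xy(2)] by (simp add: clamp_to_inside)
  qed
qed

text \<open>A limit along one fixed sequence of increments, so that Borel measurability is immediate
  for continuous \<open>f\<close>. It is the derivative wherever that exists; elsewhere its value is
  irrelevant to integrals once \<open>f\<close> is differentiable almost everywhere.\<close>

definition borel_deriv :: "(real \<Rightarrow> real) \<Rightarrow> real \<Rightarrow> real" where
  "borel_deriv f x = lim (\<lambda>n. (f (x + inverse (real (Suc n))) - f x) * real (Suc n))"

lemma borel_measurable_borel_deriv:
  assumes "continuous_on UNIV f"
  shows "borel_deriv f \<in> borel_measurable borel"
proof -
  have [measurable]: "f \<in> borel_measurable borel"
    by (rule borel_measurable_continuous_onI[OF assms])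
  show ?thesis unfolding borel_deriv_def by measurable
qed

lemma borel_deriv_eq:
  assumes "(f has_real_derivative D) (at x)"
  shows "borel_deriv f x = D"
proof -
  have *: "((\<lambda>h. (f (x + h) - f x) / h) \<longlongrightarrow> D) (at 0)"
    using assms by (simp add: DERIV_def)
  have "filterlim (\<lambda>n. inverse (real (Suc n))) (at 0) sequentially"
    unfolding filterlim_at using LIMSEQ_inverse_real_of_nat by auto
  from filterlim_compose[OF * this] show ?thesis
    unfolding borel_deriv_def by (intro limI) (simp add: divide_inverse)
qed

text \<open>By Lebesgue differentiation the densities found on the intervals [-n, n] agree almost
  everywhere with \<open>borel_deriv f\<close>, so one Borel function serves all intervals.\<close>

theorem abs_cont_FTC:
  assumes "abs_cont f"
  shows "AE x in lborel. (f has_real_derivative borel_deriv f x) (at x)"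
    and "set_integrable lborel {a..b} (borel_deriv f)"
    and "x \<le> y \<Longrightarrow> f y - f x = (LBINT z:{x..y}. borel_deriv f z)"
proof -
  have ac: "abs_cont_on dist {a..b} f" for a b using assms by (simp add: abs_cont_def)
  have cont: "continuous_on UNIV f"
  proof -
    have "isCont f x" for x
      using abs_cont_on_imp_continuous_on[OF ac[of "x - 1" "x + 1"]]
      by (rule continuous_on_interior) (auto simp: interior_atLeastAtMost_real)
    then show ?thesis by (simp add: continuous_at_imp_continuous_on)
  qed
  have [measurable]: "borel_deriv f \<in> borel_measurable borel"
    by (rule borel_measurable_borel_deriv[OF cont])
  have "\<exists>g. set_integrable lborel {-real n..real n} g \<and>
     (\<forall>x y. - real n \<le> x \<longrightarrow> x \<le> y \<longrightarrow> y \<le> real n \<longrightarrow> f y - f x = (LBINT z:{x..y}. g z))" for n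
  proof -
    have "- real n \<le> real n" by simp
    from abs_cont_on_density[OF ac this] show ?thesis by metis
  qed
  then obtain G where G: "\<And>n. set_integrable lborel {-real n..real n} (G n)"
     "\<And>n x y. - real n \<le> x \<Longrightarrow> x \<le> y \<Longrightarrow> y \<le> real n \<Longrightarrow> f y - f x = (LBINT z:{x..y}. G n z)"
    by metis
  have "AE x in lborel. \<forall>n. - real n < x \<longrightarrow> x < real n \<longrightarrow> (f has_real_derivative G n x) (at x)"
    unfolding AE_all_countable by (intro allI lebesgue_differentiation_local G)
  then have ae: "AE x in lborel. (f has_real_derivative borel_deriv f x) (at x) \<and>
      (\<forall>n. - real n < x \<longrightarrow> x < real n \<longrightarrow> borel_deriv f x = G n x)"
  proof eventually_elim
    fix x assume *: "\<forall>n. - real n < x \<longrightarrow> x < real n \<longrightarrow> (f has_real_derivative G n x) (at x)"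
    obtain n where "\<bar>x\<bar> < real n" using reals_Archimedean2 by blast
    then have "(f has_real_derivative G n x) (at x)" using * by (simp add: abs_less_iff minus_less_iff)
    moreover have "borel_deriv f x = G n x" if "- real n < x" "x < real n" for n
      using * that by (blast intro: borel_deriv_eq)
    ultimately show "(f has_real_derivative borel_deriv f x) (at x) \<and>
      (\<forall>n. - real n < x \<longrightarrow> x < real n \<longrightarrow> borel_deriv f x = G n x)"
      by (auto simp: borel_deriv_eq)
  qed
  then show "AE x in lborel. (f has_real_derivative borel_deriv f x) (at x)" by auto
  have *: "set_integrable lborel {a..b} (borel_deriv f) \<and> (a \<le> b \<longrightarrow> f b - f a =
    (LBINT z:{a..b}. borel_deriv f z))" for a b
  proof -
    obtain n where n: "max \<bar>a\<bar> \<bar>b\<bar> < real n" using reals_Archimedean2 by blast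
    have sub: "{a..b} \<subseteq> {-real n..real n}" using n by auto
    have Gi: "set_integrable lborel {a..b} (G n)"
      by (rule set_integrable_subset[OF G(1) _ sub]) simp
    have eq: "AE z in lborel. indicator {a..b} z *\<^sub>R G n z = indicator {a..b} z *\<^sub>R borel_deriv f z"
    proof -
      have bd: "- real n < z \<and> z < real n" if "z \<in> {a..b}" for z using n that by auto
      show ?thesis using ae
      proof eventually_elim
        case (elim z)
        then show ?case using bd[of z] by (auto simp: indicator_def)
      qed
    qed
    have m: "(\<lambda>z. indicator {a..b} z *\<^sub>R G n z) \<in> borel_measurable lborel"
      using Gi by (auto simp: set_integrable_def)
    have "integrable lborel (\<lambda>z. indicator {a..b} z *\<^sub>R borel_deriv f z)"
      using Gi integrable_cong_AE[OF m _ eq] unfolding set_integrable_def by auto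
    moreover have "(LBINT z:{a..b}. G n z) = (LBINT z:{a..b}. borel_deriv f z)"
      unfolding set_lebesgue_integral_def using m eq by (intro integral_cong_AE) auto
    moreover have "f b - f a = (LBINT z:{a..b}. G n z)" if "a \<le> b"
      using n that by (intro G(2)) auto
    ultimately show ?thesis by (simp add: set_integrable_def)
  qed
  then show "set_integrable lborel {a..b} (borel_deriv f)"
    and "x \<le> y \<Longrightarrow> f y - f x = (LBINT z:{x..y}. borel_deriv f z)" by blast+
qed

text \<open>The product majorant gives integrability on the plane. In the exchanges below it is a
  multiple of the indicator of a time interval, multiplied by an integrable function of the other
  variable.\<close>

lemma fubini_dominated:
  fixes f :: "real \<Rightarrow> real \<Rightarrow> real"
  assumes [measurable]: "(\<lambda>(x, y). f x y) \<in> borel_measurable (lborel \<Otimes>\<^sub>M lborel)"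
    and h: "integrable lborel h" and g: "integrable lborel g"
    and le: "\<And>x y. \<bar>f x y\<bar> \<le> h x * g y"
  shows "integrable lborel (\<lambda>x. LBINT y. f x y)" "integrable lborel (\<lambda>y. LBINT x. f x y)"
    "(LBINT x. LBINT y. f x y) = (LBINT y. LBINT x. f x y)"
proof -
  have [measurable]: "h \<in> borel_measurable lborel" "g \<in> borel_measurable lborel"
    using h g by (auto simp: borel_measurable_integrable)
  have 1: "integrable (lborel \<Otimes>\<^sub>M lborel) (\<lambda>(x, y). h x * g y)"
  proof (rule lborel_pair.Fubini_integrable)
    show "integrable lborel (\<lambda>x. LBINT y. norm (case (x, y) of (x, y) \<Rightarrow> h x * g y))"
      using h by (simp add: abs_mult)
    show "AE x in lborel. integrable lborel (\<lambda>y. case (x, y) of (x, y) \<Rightarrow> h x * g y)"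
      using g by simp
  qed measurable
  have i: "integrable (lborel \<Otimes>\<^sub>M lborel) (\<lambda>(x, y). f x y)"
    by (rule Bochner_Integration.integrable_bound[OF 1]) (auto intro!: AE_I2 order_trans[OF le abs_ge_self])
  show "integrable lborel (\<lambda>x. LBINT y. f x y)"
    using lborel_pair.integrable_fst[OF i] by simp
  show "integrable lborel (\<lambda>y. LBINT x. f x y)"
    using lborel_pair.integrable_snd[OF i] by simp
  show "(LBINT x. LBINT y. f x y) = (LBINT y. LBINT x. f x y)"
    using lborel_pair.Fubini_integral[OF i] by simp
qed

lemma continuous_on_indefinite_integral:
  fixes F g :: "real \<Rightarrow> real"
  assumes "\<And>x y. set_integrable lborel {x..y} g"
    and F: "\<And>x y. x \<le> y \<Longrightarrow> F y - F x = (LBINT z:{x..y}. g z)"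
  shows "continuous_on UNIV F"
proof -
  have "isCont F x" for x
  proof -
    have i: "g integrable_on {x - 1..x + 1}"
      using set_borel_integral_eq_integral(1)[OF assms(1)] .
    have "continuous_on {x - 1..x + 1} (\<lambda>y. F (x - 1) + integral {x - 1..y} g)"
      by (intro continuous_intros indefinite_integral_continuous_1 i)
    also have "?this \<longleftrightarrow> continuous_on {x - 1..x + 1} F"
    proof (rule continuous_on_cong[OF refl])
      fix y assume "y \<in> {x - 1..x + 1}"
      then show "F (x - 1) + integral {x - 1..y} g = F y"
        using F[of "x - 1" y] set_borel_integral_eq_integral(2)[OF assms(1), of "x - 1" y] by simp
    qed
    finally show ?thesis
      by (rule continuous_on_interior) (auto simp: interior_atLeastAtMost_real)
  qed
  then show ?thesis by (simp add: continuous_at_imp_continuous_on)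
qed

section \<open>Characteristics\<close>

text \<open>\<open>a\<close> is a Borel version of the derivative of the initial datum.\<close>

locale hunter_saxton_data =
  fixes ubar a :: "real \<Rightarrow> real"
  assumes a_meas [measurable]: "a \<in> borel_measurable borel"
    and a_sq: "integrable lborel (\<lambda>x. (a x)\<^sup>2)"
    and ubar_diff: "x \<le> y \<Longrightarrow> ubar y - ubar x = (LBINT z:{x..y}. a z)"
begin

definition "energy = (LBINT x. (a x)\<^sup>2)"

text \<open>\<open>alive t\<close> is the indicator of the characteristics that have not yet collapsed at time \<open>t\<close>: for \<open>t > 0\<close>
  the condition reads \<open>a x > -2/t\<close>, and nothing is excluded at \<open>t = 0\<close>.  \<open>X\<close> and \<open>V\<close> are the maps \<open>\<xi>\<close> and
  \<open>u(t, \<xi>)\<close> of the theorem; it will turn out that \<open>X\<^sub>y = q\<^sup>2\<close> and \<open>V\<^sub>y = a q\<close>.\<close>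

definition "alive t x = (if 0 < 1 + t * a x / 2 then 1 else 0 :: real)"
definition "q t x = max 0 (1 + t * a x / 2)"
definition "M t = (LBINT x. alive t x * (a x)\<^sup>2)"
definition "\<phi> t y = 1/4 * (LBINT x. alive t x * (sgn (y - x) * (a x)\<^sup>2))"
definition "V t y = ubar y + (LBINT s:{0..t}. \<phi> s y)"
definition "X t y = y + t * ubar y + (LBINT s:{0..t}. (t - s) * \<phi> s y)"

lemma alive_meas [measurable]: "(\<lambda>(t, x). alive t x) \<in> borel_measurable (borel \<Otimes>\<^sub>M borel)"
  unfolding alive_def by measurable

lemma q_meas [measurable]: "(\<lambda>(t, x). q t x) \<in> borel_measurable (borel \<Otimes>\<^sub>M borel)"
  unfolding q_def by measurable

lemma alive_bounds: "0 \<le> alive t x" "alive t x \<le> 1"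
  by (auto simp: alive_def)

lemma q_nonneg: "0 \<le> q t x"
  by (auto simp: q_def)

lemma q_pos_iff: "0 < q t x \<longleftrightarrow> alive t x = 1"
  by (auto simp: q_def alive_def)

lemma alive_cases: "alive t x = 1 \<or> alive t x = 0 \<and> q t x = 0"
  by (auto simp: q_def alive_def)

lemma alive_antimono:
  assumes "0 \<le> s" "s \<le> t" shows "alive t x \<le> alive s x"
proof -
  have "0 < 1 + s * a x / 2" if "0 < 1 + t * a x / 2"
  proof (cases "0 \<le> a x")
    case True then show ?thesis using assms by (simp add: add_pos_nonneg)
  next
    case False
    then have "t * a x \<le> s * a x" using assms by (intro mult_right_mono_neg) auto
    then show ?thesis using that by linarith
  qed
  then show ?thesis by (auto simp: alive_def)
qed

lemma energy_nonneg: "0 \<le> energy"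
  by (simp add: energy_def)

lemma integrable_alive: "integrable lborel (\<lambda>x. alive t x * (a x)\<^sup>2)"
  by (rule Bochner_Integration.integrable_bound[OF a_sq]) (use alive_bounds in \<open>auto simp: abs_mult
    mult_left_le_one_le\<close>)

lemma integrable_alive_sgn: "integrable lborel (\<lambda>x. alive t x * (sgn (y - x) * (a x)\<^sup>2))"
  by (rule Bochner_Integration.integrable_bound[OF integrable_alive[of t]])
    (auto simp: abs_mult abs_sgn_eq alive_bounds)

lemma M_bounds: "0 \<le> M t" "M t \<le> energy"
  unfolding M_def energy_def using alive_bounds integrable_alive a_sq
  by (auto intro!: integral_nonneg_AE integral_mono mult_nonneg_nonneg simp: mult_left_le_one_le)

lemma M_antimono: "0 \<le> s \<Longrightarrow> s \<le> t \<Longrightarrow> M t \<le> M s"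
  unfolding M_def by (intro integral_mono integrable_alive mult_right_mono alive_antimono) auto

text \<open>Constants are integrable on bounded intervals and a^2 everywhere. A majorant of this
  shape exists for all densities in use: \<open>a\<close>, a*q and q^2.\<close>

lemma set_integrable_dom:
  assumes [measurable]: "f \<in> borel_measurable borel"
    and "\<And>x. \<bar>f x\<bar> \<le> c + d * (a x)\<^sup>2"
  shows "set_integrable lborel {l..u} f"
proof (rule set_integrable_bound)
  show "set_integrable lborel {l..u} (\<lambda>x. c + d * (a x)\<^sup>2)"
    by (intro set_integral_add set_integrable_mult_right set_integrable_const_Icc set_integrable_lborel
      a_sq) simp
  show "set_borel_measurable lborel {l..u} f" unfolding set_borel_measurable_def by measurable
  have "\<bar>f x\<bar> \<le> \<bar>c + d * (a x)\<^sup>2\<bar>" for x using assms(2)[of x] by linarith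
  then show "AE x in lborel. x \<in> {l..u} \<longrightarrow> norm (f x) \<le> norm (c + d * (a x)\<^sup>2)" by simp
qed

lemma abs_le_1_plus_sq: "\<bar>b\<bar> \<le> 1 + (b::real)\<^sup>2"
  using sum_squares_bound[of "\<bar>b\<bar>" 1] by (auto simp: power2_eq_square)

lemma q_le: "0 \<le> t \<Longrightarrow> q t x \<le> 1 + t * \<bar>a x\<bar> / 2"
proof -
  assume "0 \<le> t"
  then have "t * a x \<le> t * \<bar>a x\<bar>" by (intro mult_left_mono) auto
  then show ?thesis using \<open>0 \<le> t\<close> by (auto simp: q_def)
qed

lemma set_integrable_a: "set_integrable lborel {l..u} a"
  by (rule set_integrable_dom[of a 1 1]) (auto simp: abs_le_1_plus_sq)

lemma a_q_bound: "0 \<le> t \<Longrightarrow> \<bar>a x * q t x\<bar> \<le> 1 + (1 + t / 2) * (a x)\<^sup>2"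
proof -
  assume t: "0 \<le> t"
  have "\<bar>a x * q t x\<bar> \<le> \<bar>a x\<bar> * (1 + t * \<bar>a x\<bar> / 2)"
    unfolding abs_mult using q_le[OF t] q_nonneg by (intro mult_left_mono) auto
  also have "\<dots> = \<bar>a x\<bar> + t / 2 * (a x)\<^sup>2"
    by (simp add: algebra_simps power2_eq_square)
  also have "\<dots> \<le> 1 + (1 + t / 2) * (a x)\<^sup>2"
    using abs_le_1_plus_sq[of "a x"] by (simp add: algebra_simps)
  finally show ?thesis .
qed

lemma q_sq_bound: "0 \<le> t \<Longrightarrow> (q t x)\<^sup>2 \<le> 2 + t\<^sup>2 / 2 * (a x)\<^sup>2"
proof -
  assume t: "0 \<le> t"
  have "(q t x)\<^sup>2 \<le> (1 + t * \<bar>a x\<bar> / 2)\<^sup>2"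
    using q_le[OF t] q_nonneg by (intro power_mono) auto
  also have "\<dots> \<le> 2 * 1\<^sup>2 + 2 * (t * \<bar>a x\<bar> / 2)\<^sup>2"
    using sum_squares_bound[of 1 "t * \<bar>a x\<bar> / 2"] unfolding power2_sum by simp
  also have "\<dots> = 2 + t\<^sup>2 / 2 * (a x)\<^sup>2" by (simp add: power_mult_distrib power_divide)
  finally show ?thesis .
qed

lemma set_integrable_a_q: "0 \<le> t \<Longrightarrow> set_integrable lborel {l..u} (\<lambda>x. a x * q t x)"
  by (rule set_integrable_dom[OF _ a_q_bound]) measurable

lemma set_integrable_q_sq: "0 \<le> t \<Longrightarrow> set_integrable lborel {l..u} (\<lambda>x. (q t x)\<^sup>2)"
  by (rule set_integrable_dom[of _ 2 "t\<^sup>2 / 2"]) (use q_sq_bound[of t] in auto)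

lemma phi_meas [measurable]: "(\<lambda>s. \<phi> s y) \<in> borel_measurable borel"
  unfolding \<phi>_def by measurable

lemma phi_abs: "\<bar>\<phi> t y\<bar> \<le> energy / 4"
proof -
  have "\<bar>LBINT x. alive t x * (sgn (y - x) * (a x)\<^sup>2)\<bar> \<le> (LBINT x. \<bar>alive t x * (sgn (y - x) * (a x)\<^sup>2)\<bar>)"
    by (rule integral_abs_bound)
  also have "\<dots> \<le> energy"
    unfolding energy_def
    by (intro integral_mono integrable_abs integrable_alive_sgn a_sq)
      (auto simp: abs_mult abs_sgn_eq alive_bounds mult_left_le_one_le)
  finally show ?thesis by (simp add: \<phi>_def)
qed

text \<open>Between the two times \<open>\<phi>\<close> loses only labels that collapse, and
  \<open>sgn\<close> is bounded by 1. The bound is uniform in \<open>y\<close>; through it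
  continuity of \<open>M\<close> controls differentiability of \<open>V\<close> in time.\<close>

lemma phi_time_diff:
  assumes "0 \<le> s" "s \<le> t"
  shows "\<bar>\<phi> s y - \<phi> t y\<bar> \<le> (M s - M t) / 4"
proof -
  have eq: "(alive s x * (sgn (y - x) * (a x)\<^sup>2) - alive t x * (sgn (y - x) * (a x)\<^sup>2)) =
      sgn (y - x) * (alive s x * (a x)\<^sup>2 - alive t x * (a x)\<^sup>2)" for x
    by (simp add: algebra_simps)
  have "\<bar>\<phi> s y - \<phi> t y\<bar> = 1/4 * \<bar>LBINT x. sgn (y - x) * (alive s x * (a x)\<^sup>2 - alive t x * (a x)\<^sup>2)\<bar>"
    unfolding \<phi>_def right_diff_distrib[symmetric] abs_mult
    using integrable_alive_sgn by (subst Bochner_Integration.integral_diff[symmetric]) (auto simp: eq)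
  also have "\<dots> \<le> 1/4 * (LBINT x. \<bar>sgn (y - x) * (alive s x * (a x)\<^sup>2 - alive t x * (a x)\<^sup>2)\<bar>)"
    by (intro mult_left_mono integral_abs_bound) auto
  also have "\<dots> \<le> 1/4 * (LBINT x. alive s x * (a x)\<^sup>2 - alive t x * (a x)\<^sup>2)"
  proof (intro mult_left_mono integral_mono integrable_abs)
    show "integrable lborel (\<lambda>x. sgn (y - x) * (alive s x * (a x)\<^sup>2 - alive t x * (a x)\<^sup>2))"
      unfolding eq[symmetric] by (intro Bochner_Integration.integrable_diff integrable_alive_sgn)
    show "integrable lborel (\<lambda>x. alive s x * (a x)\<^sup>2 - alive t x * (a x)\<^sup>2)"
      by (intro Bochner_Integration.integrable_diff integrable_alive)
    fix x
    have "0 \<le> alive s x * (a x)\<^sup>2 - alive t x * (a x)\<^sup>2"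
      using mult_right_mono[OF alive_antimono[OF assms, of x], of "(a x)\<^sup>2"] by simp
    then show "\<bar>sgn (y - x) * (alive s x * (a x)\<^sup>2 - alive t x * (a x)\<^sup>2)\<bar> \<le>
      alive s x * (a x)\<^sup>2 - alive t x * (a x)\<^sup>2"
      by (auto simp: abs_mult abs_sgn_eq)
  qed auto
  also have "\<dots> = (M s - M t) / 4"
    unfolding M_def using integrable_alive by simp
  finally show ?thesis .
qed

text \<open>The two signs differ by 2 between \<open>y1\<close> and \<open>y2\<close> and agree
  outside, end points aside. With the factor 1/4 this leaves half of the living energy
  density.\<close>

lemma phi_diff:
  assumes "y1 \<le> y2"
  shows "\<phi> t y2 - \<phi> t y1 = (LBINT x:{y1..y2}. alive t x * (a x)\<^sup>2 / 2)"
proof -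
  have "\<phi> t y2 - \<phi> t y1 = 1/4 * (LBINT x. alive t x * (sgn (y2 - x) * (a x)\<^sup>2) - alive t x * (sgn (y1 -
    x) * (a x)\<^sup>2))"
    unfolding \<phi>_def using integrable_alive_sgn by simp
  also have "\<dots> = 1/4 * (LBINT x. 4 * (indicator {y1..y2} x *\<^sub>R (alive t x * (a x)\<^sup>2 / 2)))"
  proof (intro arg_cong[where f = "\<lambda>x. 1/4 * x"] integral_discrete_difference[where X = "{y1, y2}"])
    fix x assume "x \<notin> {y1, y2}"
    then show "alive t x * (sgn (y2 - x) * (a x)\<^sup>2) - alive t x * (sgn (y1 - x) * (a x)\<^sup>2) =
        4 * (indicator {y1..y2} x *\<^sub>R (alive t x * (a x)\<^sup>2 / 2))"
      using assms by (cases "x < y1"; cases "x < y2") (auto simp: indicator_def sgn_if)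
  qed auto
  also have "\<dots> = 1/4 * (4 * (LBINT x. indicator {y1..y2} x *\<^sub>R (alive t x * (a x)\<^sup>2 / 2)))"
    by (simp only: integral_mult_right_zero)
  finally show ?thesis unfolding set_lebesgue_integral_def by linarith
qed

lemma phi_mono: "y1 \<le> y2 \<Longrightarrow> \<phi> t y1 \<le> \<phi> t y2"
  using phi_diff[of y1 y2 t] set_integral_nonneg_real[of "\<lambda>x. alive t x * (a x)\<^sup>2 / 2" "{y1..y2}"] alive_bounds
  by simp

lemma phi_set_integrable: "set_integrable lborel {s..t} (\<lambda>r. \<phi> r y)"
  by (rule set_integrable_dom[of _ "energy / 4" 0]) (measurable, insert phi_abs, simp)

lemma V_time_diff:
  assumes "0 \<le> s" "s \<le> t"
  shows "V t y - V s y = (LBINT r:{s..t}. \<phi> r y)"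
proof -
  have "(LBINT r:{0..t}. \<phi> r y) = (LBINT r:{0..s}. \<phi> r y) + (LBINT r:{s..t}. \<phi> r y)"
    by (rule set_integral_Icc_split[OF phi_set_integrable assms])
  then show ?thesis by (simp add: V_def)
qed

lemma V_time_lipschitz:
  assumes "0 \<le> s" "0 \<le> t" shows "\<bar>V t y - V s y\<bar> \<le> energy / 4 * \<bar>t - s\<bar>"
proof -
  have "\<bar>V t y - V s y\<bar> \<le> energy / 4 * (t - s)" if "0 \<le> s" "s \<le> t" for s t
    using set_integral_const_dist[OF that(2) phi_set_integrable, of y 0 "energy / 4"] phi_abs[of _ y]
      V_time_diff[OF that]
    by simp
  from this[of s t] this[of t s] assms show ?thesis
    by (cases "s \<le> t") (auto simp: abs_minus_commute)
qed

lemma V_time_cont: "continuous_on {0..} (\<lambda>t. V t y)"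
  unfolding continuous_on_iff
proof (intro ballI allI impI)
  fix s e :: real assume "s \<in> {0..}" "0 < e"
  then show "\<exists>d>0. \<forall>t\<in>{0..}. dist t s < d \<longrightarrow> dist (V t y) (V s y) < e"
  proof (intro exI[of _ "e / (energy / 4 + 1)"] conjI ballI impI)
    fix t assume t: "t \<in> {0..}" "dist t s < e / (energy / 4 + 1)"
    have "\<bar>V t y - V s y\<bar> \<le> energy / 4 * \<bar>t - s\<bar>"
      using V_time_lipschitz \<open>s \<in> {0..}\<close> t by auto
    also have "\<dots> \<le> (energy / 4 + 1) * \<bar>t - s\<bar>" by (simp add: algebra_simps)
    also have "\<dots> < e" using t energy_nonneg by (simp add: dist_real_def field_simps)
    finally show "dist (V t y) (V s y) < e" by (simp add: dist_real_def)
  qed (use energy_nonneg in auto)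
qed

lemma V_set_integrable: "0 \<le> s \<Longrightarrow> set_integrable lborel {s..t} (\<lambda>r. V r y)"
  by (intro borel_integrable_atLeastAtMost' continuous_on_subset[OF V_time_cont]) auto

text \<open>Fubini on the triangle 0 <= r <= s <= t turns the kernel t - s into a double time
  integral. This identifies \<open>X\<close> as the curve with velocity \<open>V\<close>, that is,
  as a characteristic.\<close>

lemma X_eq:
  assumes "0 \<le> t"
  shows "X t y = y + (LBINT s:{0..t}. V s y)"
proof -
  define f where "f s r = indicator {0..t} s * indicator {0..s} r * \<phi> r y" for s r
  \<comment> \<open>Joint measurability of the triangle: r <= s is rewritten as a condition on s -
    r.\<close>
  have ind: "(\<lambda>(s::real, r::real). indicator {0..s} r :: real) \<in> borel_measurable (borel \<Otimes>\<^sub>M borel)"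
  proof -
    have "(\<lambda>p :: real \<times> real. indicator {0..} (snd p) * indicator {0..} (fst p - snd p) :: real) \<in>
      borel_measurable (borel \<Otimes>\<^sub>M borel)"
    proof -
      have A: "(indicator {0::real..} :: real \<Rightarrow> real) \<in> borel_measurable borel" by simp
      have 1: "(\<lambda>p :: real \<times> real. indicator {0::real..} (snd p) :: real) \<in> borel_measurable (borel \<Otimes>\<^sub>M borel)"
        by (rule measurable_compose[OF measurable_snd A])
      have 2: "(\<lambda>p. indicator {0::real..} (fst p - snd p) :: real) \<in> borel_measurable (borel \<Otimes>\<^sub>M borel)"
        by (rule measurable_compose[OF _ A]) measurable
      show ?thesis by (rule borel_measurable_times[OF 1 2])
    qed
    also have "(\<lambda>p :: real \<times> real. indicator {0..} (snd p) * indicator {0..} (fst p - snd p) :: real) =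
      (\<lambda>(s::real, r::real). indicator {0..s} r)"
      by (auto simp: fun_eq_iff indicator_def)
    finally show ?thesis .
  qed
  note I = integrable_indicator_Icc[of 0 t]
  have "(LBINT s. LBINT r. f s r) = (LBINT r. LBINT s. f s r)"
  proof (rule fubini_dominated(3)[OF _ I integrable_mult_right[OF I, of "energy / 4"]])
    show "(\<lambda>(s, r). f s r) \<in> borel_measurable (lborel \<Otimes>\<^sub>M lborel)"
      unfolding f_def using ind by measurable
    show "\<bar>f s r\<bar> \<le> indicator {0..t} s * (energy / 4 * indicator {0..t} r)" for s r
      using phi_abs[of r y] energy_nonneg by (auto simp: f_def indicator_def abs_mult)
  qed
  moreover have "(LBINT s. LBINT r. f s r) = (LBINT s:{0..t}. V s y) - t * ubar y"
  proof -
    have "(LBINT r. f s r) = indicator {0..t} s * (V s y - ubar y)" for s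
      by (simp add: f_def V_def set_lebesgue_integral_def mult.assoc)
    moreover have "set_integrable lborel {0..t} (\<lambda>s. V s y)" by (rule V_set_integrable) simp
    moreover note set_integrable_const_Icc[of 0 t "ubar y"]
    ultimately show ?thesis
      using assms set_integral_diff(2)[of lborel "{0..t}" "\<lambda>s. V s y" "\<lambda>s. ubar y"]
      by (simp add: set_lebesgue_integral_def)
  qed
  moreover have "(LBINT r. LBINT s. f s r) = (LBINT s:{0..t}. (t - s) * \<phi> s y)"
  proof -
    have "(LBINT s. f s r) = indicator {0..t} r * ((t - r) * \<phi> r y)" for r
    proof -
      have "f s r = indicator {0..t} r * \<phi> r y * indicator {r..t} s" for s
        by (auto simp: f_def indicator_def)
      then have "(LBINT s. f s r) = indicator {0..t} r * \<phi> r y * (LBINT s. indicator {r..t} s)"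
        by (simp only: integral_mult_right_zero)
      then show ?thesis by (cases "r \<in> {0..t}") auto
    qed
    then show ?thesis by (simp add: set_lebesgue_integral_def)
  qed
  ultimately show ?thesis by (simp add: X_def)
qed

text \<open>The time spent alive is t or, for negative \<open>a x\<close>, the minimum of t and
  \<tau> = -2 / a x. Since \<tau> * a^2/2 = -a, the slope of \<open>V\<close> reaches zero exactly
  at the collapse and stays there.\<close>

lemma alive_time_integral:
  assumes "0 \<le> t"
  shows "a x + (LBINT s:{0..t}. alive s x) * ((a x)\<^sup>2 / 2) = a x * q t x"
proof (cases "0 \<le> a x")
  case True
  have "(LBINT s:{0..t}. alive s x) = (LBINT s:{0..t}. 1)"
    unfolding set_lebesgue_integral_def using True
    by (intro Bochner_Integration.integral_cong) (auto simp: alive_def indicator_def add_pos_nonneg)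
  also have "\<dots> = t" using assms by (simp add: set_lebesgue_integral_def)
  finally show ?thesis
    using True assms by (simp add: q_def max_def power2_eq_square algebra_simps)
next
  case False
  define \<tau> where "\<tau> = -2 / a x"
  have \<tau>: "0 < \<tau>" using False by (simp add: \<tau>_def divide_neg_neg)
  have alive: "alive s x = (if s < \<tau> then 1 else 0)" for s
    using False by (simp add: alive_def \<tau>_def field_simps) 
  have "(LBINT s:{0..t}. alive s x) = (LBINT s. indicator {0..min t \<tau>} s)"
    unfolding set_lebesgue_integral_def
    by (intro integral_discrete_difference[where X = "{\<tau>}"]) (auto simp: alive indicator_def)
  also have "\<dots> = min t \<tau>" using assms \<tau> by simp
  finally have I: "(LBINT s:{0..t}. alive s x) = min t \<tau>" .
  show ?thesis
  proof (cases "t < \<tau>")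
    case True
    then have "0 < 1 + t * a x / 2" using alive[of t] by (simp add: alive_def split: if_splits)
    with I True show ?thesis by (simp add: q_def power2_eq_square algebra_simps)
  next
    case F: False
    then have "q t x = 0" using alive[of t] alive_cases[of t x] by auto
    moreover have "\<tau> * ((a x)\<^sup>2 / 2) = - a x" using False by (simp add: \<tau>_def power2_eq_square)
    ultimately show ?thesis using I F by simp
  qed
qed

text \<open>Integrating the space density of \<open>\<phi>\<close> over time and exchanging the
  order leads to \<open>alive_time_integral\<close>; the initial slope \<open>a\<close> comes from
  \<open>ubar\<close>.\<close>

lemma V_diff:
  assumes "0 \<le> t" "y1 \<le> y2"
  shows "V t y2 - V t y1 = (LBINT y:{y1..y2}. a y * q t y)"
proof -
  define f where "f s x = indicator {0..t} s * (indicator {y1..y2} x * (alive s x * (a x)\<^sup>2 / 2))" for s x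
  have "(LBINT s. LBINT x. f s x) = (LBINT x. LBINT s. f s x)"
  proof (rule fubini_dominated(3)[OF _ integrable_indicator_Icc a_sq])
    show "(\<lambda>(s, x). f s x) \<in> borel_measurable (lborel \<Otimes>\<^sub>M lborel)"
      unfolding f_def by measurable
    show "\<bar>f s x\<bar> \<le> indicator {0..t} s * (a x)\<^sup>2" for s x
      using alive_bounds[of s x] by (auto simp: f_def indicator_def abs_mult mult_left_le_one_le intro:
        order_trans[OF mult_left_le_one_le])
  qed
  moreover have "(LBINT s. LBINT x. f s x) = (LBINT s:{0..t}. \<phi> s y2) - (LBINT s:{0..t}. \<phi> s y1)"
  proof -
    have "(LBINT x. f s x) = indicator {0..t} s * (\<phi> s y2 - \<phi> s y1)" for s
      unfolding f_def phi_diff[OF assms(2)] set_lebesgue_integral_def by simp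
    then show ?thesis
      using set_integral_diff(2)[OF phi_set_integrable phi_set_integrable, of 0 t y2 y1]
      by (simp add: set_lebesgue_integral_def)
  qed
  moreover have "(LBINT x. LBINT s. f s x) = (LBINT y:{y1..y2}. a y * q t y) - (LBINT y:{y1..y2}. a y)"
  proof -
    have "(LBINT s. f s x) = indicator {y1..y2} x * (a x * q t x - a x)" for x
    proof -
      have "f s x = (indicator {0..t} s * alive s x) * (indicator {y1..y2} x * ((a x)\<^sup>2 / 2))" for s
        by (simp add: f_def)
      then have "(LBINT s. f s x) = (LBINT s:{0..t}. alive s x) * (indicator {y1..y2} x * ((a x)\<^sup>2 / 2))"
        by (simp only: integral_mult_left_zero set_lebesgue_integral_def real_scaleR_def)
      also have "\<dots> = indicator {y1..y2} x * (a x * q t x - a x)"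
        unfolding alive_time_integral[OF assms(1), of x, symmetric] by simp
      finally show ?thesis .
    qed
    then show ?thesis
      using set_integral_diff(2)[OF set_integrable_a_q[OF assms(1)] set_integrable_a, of y1 y2]
      by (simp add: set_lebesgue_integral_def)
  qed
  ultimately show ?thesis
    using ubar_diff[OF assms(2)] by (simp add: V_def)
qed

text \<open>The square of the positive part is differentiable also at its zero, so one formula
  covers the times before, at and after the collapse.\<close>

lemma q_sq_has_derivative: "((\<lambda>s. (q s x)\<^sup>2) has_real_derivative a x * q s x) (at s)"
proof -
  have pos: "((\<lambda>z::real. (max 0 z)\<^sup>2) has_real_derivative 2 * max 0 z) (at z)" for z
  proof -
    have lim: "((\<lambda>h. ((max 0 (z + h))\<^sup>2 - (max 0 z)\<^sup>2) / h) \<longlongrightarrow> 2 * max 0 z) (at 0)"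
    proof (cases "z = 0")
      case True
      have "((\<lambda>h::real. max 0 h) \<longlongrightarrow> max 0 0) (at 0)" by (intro tendsto_intros)
      then have "((\<lambda>h::real. max 0 h) \<longlongrightarrow> 0) (at 0)" by simp
      moreover have "((max 0 (z + h))\<^sup>2 - (max 0 z)\<^sup>2) / h = max 0 h" for h
        using True by (auto simp: max_def power2_eq_square)
      ultimately show ?thesis using True by simp
    next
      case False
      have "((\<lambda>w. (max 0 w)\<^sup>2) has_real_derivative 2 * max 0 z) (at z)"
      proof (cases "0 < z")
        case True
        have "((\<lambda>w. w\<^sup>2) has_real_derivative 2 * max 0 z) (at z)"
          using True by (auto intro!: derivative_eq_intros)
        then show ?thesis
          by (rule has_field_derivative_transform_within_open[of _ _ _ "{0<..}"]) (use True in auto)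
      next
        case F: False
        have "((\<lambda>w. 0::real) has_real_derivative 2 * max 0 z) (at z)"
          using F by (auto intro!: derivative_eq_intros)
        then show ?thesis
          by (rule has_field_derivative_transform_within_open[of _ _ _ "{..<0}"]) (use F False in auto)
      qed
      then show ?thesis by (simp add: DERIV_def)
    qed
    then show ?thesis by (simp add: DERIV_def)
  qed
  have "((\<lambda>s. 1 + s * a x / 2) has_real_derivative a x / 2) (at s)"
    by (auto intro!: derivative_eq_intros)
  from DERIV_chain2[OF pos this] show ?thesis
    by (simp add: q_def mult.commute)
qed

lemma q_time_integral:
  assumes "0 \<le> t"
  shows "(LBINT s:{0..t}. a x * q s x) = (q t x)\<^sup>2 - 1"
proof -
  have "(LBINT s. (a x * q s x) * indicator {0..t} s) = (q t x)\<^sup>2 - (q 0 x)\<^sup>2"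
    by (rule integral_FTC_Icc_real[OF assms q_sq_has_derivative]) (auto simp: q_def intro!: continuous_intros)
  moreover have "q 0 x = 1" by (simp add: q_def)
  ultimately show ?thesis
    unfolding set_lebesgue_integral_def real_scaleR_def mult.commute[of "indicator _ _"] by simp
qed

text \<open>By \<open>X_eq\<close> the density of \<open>X\<close> is 1 plus the time integral of
  the density a*q of \<open>V\<close>; by \<open>q_time_integral\<close> that integral is q^2 -
  1.\<close>

lemma X_diff:
  assumes "0 \<le> t" "y1 \<le> y2"
  shows "X t y2 - X t y1 = (LBINT y:{y1..y2}. (q t y)\<^sup>2)"
proof -
  define f where "f s y = indicator {0..t} s * (indicator {y1..y2} y * (a y * q s y))" for s y
  have Vi: "set_integrable lborel {0..t} (\<lambda>s. V s y)" for y by (rule V_set_integrable) simp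
  have dom: "integrable lborel (\<lambda>y. indicator {y1..y2} y *\<^sub>R (1 + (1 + t / 2) * (a y)\<^sup>2))"
    using set_integrable_dom[of "\<lambda>y. 1 + (1 + t / 2) * (a y)\<^sup>2" 1 "1 + t / 2" y1 y2] assms(1)
    by (simp add: set_integrable_def)
  have "(LBINT s. LBINT x. f s x) = (LBINT x. LBINT s. f s x)"
  proof (rule fubini_dominated(3)[OF _ integrable_indicator_Icc dom])
    show "(\<lambda>(s, x). f s x) \<in> borel_measurable (lborel \<Otimes>\<^sub>M lborel)"
      unfolding f_def by measurable
    show "\<bar>f s x\<bar> \<le> indicator {0..t} s * (indicator {y1..y2} x *\<^sub>R (1 + (1 + t / 2) * (a x)\<^sup>2))" for s x
    proof (cases "s \<in> {0..t} \<and> x \<in> {y1..y2}")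
      case True
      have "(1 + s / 2) * (a x)\<^sup>2 \<le> (1 + t / 2) * (a x)\<^sup>2"
        using True by (intro mult_right_mono) auto
      then show ?thesis using a_q_bound[of s x] True by (simp add: f_def)
    qed (auto simp: f_def)
  qed
  moreover have "(LBINT s. LBINT x. f s x) = (LBINT s:{0..t}. V s y2) - (LBINT s:{0..t}. V s y1)"
  proof -
    have "(LBINT x. f s x) = indicator {0..t} s * (V s y2 - V s y1)" for s
      using V_diff[OF _ assms(2), of s] by (cases "s \<in> {0..t}") (auto simp: f_def set_lebesgue_integral_def)
    then show ?thesis
      using set_integral_diff(2)[OF Vi Vi, of y2 y1] by (simp add: set_lebesgue_integral_def)
  qed
  moreover have "(LBINT x. LBINT s. f s x) = (LBINT y:{y1..y2}. (q t y)\<^sup>2) - (y2 - y1)"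
  proof -
    have "f s x = indicator {y1..y2} x * (indicator {0..t} s * (a x * q s x))" for s x
      by (simp add: f_def)
    then have "(LBINT s. f s x) = indicator {y1..y2} x * (LBINT s:{0..t}. a x * q s x)" for x
      by (simp only: set_lebesgue_integral_def integral_mult_right_zero real_scaleR_def)
    then have "(LBINT s. f s x) = indicator {y1..y2} x * ((q t x)\<^sup>2 - 1)" for x
      by (simp only: q_time_integral[OF assms(1)])
    moreover note set_integrable_const_Icc[of y1 y2 1]
    ultimately show ?thesis
      using set_integral_diff(2)[OF set_integrable_q_sq[OF assms(1)], of y1 y2 "\<lambda>_. 1"] assms(2)
      by (simp add: set_lebesgue_integral_def)
  qed
  ultimately show ?thesis
    using X_eq[OF assms(1)] by simp
qed

lemma X_mono: "0 \<le> t \<Longrightarrow> y1 \<le> y2 \<Longrightarrow> X t y1 \<le> X t y2"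
  using X_diff[of t y1 y2] set_integral_nonneg_real[of "\<lambda>y. (q t y)\<^sup>2" "{y1..y2}"] by simp

lemma X_cont: "0 \<le> t \<Longrightarrow> continuous_on UNIV (X t)"
  by (rule continuous_on_indefinite_integral[OF set_integrable_q_sq X_diff])

lemma X_0: "X 0 y = y" and V_0: "V 0 y = ubar y"
proof -
  have "(LBINT s:{0..0}. f s) = 0" for f :: "real \<Rightarrow> real"
    using set_integral_Icc_Ioo[of 0 0 f] by (simp add: set_lebesgue_integral_def)
  then show "X 0 y = y" "V 0 y = ubar y" by (auto simp: X_def V_def)
qed

text \<open>Young's inequality \<open>\<bar>a q\<bar> \<le> (c/2) a\<^sup>2 + q\<^sup>2/(2c)\<close>, where \<open>a q = V\<^sub>y\<close> and \<open>q\<^sup>2 = X\<^sub>y\<close>.\<close>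

lemma V_diff_le:
  assumes "0 \<le> t" "y1 \<le> y2" "0 < c"
  shows "\<bar>V t y2 - V t y1\<bar> \<le> c / 2 * (LBINT y:{y1<..<y2}. (a y)\<^sup>2) + (X t y2 - X t y1) / (2 * c)"
proof -
  have young: "\<bar>a y * q t y\<bar> \<le> c / 2 * (a y)\<^sup>2 + 1 / (2 * c) * (q t y)\<^sup>2" for y
  proof -
    have "2 * (c * \<bar>a y\<bar>) * q t y \<le> (c * \<bar>a y\<bar>)\<^sup>2 + (q t y)\<^sup>2"
      by (rule sum_squares_bound)
    then have "2 * (c * \<bar>a y\<bar>) * q t y / (2 * c) \<le> ((c * \<bar>a y\<bar>)\<^sup>2 + (q t y)\<^sup>2) / (2 * c)"
      using \<open>0 < c\<close> by (intro divide_right_mono) auto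
    moreover have "2 * (c * \<bar>a y\<bar>) * q t y / (2 * c) = \<bar>a y * q t y\<bar>"
      using \<open>0 < c\<close> q_nonneg[of t y] by (simp add: abs_mult)
    moreover have "((c * \<bar>a y\<bar>)\<^sup>2 + (q t y)\<^sup>2) / (2 * c) = c / 2 * (a y)\<^sup>2 + 1 / (2 * c) * (q t y)\<^sup>2"
      unfolding power_mult_distrib power2_abs using \<open>0 < c\<close> by (simp add: field_simps power2_eq_square)
    ultimately show ?thesis by simp
  qed
  have i: "set_integrable lborel {y1..y2} (\<lambda>y. c / 2 * (a y)\<^sup>2)"
    "set_integrable lborel {y1..y2} (\<lambda>y. 1 / (2 * c) * (q t y)\<^sup>2)"
    using set_integrable_lborel[OF a_sq, of "{y1..y2}"] set_integrable_q_sq[OF assms(1)] by auto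
  have "\<bar>V t y2 - V t y1\<bar> \<le> (LBINT y:{y1..y2}. \<bar>a y * q t y\<bar>)"
    unfolding V_diff[OF assms(1,2)] by (rule abs_set_integral_le)
  also have "\<dots> \<le> (LBINT y:{y1..y2}. c / 2 * (a y)\<^sup>2 + 1 / (2 * c) * (q t y)\<^sup>2)"
    using young i by (intro set_integral_mono set_integrable_abs set_integrable_a_q assms set_integral_add) auto
  also have "\<dots> = c / 2 * (LBINT y:{y1..y2}. (a y)\<^sup>2) + 1 / (2 * c) * (LBINT y:{y1..y2}. (q t y)\<^sup>2)"
    using i by (simp only: set_integral_add(2) set_integral_mult_right)
  finally show ?thesis
    using X_diff[OF assms(1,2)] by (simp add: set_integral_Icc_Ioo[of _ _ "\<lambda>y. (a y)\<^sup>2"])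
qed

lemma V_diff_le_energy:
  assumes "0 \<le> t" "y1 \<le> y2" "0 < c"
  shows "\<bar>V t y2 - V t y1\<bar> \<le> c / 2 * energy + (X t y2 - X t y1) / (2 * c)"
proof -
  have "(LBINT y:{y1<..<y2}. (a y)\<^sup>2) \<le> energy"
    unfolding energy_def by (rule set_integral_le_integral[OF a_sq]) auto
  then have "c / 2 * (LBINT y:{y1<..<y2}. (a y)\<^sup>2) \<le> c / 2 * energy"
    using assms(3) by (intro mult_left_mono) auto
  with V_diff_le[OF assms] show ?thesis by linarith
qed

text \<open>Young's inequality with the best constant. Increments of \<open>V\<close> are thus
  controlled by those of \<open>X\<close> alone, which makes \<open>u\<close> well defined and
  Hoelder continuous with exponent 1/2. The summand 1 keeps the optimal constant meaningful when the
  energy is zero.\<close>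

lemma V_holder:
  assumes "0 \<le> t"
  shows "\<bar>V t y2 - V t y1\<bar> \<le> sqrt ((energy + 1) * \<bar>X t y2 - X t y1\<bar>)"
proof -
  have *: "\<bar>V t y2 - V t y1\<bar> \<le> sqrt ((energy + 1) * \<bar>X t y2 - X t y1\<bar>)" if "y1 \<le> y2" for y1 y2
  proof -
    define D where "D = X t y2 - X t y1"
    have D: "0 \<le> D" using X_mono[OF assms that] by (simp add: D_def)
    have le: "\<bar>V t y2 - V t y1\<bar> \<le> c / 2 * (energy + 1) + D / (2 * c)" if "0 < c" for c
    proof -
      have "c / 2 * energy \<le> c / 2 * (energy + 1)" using that by (intro mult_left_mono) auto
      then show ?thesis using V_diff_le_energy[OF assms \<open>y1 \<le> y2\<close> that] by (simp add: D_def)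
    qed
    have E: "0 < energy + 1" using energy_nonneg by simp
    show ?thesis
    proof (cases "D = 0")
      case True
      have "\<bar>V t y2 - V t y1\<bar> \<le> 0"
      proof (rule field_le_epsilon)
        fix e :: real assume "0 < e"
        \<comment> \<open>With D = 0 the second term disappears, so the constant may be taken
          arbitrarily small.\<close>
        define c where "c = e / (energy + 1)"
        have c: "0 < c" "c * (energy + 1) = e" using \<open>0 < e\<close> E by (auto simp: c_def)
        have "\<bar>V t y2 - V t y1\<bar> \<le> 2 * c / 2 * (energy + 1) + D / (2 * (2 * c))"
          using c(1) by (intro le) simp
        also have "\<dots> = 0 + e" using c(2) True by simp
        finally show "\<bar>V t y2 - V t y1\<bar> \<le> 0 + e" .
      qed
      then show ?thesis using E by simp
    next
      case False
      then have D: "0 < D" using D by simp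
      \<comment> \<open>This value makes the two terms of the bound equal.\<close>
      define c where "c = sqrt (D / (energy + 1))"
      have c: "0 < c" using D E by (simp add: c_def)
      have c2: "c * c = D / (energy + 1)" using D E by (simp add: c_def)
      have "D / (2 * c) = c / 2 * (energy + 1)"
        using c c2 E by (simp add: field_simps)
      moreover have "c * (energy + 1) = sqrt ((energy + 1) * D)"
      proof -
        have "(c * (energy + 1))\<^sup>2 = c * c * (energy + 1) * (energy + 1)"
          by (simp add: power2_eq_square)
        also have "c * c * (energy + 1) = D" using c2 E by simp
        finally have "(c * (energy + 1))\<^sup>2 = (energy + 1) * D" by (simp only: mult.commute)
        then show ?thesis using c E by (intro real_sqrt_unique[symmetric]) auto
      qed
      ultimately have "\<bar>V t y2 - V t y1\<bar> \<le> sqrt ((energy + 1) * D)" using le[OF c] by simp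
      then show ?thesis using D by (simp add: D_def)
    qed
  qed
  show ?thesis
    using *[of y1 y2] *[of y2 y1] by (cases "y1 \<le> y2") (auto simp: abs_minus_commute)
qed

text \<open>Young's inequality at time 0 lets \<open>ubar\<close> grow with as small a slope as
  desired, so \<open>X t\<close> differs from the identity by at most a constant plus |y|/2,
  uniformly for t <= T. This yields surjectivity, and it keeps preimages of bounded sets bounded
  uniformly in time.\<close>

lemma X_growth:
  assumes "0 \<le> T"
  obtains C where "0 \<le> C" "\<And>t y. 0 \<le> t \<Longrightarrow> t \<le> T \<Longrightarrow> \<bar>y\<bar> \<le> 2 * (C + \<bar>X t y\<bar>)"
    "\<And>t y. 0 \<le> t \<Longrightarrow> t \<le> T \<Longrightarrow> \<bar>X t y - y\<bar> \<le> C + \<bar>y\<bar> / 2"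
proof -
  define C where "C = T * \<bar>ubar 0\<bar> + T * ((T + 1) / 2 * energy) + T * (T * (energy / 4))"
  have C: "0 \<le> C" using assms energy_nonneg by (simp add: C_def)
  have *: "\<bar>X t y - y\<bar> \<le> C + \<bar>y\<bar> / 2" if t: "0 \<le> t" "t \<le> T" for t y
  proof -
    \<comment> \<open>The constant T + 1 gives the slope 1/(2*(T + 1)), which multiplication by t <=
      T keeps below 1/2.\<close>
    have u: "\<bar>ubar y\<bar> \<le> \<bar>ubar 0\<bar> + (T + 1) / 2 * energy + \<bar>y\<bar> / (2 * (T + 1))"
      using V_diff_le_energy[of 0 0 y "T + 1"] V_diff_le_energy[of 0 y 0 "T + 1"] assms
      by (cases "0 \<le> y") (auto simp: X_0 V_0)
    have "\<bar>(LBINT s:{0..t}. (t - s) * \<phi> s y) - (t - 0) * 0\<bar> \<le> (T * (energy / 4)) * (t - 0)"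
    proof (rule set_integral_const_dist[OF t(1)])
      have "set_integrable lborel {0..t} (\<lambda>s. (t - s) * indicator {0..t} s * \<phi> s y)"
      proof (rule set_integrable_dom[of _ "t * (energy / 4)" 0])
        fix s
        have "\<bar>t - s\<bar> * \<bar>\<phi> s y\<bar> \<le> t * (energy / 4)" if "0 \<le> s" "s \<le> t"
          using phi_abs[of s y] that by (intro mult_mono) auto
        then show "\<bar>(t - s) * indicator {0..t} s * \<phi> s y\<bar> \<le> t * (energy / 4) + 0 * (a s)\<^sup>2"
          using t energy_nonneg by (cases "s \<in> {0..t}") (auto simp: abs_mult)
      qed measurable
      also have "?this = set_integrable lborel {0..t} (\<lambda>s. (t - s) * \<phi> s y)"
        by (rule set_integrable_cong) (auto simp: indicator_def)
      finally show "set_integrable lborel {0..t} (\<lambda>s. (t - s) * \<phi> s y)" .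
      fix s assume "0 \<le> s" "s \<le> t"
      then have "\<bar>t - s\<bar> * \<bar>\<phi> s y\<bar> \<le> T * (energy / 4)"
        using phi_abs[of s y] t by (intro mult_mono) auto
      then show "\<bar>(t - s) * \<phi> s y - 0\<bar> \<le> T * (energy / 4)" by (simp add: abs_mult)
    qed
    also have "\<dots> \<le> (T * (energy / 4)) * T" using t energy_nonneg by (intro mult_left_mono) auto
    finally have I: "\<bar>LBINT s:{0..t}. (t - s) * \<phi> s y\<bar> \<le> T * (T * (energy / 4))" by (simp add: mult.commute)
    have "t * \<bar>ubar y\<bar> \<le> T * (\<bar>ubar 0\<bar> + (T + 1) / 2 * energy + \<bar>y\<bar> / (2 * (T + 1)))"
      using u t by (intro mult_mono) auto
    also have "\<dots> = T * \<bar>ubar 0\<bar> + T * ((T + 1) / 2 * energy) + T / (T + 1) * (\<bar>y\<bar> / 2)"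
      using assms by (simp add: distrib_left)
    also have "T / (T + 1) * (\<bar>y\<bar> / 2) \<le> 1 * (\<bar>y\<bar> / 2)"
      using assms by (intro mult_right_mono) auto
    finally have "\<bar>t * ubar y\<bar> \<le> T * \<bar>ubar 0\<bar> + T * ((T + 1) / 2 * energy) + \<bar>y\<bar> / 2"
      using t by (simp add: abs_mult)
    moreover have "X t y - y = t * ubar y + (LBINT s:{0..t}. (t - s) * \<phi> s y)"
      by (simp add: X_def)
    ultimately show ?thesis using I by (simp add: C_def)
  qed
  moreover have "\<bar>y\<bar> \<le> 2 * (C + \<bar>X t y\<bar>)" if "0 \<le> t" "t \<le> T" for t y
  proof -
    have "\<bar>y\<bar> \<le> \<bar>X t y - y\<bar> + \<bar>X t y\<bar>" by arith
    then show ?thesis using *[OF that, of y] by argo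
  qed
  ultimately show ?thesis using C that by blast
qed

lemma X_surj:
  assumes "0 \<le> t" shows "\<exists>y. X t y = x"
proof -
  obtain C where C: "0 \<le> C" "\<And>s y. 0 \<le> s \<Longrightarrow> s \<le> t \<Longrightarrow> \<bar>X s y - y\<bar> \<le> C + \<bar>y\<bar> / 2"
    using X_growth[OF assms] by metis
  define r where "r = 2 * (C + \<bar>x\<bar>)"
  have r: "0 \<le> r" "\<bar>r\<bar> = r" "\<bar>- r\<bar> = r" "C - r / 2 \<le> x" "x \<le> r / 2 - C"
    using C(1) by (auto simp: r_def field_simps)
  have "\<exists>y. - r \<le> y \<and> y \<le> r \<and> X t y = x"
  proof (rule IVT')
    show "X t (- r) \<le> x" using C(2)[OF assms order_refl, of "- r"] r by linarith
    show "x \<le> X t r" using C(2)[OF assms order_refl, of r] r by linarith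
    show "- r \<le> r" using r by simp
    show "continuous_on {- r..r} (X t)" using X_cont[OF assms] by (rule continuous_on_subset) simp
  qed
  then show ?thesis by blast
qed

text \<open>Any preimage will do, because \<open>V t\<close> is constant on the level sets of
  \<open>X t\<close>. Every choice is strictly increasing in x, since \<open>X t\<close> is
  nondecreasing.\<close>

definition "label t x = (SOME y. X t y = x)"
definition "u t x = V t (label t x)"

lemma X_label: "0 \<le> t \<Longrightarrow> X t (label t x) = x"
  unfolding label_def by (rule someI_ex) (rule X_surj)

lemma V_eq_if_X_eq: "0 \<le> t \<Longrightarrow> X t y = X t z \<Longrightarrow> V t y = V t z"
  using V_holder[of t z y] by simp

lemma u_X: "0 \<le> t \<Longrightarrow> u t (X t y) = V t y"
  unfolding u_def by (rule V_eq_if_X_eq) (auto simp: X_label)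

lemma label_strict_mono: "0 \<le> t \<Longrightarrow> x < z \<Longrightarrow> label t x < label t z"
  using X_mono[of t "label t z" "label t x"] X_label[of t] by (metis not_le)

lemma label_mono: "0 \<le> t \<Longrightarrow> x \<le> z \<Longrightarrow> label t x \<le> label t z"
  using label_strict_mono[of t x z] by (cases "x = z") auto

end

section \<open>The solution in Eulerian variables\<close>

context hunter_saxton_data
begin

lemma X_meas: "0 \<le> t \<Longrightarrow> X t \<in> borel_measurable borel"
  by (rule borel_measurable_continuous_onI[OF X_cont])

lemma nn_integral_q_sq_Icc:
  assumes "0 \<le> t" "y1 \<le> y2"
  shows "(\<integral>\<^sup>+y. ennreal ((q t y)\<^sup>2) * indicator {y1..y2} y \<partial>lborel) = ennreal (X t y2 - X t y1)"
proof -
  have "(\<integral>\<^sup>+y. ennreal ((q t y)\<^sup>2) * indicator {y1..y2} y \<partial>lborel)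
      = (\<integral>\<^sup>+y. ennreal (indicator {y1..y2} y *\<^sub>R (q t y)\<^sup>2) \<partial>lborel)"
    by (intro nn_integral_cong) (auto simp: indicator_def)
  also have "\<dots> = ennreal (LBINT y:{y1..y2}. (q t y)\<^sup>2)"
    unfolding set_lebesgue_integral_def
    using set_integrable_q_sq[OF assms(1), of y1 y2]
    by (intro nn_integral_eq_integral) (auto simp: set_integrable_def)
  finally show ?thesis using X_diff[OF assms] by simp
qed

abbreviation "pushforward t \<equiv> distr (density lborel (\<lambda>y. ennreal ((q t y)\<^sup>2))) borel (X t)"

text \<open>Since \<open>X\<^sub>y = q\<^sup>2\<close>, the monotone map \<open>X t\<close> pushes the measure \<open>q\<^sup>2 dy\<close> forward to \<open>dx\<close>.\<close>

lemma lborel_eq_distr_X: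
  assumes t: "0 \<le> t"
  shows "lborel = pushforward t"
proof (rule lborel_eqI)
  have [measurable]: "X t \<in> borel_measurable borel" by (rule X_meas[OF t])
  fix l u :: real assume "\<And>b. b \<in> Basis \<Longrightarrow> l \<bullet> b \<le> u \<bullet> b"
  then have lu: "l \<le> u" by simp
  define m where "m A = (\<integral>\<^sup>+y. ennreal ((q t y)\<^sup>2) * indicator A y \<partial>lborel)" for A
  have m_mono: "m A \<le> m B" if "A \<subseteq> B" for A B
    unfolding m_def using that by (intro nn_integral_mono) (auto simp: indicator_def)
  have em: "emeasure (pushforward t) (box l u) = m (X t -` box l u)"
  proof -
    have "X t -` box l u \<in> sets borel" using measurable_sets[of "X t"
      borel borel "box l u"] X_meas[OF t] by simp
    then show ?thesis unfolding m_def by (subst emeasure_distr; (subst emeasure_density)?) auto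
  qed
  have less: "y < z" if "X t y < X t z" for y z
    using X_mono[OF t, of z y] that by (cases "z \<le> y") auto
  have "m (X t -` box l u) \<le> m {label t l..label t u}"
  proof (rule m_mono, rule subsetI)
    fix y assume "y \<in> X t -` box l u"
    then have "X t (label t l) < X t y" "X t y < X t (label t u)" by (auto simp: box_real X_label[OF t])
    then have "label t l < y" "y < label t u" by (auto intro: less)
    then show "y \<in> {label t l..label t u}" by simp
  qed
  also have "\<dots> = ennreal (u - l)"
    unfolding m_def using nn_integral_q_sq_Icc[OF t label_mono[OF t lu]] by (simp add: X_label[OF t])
  finally have le: "m (X t -` box l u) \<le> ennreal (u - l)" .
  have ge: "ennreal (u - l) \<le> m (X t -` box l u)"
  proof (rule ennreal_le_epsilon)
    fix e :: real assume "0 < e"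
    show "ennreal (u - l) \<le> m (X t -` box l u) + ennreal e"
    proof (cases "u - l \<le> e")
      case True
      then have "ennreal (u - l) \<le> 0 + ennreal e" by (simp add: ennreal_leI)
      also have "\<dots> \<le> m (X t -` box l u) + ennreal e" by (intro add_right_mono) simp
      finally show ?thesis .
    next
      case False
      \<comment> \<open>The labels of \<open>l\<close> and \<open>u\<close> are mapped to the end
        points, outside the open box; moving both inwards by e/2 costs e in length.\<close>
      define l' u' where "l' = l + e / 2" and "u' = u - e / 2"
      have lu': "l' \<le> u'" "l < l'" "u' < u" using False \<open>0 < e\<close> by (auto simp: l'_def u'_def field_simps)
      have sub: "{label t l'..label t u'} \<subseteq> X t -` box l u"
      proof
        fix y assume "y \<in> {label t l'..label t u'}"
        then have "X t (label t l') \<le> X t y" "X t y \<le> X t (label t u')"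
          using X_mono[OF t] by auto
        then show "y \<in> X t -` box l u" using lu' by (simp add: box_real X_label[OF t])
      qed
      have "ennreal (u - l) = ennreal ((u' - l') + e)"
        by (simp add: l'_def u'_def)
      also have "\<dots> = ennreal (u' - l') + ennreal e"
        using lu' \<open>0 < e\<close> by (intro ennreal_plus) auto
      also have "ennreal (u' - l') = m {label t l'..label t u'}"
        unfolding m_def using nn_integral_q_sq_Icc[OF t label_mono[OF t lu'(1)]] by (simp add: X_label[OF t])
      also have "\<dots> + ennreal e \<le> m (X t -` box l u) + ennreal e"
        by (intro add_right_mono m_mono sub)
      finally show ?thesis .
    qed
  qed
  show "emeasure (pushforward t) (box l u) = ennreal (\<Prod>b\<in>Basis. (u - l) \<bullet> b)"
    unfolding em using le ge by simp
qed simp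

lemma integral_X:
  fixes f :: "real \<Rightarrow> real"
  assumes t: "0 \<le> t" and [measurable]: "f \<in> borel_measurable borel"
  shows "integrable lborel f \<longleftrightarrow> integrable lborel (\<lambda>y. (q t y)\<^sup>2 * f (X t y))"
    and "integral\<^sup>L lborel f = (LBINT y. (q t y)\<^sup>2 * f (X t y))"
proof -
  have [measurable]: "X t \<in> borel_measurable borel" by (rule X_meas[OF t])
  have "integrable lborel f \<longleftrightarrow> integrable (pushforward t) f"
    by (subst lborel_eq_distr_X[OF t]) simp
  also have "\<dots> \<longleftrightarrow> integrable lborel (\<lambda>y. (q t y)\<^sup>2 * f (X t y))"
    by (subst integrable_distr_eq; (subst integrable_density)?) auto
  finally show "integrable lborel f \<longleftrightarrow> integrable lborel (\<lambda>y. (q t y)\<^sup>2 * f (X t y))" .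
  have "integral\<^sup>L lborel f = integral\<^sup>L (pushforward t) f"
    by (subst lborel_eq_distr_X[OF t]) simp
  also have "\<dots> = (LBINT y. (q t y)\<^sup>2 * f (X t y))"
    by (subst integral_distr; (subst integral_density)?) auto
  finally show "integral\<^sup>L lborel f = (LBINT y. (q t y)\<^sup>2 * f (X t y))" .
qed

text \<open>The preimage of a null set has measure zero for q^2 dy, hence is null among labels with
  q > 0. Among the others it may be large, since an interval of labels can be mapped to one
  point.\<close>

lemma AE_X:
  assumes t: "0 \<le> t" and "AE x in lborel. P x"
  shows "AE y in lborel. 0 < q t y \<longrightarrow> P (X t y)"
proof -
  have [measurable]: "X t \<in> borel_measurable borel" by (rule X_meas[OF t])
  obtain N where N: "{x \<in> space lborel. \<not> P x} \<subseteq> N" "N \<in> null_sets lborel"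
    using assms(2) unfolding eventually_ae_filter by blast
  then have [measurable]: "N \<in> sets borel" by auto
  have "emeasure (pushforward t) N = 0"
    using N(2) by (subst lborel_eq_distr_X[OF t, symmetric]) auto
  from this have "(\<integral>\<^sup>+y. ennreal ((q t y)\<^sup>2) * indicator (X t -` N) y \<partial>lborel) = 0"
  proof -
    assume *: "emeasure (pushforward t) N = 0"
    have "X t -` N \<in> sets borel" using measurable_sets[of "X t" borel borel N] X_meas[OF t] by simp
    then show ?thesis using * by (subst (asm) emeasure_distr; (subst (asm) emeasure_density)?) auto
  qed
  then have "AE y in lborel. ennreal ((q t y)\<^sup>2) * indicator (X t -` N) y = 0"
    by (subst (asm) nn_integral_0_iff_AE) auto
  then show ?thesis
    by eventually_elim (use N(1) in \<open>auto simp: indicator_def split: if_splits\<close>)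
qed

text \<open>A single point is a null set, so its preimage can have positive measure only through
  collapsed labels.\<close>

lemma AE_level_set:
  assumes "0 \<le> t"
  shows "AE y in lborel. X t y = x \<longrightarrow> q t y = 0"
  using AE_X[OF assms AE_lborel_singleton[of x]]
  by eventually_elim (use q_nonneg[of t] in \<open>auto simp: less_le\<close>)

lemma u_holder: "0 \<le> t \<Longrightarrow> \<bar>u t x - u t z\<bar> \<le> sqrt ((energy + 1) * \<bar>x - z\<bar>)"
  using V_holder[of t "label t x" "label t z"] by (simp add: u_def X_label)

lemma X_time_diff:
  assumes "0 \<le> s" "s \<le> t"
  shows "X t y - X s y = (LBINT r:{s..t}. V r y)"
proof -
  have "(LBINT r:{0..t}. V r y) = (LBINT r:{0..s}. V r y) + (LBINT r:{s..t}. V r y)"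
    by (rule set_integral_Icc_split[OF V_set_integrable assms]) simp
  then show ?thesis using assms by (simp add: X_eq)
qed

lemma X_time_dist:
  assumes "0 \<le> s" "0 \<le> t"
  shows "\<bar>X s y - X t y - (s - t) * V t y\<bar> \<le> energy / 4 * \<bar>s - t\<bar> * \<bar>s - t\<bar>"
proof -
  have V: "\<bar>V r y - V t y\<bar> \<le> energy / 4 * \<bar>s - t\<bar>" if "min s t \<le> r" "r \<le> max s t" for r
  proof -
    have "\<bar>V r y - V t y\<bar> \<le> energy / 4 * \<bar>r - t\<bar>"
      using V_time_lipschitz[of t r y] assms that by auto
    also have "\<dots> \<le> energy / 4 * \<bar>s - t\<bar>"
      using that energy_nonneg by (intro mult_left_mono) auto
    finally show ?thesis .
  qed
  show ?thesis
  proof (cases "s \<le> t")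
    case True
    have "\<bar>(LBINT r:{s..t}. V r y) - (t - s) * V t y\<bar> \<le> (energy / 4 * \<bar>s - t\<bar>) * (t - s)"
      using V True by (intro set_integral_const_dist V_set_integrable assms) auto
    moreover have "X s y - X t y - (s - t) * V t y = - ((LBINT r:{s..t}. V r y) - (t - s) * V t y)"
      using X_time_diff[OF assms(1) True, of y] by (simp add: algebra_simps)
    moreover have "\<bar>s - t\<bar> = t - s" using True by simp
    ultimately show ?thesis by (simp only: abs_minus_cancel)
  next
    case False
    then have "\<bar>(LBINT r:{t..s}. V r y) - (s - t) * V t y\<bar> \<le> (energy / 4 * \<bar>s - t\<bar>) * (s - t)"
      using V by (intro set_integral_const_dist V_set_integrable assms) auto
    then show ?thesis using False X_time_diff[OF assms(2), of s y] by simp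
  qed
qed

text \<open>Position at time s, earlier or later than t, of a characteristic that is at x at time
  t.\<close>

definition "flow s t x = X s (label t x)"

lemma u_flow: "0 \<le> s \<Longrightarrow> u s (flow s t x) = V s (label t x)"
  by (simp add: flow_def u_X)

lemma u_flow_dist:
  assumes "0 \<le> s" "0 \<le> t"
  shows "\<bar>u s (flow s t x) - u t x\<bar> \<le> energy / 4 * \<bar>s - t\<bar>"
  using V_time_lipschitz[OF assms(2,1)] u_flow[OF assms(1)] by (simp add: u_def)

lemma flow_dist:
  assumes "0 \<le> s" "0 \<le> t"
  shows "\<bar>flow s t x - x - (s - t) * u t x\<bar> \<le> energy / 4 * \<bar>s - t\<bar> * \<bar>s - t\<bar>"
  using X_time_dist[OF assms, of "label t x"] by (simp add: flow_def u_def X_label assms)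

text \<open>Following the characteristic through (t, x) to time s changes \<open>u\<close> by at
  most a multiple of |s - t|. The spatial distance that remains at time s is handled by
  \<open>u_holder\<close>.\<close>

lemma u_joint_cont: "continuous_on ({0..} \<times> UNIV) (\<lambda>(t, x). u t x)"
  unfolding continuous_on_def
proof (rule ballI)
  fix p :: "real \<times> real" assume "p \<in> {0..} \<times> UNIV"
  then obtain t x where p: "p = (t, x)" and t: "t \<in> {0..}" by auto
  define B where "B p = sqrt ((energy + 1) * (\<bar>snd p - x\<bar> + \<bar>fst p - t\<bar> * \<bar>u t x\<bar> +
    energy / 4 * \<bar>fst p - t\<bar> * \<bar>fst p - t\<bar>))
      + energy / 4 * \<bar>fst p - t\<bar>" for p :: "real \<times> real"
  have "((\<lambda>p. B p) \<longlongrightarrow> B (t, x)) (at (t, x) within {0..} \<times> UNIV)"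
    unfolding B_def by (intro tendsto_intros) auto
  then have B: "((\<lambda>p. B p) \<longlongrightarrow> 0) (at (t, x) within {0..} \<times> UNIV)"
    by (simp add: B_def)
  have le: "\<bar>u s z - u t x\<bar> \<le> B (s, z)" if "0 \<le> s" for s z
  proof -
    have *: "\<bar>flow s t x - x\<bar> \<le> \<bar>(s - t) * u t x\<bar> + energy / 4 * \<bar>s - t\<bar> * \<bar>s - t\<bar>"
    proof -
      have "\<bar>flow s t x - x\<bar> \<le> \<bar>flow s t x - x - (s - t) * u t x\<bar> + \<bar>(s - t) * u t x\<bar>" by arith
      then show ?thesis using flow_dist[OF that, of t x] t by fastforce
    qed
    have "\<bar>z - flow s t x\<bar> \<le> \<bar>z - x\<bar> + \<bar>s - t\<bar> * \<bar>u t x\<bar> + energy / 4 * \<bar>s - t\<bar> * \<bar>s - t\<bar>"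
    proof -
      have "\<bar>z - flow s t x\<bar> \<le> \<bar>z - x\<bar> + \<bar>flow s t x - x\<bar>" by arith
      then show ?thesis using * unfolding abs_mult by linarith
    qed
    then have "sqrt ((energy + 1) * \<bar>z - flow s t x\<bar>) \<le>
        sqrt ((energy + 1) * (\<bar>z - x\<bar> + \<bar>s - t\<bar> * \<bar>u t x\<bar> + energy / 4 * \<bar>s - t\<bar> * \<bar>s - t\<bar>))"
      using energy_nonneg by (intro real_sqrt_le_mono mult_left_mono) auto
    moreover have "\<bar>u s z - u s (flow s t x)\<bar> \<le> sqrt ((energy + 1) * \<bar>z - flow s t x\<bar>)"
      by (rule u_holder[OF that])
    moreover have "\<bar>u s (flow s t x) - u t x\<bar> \<le> energy / 4 * \<bar>s - t\<bar>"
      using that t by (intro u_flow_dist) auto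
    moreover have "\<bar>u s z - u t x\<bar> \<le> \<bar>u s z - u s (flow s t x)\<bar> + \<bar>u s (flow s t x) - u t x\<bar>"
      by arith
    ultimately show ?thesis unfolding B_def fst_conv snd_conv by linarith
  qed
  have "((\<lambda>p. (case p of (t, x) \<Rightarrow> u t x) - u t x) \<longlongrightarrow> 0) (at (t, x) within {0..} \<times> UNIV)"
  proof (rule Lim_null_comparison[OF _ B])
    show "\<forall>\<^sub>F p in at (t, x) within {0..} \<times> UNIV. norm ((case p of (t, x) \<Rightarrow> u t x) - u t x) \<le> B p"
      unfolding eventually_at_filter using le by (auto intro!: always_eventually)
  qed
  then have "((\<lambda>(t, x). u t x) \<longlongrightarrow> u t x) (at (t, x) within {0..} \<times> UNIV)"
    by (rule LIM_zero_cancel)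
  then show "((\<lambda>(t, x). u t x) \<longlongrightarrow> (case p of (t, x) \<Rightarrow> u t x)) (at p within {0..} \<times> UNIV)"
    by (simp add: p)
qed

lemma u_cont: "0 \<le> t \<Longrightarrow> continuous_on UNIV (u t)"
proof -
  assume "0 \<le> t"
  have "continuous_on UNIV (\<lambda>x. (\<lambda>(t, x). u t x) (t, x))"
    by (rule continuous_on_compose2[OF u_joint_cont, where f = "\<lambda>x. (t, x)"])
      (intro continuous_intros, use \<open>0 \<le> t\<close> in auto)
  then show ?thesis by simp
qed

lemma u_meas: "0 \<le> t \<Longrightarrow> u t \<in> borel_measurable borel"
  by (rule borel_measurable_continuous_onI[OF u_cont])

text \<open>One constant in Young's inequality serves the whole family: the label intervals are
  disjoint, so their energies sum to at most \<open>energy\<close>, while the other terms sum to a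
  multiple of the total length.\<close>

lemma u_abs_cont:
  assumes t: "0 \<le> t"
  shows "abs_cont (u t)"
  unfolding abs_cont_def
proof (intro allI, unfold abs_cont_on_iff, intro allI impI)
  fix l r \<epsilon> :: real assume "0 < \<epsilon>"
  \<comment> \<open>Makes the energy term at most \<epsilon>/2; the length term is below
    \<epsilon>/2 as soon as the total length is below c * \<epsilon>.\<close>
  define c where "c = \<epsilon> / (energy + 1)"
  have c: "0 < c" "c / 2 * energy \<le> \<epsilon> / 2" using \<open>0 < \<epsilon>\<close> energy_nonneg by (auto simp: c_def field_simps)
  have "abs_cont_modulus dist {l..r} (u t) \<epsilon> (c * \<epsilon>)"
    unfolding abs_cont_modulus_def
  proof (intro allI impI)
    fix n p p' assume fam: "interval_family {..<n::nat} p p'" and small: "(\<Sum>i<n. p' i - p i) < c * \<epsilon>"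
    have pq: "p i \<le> p' i" if "i < n" for i using fam that by (auto simp: interval_family_def)
    let ?A = "\<lambda>i. {label t (p i)<..<label t (p' i)}"
    have disj: "disjoint_family_on ?A {..<n}"
      unfolding disjoint_family_on_def
    proof (intro ballI impI)
      fix i j assume ij: "i \<in> {..<n}" "j \<in> {..<n}" "i \<noteq> j"
      then have "{p i<..<p' i} \<inter> {p j<..<p' j} = {}" using fam by (auto simp: interval_family_def)
      then have "p' i \<le> p i \<or> p' j \<le> p j \<or> p' i \<le> p j \<or> p' j \<le> p i"
        by (auto simp: max_def min_def split: if_splits)
      then show "?A i \<inter> ?A j = {}"
        using label_mono[OF t, of "p' i" "p i"] label_mono[OF t, of "p' j" "p j"]
          label_mono[OF t, of "p' i" "p j"] label_mono[OF t, of "p' j" "p i"] by fastforce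
    qed
    have "(\<Sum>i<n. dist (u t (p i)) (u t (p' i))) \<le> (\<Sum>i<n. c / 2 * (LBINT y:?A i. (a y)\<^sup>2) +
      (p' i - p i) / (2 * c))"
    proof (rule sum_mono)
      fix i assume "i \<in> {..<n}"
      then have "label t (p i) \<le> label t (p' i)" using pq by (intro label_mono[OF t]) auto
      from V_diff_le[OF t this c(1)]
      show "dist (u t (p i)) (u t (p' i)) \<le> c / 2 * (LBINT y:?A i. (a y)\<^sup>2) + (p' i - p i) / (2 * c)"
        by (simp add: u_def dist_real_def X_label[OF t] abs_minus_commute)
    qed
    also have "\<dots> = c / 2 * (\<Sum>i<n. LBINT y:?A i. (a y)\<^sup>2) + (\<Sum>i<n. p' i - p i) / (2 * c)"
      by (simp add: sum.distrib sum_distrib_left sum_divide_distrib)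
    also have "\<dots> \<le> c / 2 * energy + (\<Sum>i<n. p' i - p i) / (2 * c)"
      unfolding energy_def using c(1) disj
      by (intro add_right_mono mult_left_mono sum_set_integral_le_integral a_sq) auto
    also have "\<dots> < \<epsilon> / 2 + c * \<epsilon> / (2 * c)"
      using c small by (intro add_le_less_mono divide_strict_right_mono) auto
    also have "\<dots> = \<epsilon>" using c(1) by simp
    finally show "(\<Sum>i<n. dist (u t (p i)) (u t (p' i))) < \<epsilon>" .
  qed
  then show "\<exists>\<delta>>0. abs_cont_modulus dist {l..r} (u t) \<epsilon> \<delta>"
    using c(1) \<open>0 < \<epsilon>\<close> by (intro exI[of _ "c * \<epsilon>"]) auto
qed

definition "ux t = borel_deriv (u t)"

lemma ux_meas: "0 \<le> t \<Longrightarrow> ux t \<in> borel_measurable borel"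
  unfolding ux_def by (rule borel_measurable_borel_deriv[OF u_cont])

lemma u_has_derivative: "0 \<le> t \<Longrightarrow> AE x in lborel. (u t has_real_derivative ux t x) (at x)"
  unfolding ux_def by (rule abs_cont_FTC(1)[OF u_abs_cont])

lemma deriv_u_AE: "0 \<le> t \<Longrightarrow> AE x in lborel. deriv (u t) x = ux t x"
  using u_has_derivative[of t] by (auto elim!: eventually_mono intro: DERIV_imp_deriv)

lemma ux_set_integrable: "0 \<le> t \<Longrightarrow> set_integrable lborel {l..r} (ux t)"
  unfolding ux_def by (rule abs_cont_FTC(2)[OF u_abs_cont])

lemma u_diff: "0 \<le> t \<Longrightarrow> x \<le> z \<Longrightarrow> u t z - u t x = (LBINT w:{x..z}. ux t w)"
  unfolding ux_def by (rule abs_cont_FTC(3)[OF u_abs_cont])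

text \<open>\<open>V t\<close> is the composition of \<open>u t\<close> with \<open>X t\<close>, and
  comparing derivatives gives u_x * q^2 = a * q. \<open>AE_X\<close> carries the exceptional null
  set of \<open>u t\<close> over to the labels with q > 0.\<close>

lemma ux_X:
  assumes t: "0 \<le> t"
  shows "AE y in lborel. 0 < q t y \<longrightarrow> ux t (X t y) = a y / q t y"
proof -
  have "AE y in lborel. (X t has_real_derivative (q t y)\<^sup>2) (at y)"
    by (rule lebesgue_differentiation_locally_integrable[OF set_integrable_q_sq[OF t] X_diff[OF t]])
  moreover have "AE y in lborel. (V t has_real_derivative a y * q t y) (at y)"
    by (rule lebesgue_differentiation_locally_integrable[OF set_integrable_a_q[OF t] V_diff[OF t]])
  ultimately show ?thesis
    using AE_X[OF t u_has_derivative[OF t]]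
  proof eventually_elim
    fix y assume *: "(X t has_real_derivative (q t y)\<^sup>2) (at y)" "(V t has_real_derivative a y * q t y) (at y)"
      "0 < q t y \<longrightarrow> (u t has_real_derivative ux t (X t y)) (at (X t y))"
    show "0 < q t y \<longrightarrow> ux t (X t y) = a y / q t y"
    proof
      assume q: "0 < q t y"
      have "((\<lambda>y. u t (X t y)) has_real_derivative ux t (X t y) * (q t y)\<^sup>2) (at y)"
        using DERIV_chain2[OF _ *(1)] *(3) q by blast
      also have "(\<lambda>y. u t (X t y)) = V t" using u_X[OF t] by (simp add: fun_eq_iff)
      finally have "ux t (X t y) * (q t y)\<^sup>2 = a y * q t y"
        using *(2) by (rule DERIV_unique)
      then show "ux t (X t y) = a y / q t y"
        using q by (simp add: power2_eq_square field_simps)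
    qed
  qed
qed

text \<open>The change of variables produces q^2 * (a/q)^2 = a^2 on living labels and zero on the
  others. Each label thus carries its energy unchanged up to its collapse.\<close>

lemma integral_ux_sq:
  assumes t: "0 \<le> t" and [measurable]: "h \<in> borel_measurable borel"
  shows "integrable lborel (\<lambda>x. (ux t x)\<^sup>2 * h x) \<longleftrightarrow> integrable lborel (\<lambda>y. alive t y * (a y)\<^sup>2 * h (X t y))"
    and "(LBINT x. (ux t x)\<^sup>2 * h x) = (LBINT y. alive t y * (a y)\<^sup>2 * h (X t y))"
proof -
  have [measurable]: "X t \<in> borel_measurable borel" "ux t \<in> borel_measurable borel"
    by (rule X_meas[OF t], rule ux_meas[OF t])
  have eq: "AE y in lborel. (q t y)\<^sup>2 * ((ux t (X t y))\<^sup>2 * h (X t y)) = alive t y * (a y)\<^sup>2 * h (X t y)"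
    using ux_X[OF t]
  proof eventually_elim
    fix y assume *: "0 < q t y \<longrightarrow> ux t (X t y) = a y / q t y"
    show "(q t y)\<^sup>2 * ((ux t (X t y))\<^sup>2 * h (X t y)) = alive t y * (a y)\<^sup>2 * h (X t y)"
    proof (cases "0 < q t y")
      case True
      then have "q t y * ux t (X t y) = a y" using * by simp
      then have "(q t y)\<^sup>2 * (ux t (X t y))\<^sup>2 = (a y)\<^sup>2" by (metis power_mult_distrib)
      moreover have "alive t y = 1" using True by (simp add: q_pos_iff)
      ultimately show ?thesis by (simp add: mult.assoc[symmetric])
    next
      case False
      then have "alive t y = 0" "q t y = 0" using alive_cases[of t y] by (auto simp: q_pos_iff)
      then show ?thesis by simp
    qed
  qed
  show "integrable lborel (\<lambda>x. (ux t x)\<^sup>2 * h x) \<longleftrightarrow> integrable lborel (\<lambda>y. alive t y * (a y)\<^sup>2 * h (X t y))"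
    by (subst integral_X(1)[OF t], measurable) (rule integrable_cong_AE[OF _ _ eq]; measurable)
  show "(LBINT x. (ux t x)\<^sup>2 * h x) = (LBINT y. alive t y * (a y)\<^sup>2 * h (X t y))"
    by (subst integral_X(2)[OF t], measurable) (rule integral_cong_AE[OF _ _ eq]; measurable)
qed

lemma ux_sq_integrable: "0 \<le> t \<Longrightarrow> integrable lborel (\<lambda>x. (ux t x)\<^sup>2)"
  and ux_sq_integral: "0 \<le> t \<Longrightarrow> (LBINT x. (ux t x)\<^sup>2) = M t"
  using integral_ux_sq[of t "\<lambda>_. 1"] integrable_alive[of t] by (auto simp: M_def)

text \<open>Lying left or right of x means the same for positions as lying left or right of
  \<open>label t x\<close> does for labels, except on the level set of x; there almost all labels
  are collapsed and carry no energy. Hence the choice made in \<open>label\<close> does not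
  influence the source.\<close>

lemma rhs_eq_phi:
  assumes t: "0 \<le> t"
  shows "1/4 * ((LBINT z:{..x}. (ux t z)\<^sup>2) - (LBINT z:{x..}. (ux t z)\<^sup>2)) = \<phi> t (label t x)"
proof -
  have i: "integrable lborel (\<lambda>y. alive t y * (a y)\<^sup>2 * indicator A (X t y))" if "A \<in> sets borel" for A
  proof -
    have "integrable lborel (\<lambda>x. (ux t x)\<^sup>2 * indicator A x)"
      using integrable_mult_indicator[of A lborel "\<lambda>x. (ux t x)\<^sup>2"] ux_sq_integrable[OF t] that
      by (simp add: mult.commute)
    then show ?thesis using that by (subst (asm) integral_ux_sq(1)[OF t]) auto
  qed
  have e: "(LBINT z:A. (ux t z)\<^sup>2) = (LBINT y. alive t y * (a y)\<^sup>2 * indicator A (X t y))"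
    if "A \<in> sets borel" for A
    using integral_ux_sq(2)[OF t, of "indicator A"] that by (simp add: set_lebesgue_integral_def mult.commute)
  have [measurable]: "X t \<in> borel_measurable borel" by (rule X_meas[OF t])
  have "(LBINT z:{..x}. (ux t z)\<^sup>2) - (LBINT z:{x..}. (ux t z)\<^sup>2)
      = (LBINT y. alive t y * (a y)\<^sup>2 * indicator {..x} (X t y) - alive t y * (a y)\<^sup>2 * indicator {x..}
        (X t y))"
    using i by (simp add: e)
  also have "\<dots> = (LBINT y. alive t y * (sgn (label t x - y) * (a y)\<^sup>2))"
  proof (rule integral_cong_AE)
    show "AE y in lborel. alive t y * (a y)\<^sup>2 * indicator {..x} (X t y) - alive t y * (a y)\<^sup>2 *
      indicator {x..} (X t y)
        = alive t y * (sgn (label t x - y) * (a y)\<^sup>2)"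
      using AE_level_set[OF t, of x]
    proof eventually_elim
      fix y assume *: "X t y = x \<longrightarrow> q t y = 0"
      show "alive t y * (a y)\<^sup>2 * indicator {..x} (X t y) - alive t y * (a y)\<^sup>2 * indicator {x..} (X t y)
        = alive t y * (sgn (label t x - y) * (a y)\<^sup>2)"
      proof (cases "X t y = x")
        case True
        then have "alive t y = 0" using * alive_cases[of t y] q_pos_iff[of t y] by auto
        then show ?thesis by simp
      next
        case False
        have "X t y < x \<longleftrightarrow> y < label t x" "x < X t y \<longleftrightarrow> label t x < y"
          using X_mono[OF t, of y "label t x"] X_mono[OF t, of "label t x" y] False X_label[OF t, of x]
          by (cases y "label t x" rule: linorder_cases; force)+
        then show ?thesis using False by (auto simp: indicator_def sgn_if)
      qed
    qed
  qed measurable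
  finally show ?thesis by (simp add: \<phi>_def)
qed

end

section \<open>Passage from Lebesgue versions to Borel versions\<close>

lemma lebesgue_measurable_cong_AE:
  fixes f g :: "real \<Rightarrow> real"
  assumes [measurable]: "g \<in> borel_measurable borel" and ae: "AE x in lborel. f x = g x"
  shows "f \<in> borel_measurable lebesgue"
proof (rule measurableI)
  fix A :: "real set" assume A: "A \<in> sets borel"
  obtain N where N: "{x \<in> space lborel. f x \<noteq> g x} \<subseteq> N" "N \<in> null_sets lborel"
    using ae unfolding eventually_ae_filter by blast
  then have N': "N \<in> null_sets lebesgue" by (auto intro: null_sets_completionI)
  have "g -` A \<in> sets borel" using measurable_sets[OF assms(1) A] by simp
  then have "g -` A \<in> sets lebesgue" by (auto intro: sets_completionI_sets)
  moreover have "f -` A \<inter> N \<in> sets lebesgue"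
    using null_sets_completion_subset[OF _ N', of "f -` A \<inter> N"] by auto
  ultimately have "(g -` A - N) \<union> (f -` A \<inter> N) \<in> sets lebesgue" using N' by auto
  also have "(g -` A - N) \<union> (f -` A \<inter> N) = f -` A \<inter> space lebesgue"
    using N(1) by auto
  finally show "f -` A \<inter> space lebesgue \<in> sets lebesgue" .
qed simp

text \<open>The notions of the problem integrate \<open>deriv\<close> over \<open>lebesgue\<close>.
  Here it is exchanged for a Borel version over \<open>lborel\<close>, where Fubini and the change
  of variables apply.\<close>

lemma
  fixes f g :: "real \<Rightarrow> real"
  assumes [measurable]: "g \<in> borel_measurable borel" and ae: "AE x in lborel. f x = g x"
  shows integrable_lebesgue_cong_AE: "integrable lebesgue f \<longleftrightarrow> integrable lborel g"
    and integral_lebesgue_cong_AE: "integral\<^sup>L lebesgue f = integral\<^sup>L lborel g"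
proof -
  have f: "f \<in> borel_measurable lebesgue" by (rule lebesgue_measurable_cong_AE[OF assms])
  have g: "g \<in> borel_measurable lebesgue" by (rule lebesgue_measurable_cong_AE[OF assms(1)]) simp
  have ae': "AE x in lebesgue. f x = g x" using ae by (rule AE_completion)
  show "integrable lebesgue f \<longleftrightarrow> integrable lborel g"
    using integrable_cong_AE[OF f g ae'] by (simp add: integrable_completion)
  show "integral\<^sup>L lebesgue f = integral\<^sup>L lborel g"
    using integral_cong_AE[OF f g ae'] by (simp add: integral_completion)
qed

lemma L2I_AE:
  assumes [measurable]: "g \<in> borel_measurable borel" and ae: "AE x in lborel. f x = g x"
    and [measurable]: "S \<in> sets borel" and int: "set_integrable lborel S (\<lambda>x. (g x)\<^sup>2)"
  shows "f \<in> L2 S"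
  unfolding L2_def set_borel_measurable_def set_integrable_def
proof safe
  show "(\<lambda>x. indicator S x *\<^sub>R f x) \<in> borel_measurable lebesgue"
    by (rule lebesgue_measurable_cong_AE[of "\<lambda>x. indicator S x *\<^sub>R g x"]) (use ae in \<open>auto elim!:
      eventually_mono\<close>)
  show "integrable lebesgue (\<lambda>x. indicator S x *\<^sub>R (f x)\<^sup>2)"
    using int unfolding set_integrable_def
    by (subst integrable_lebesgue_cong_AE[of "\<lambda>x. indicator S x *\<^sub>R (g x)\<^sup>2"]) (use ae in \<open>auto elim!:
      eventually_mono\<close>)
qed

lemma L2norm_AE:
  assumes [measurable]: "g \<in> borel_measurable borel" and ae: "AE x in lborel. f x = g x"
    and [measurable]: "S \<in> sets borel"
  shows "L2norm S f = sqrt (LINT x:S|lborel. (g x)\<^sup>2)"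
  unfolding L2norm_def set_lebesgue_integral_def
  by (subst integral_lebesgue_cong_AE[of "\<lambda>x. indicator S x *\<^sub>R (g x)\<^sup>2"]) (use ae in \<open>auto elim!:
    eventually_mono\<close>)

lemma power2_add_le: "((x::real) + y)\<^sup>2 \<le> 2 * x\<^sup>2 + 2 * y\<^sup>2"
  using sum_squares_bound[of x y] by (simp add: power2_sum)

section \<open>Continuity of the spatial derivative in time, as a map into L^2\<close>

context hunter_saxton_data
begin

lemma set_integral_UNIV: "(LINT x:UNIV|N. f x) = integral\<^sup>L N (f :: real \<Rightarrow> real)"
  by (simp add: set_lebesgue_integral_def)

lemma deriv_u_L2:
  assumes "0 \<le> t" shows "deriv (u t) \<in> L2 UNIV"
  using ux_sq_integrable[OF assms]
  by (intro L2I_AE[OF ux_meas deriv_u_AE] assms) (auto simp: set_integrable_def)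

lemma deriv_u_L2norm:
  assumes "0 \<le> t" shows "L2norm UNIV (deriv (u t)) = sqrt (M t)"
  using assms by (subst L2norm_AE[OF ux_meas deriv_u_AE]) (auto simp: set_integral_UNIV ux_sq_integral)

lemma deriv_u_L2dist:
  assumes "0 \<le> s" "0 \<le> t"
  shows "L2dist UNIV (deriv (u s)) (deriv (u t)) = sqrt (LBINT x. (ux s x - ux t x)\<^sup>2)"
proof -
  have [measurable]: "ux s \<in> borel_measurable borel" "ux t \<in> borel_measurable borel"
    using assms by (auto intro: ux_meas)
  have "AE x in lborel. deriv (u s) x - deriv (u t) x = ux s x - ux t x"
    using deriv_u_AE[OF assms(1)] deriv_u_AE[OF assms(2)] by eventually_elim simp
  from L2norm_AE[OF _ this, of UNIV] show ?thesis
    by (simp add: L2dist_def set_integral_UNIV)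
qed

lemma X_time_tendsto:
  assumes "\<And>k. 0 \<le> T k" "0 \<le> t" "T \<longlonglongrightarrow> t"
  shows "(\<lambda>k. X (T k) y) \<longlonglongrightarrow> X t y"
proof -
  have *: "\<bar>X (T k) y - X t y\<bar> \<le> \<bar>T k - t\<bar> * \<bar>V t y\<bar> + energy / 4 * \<bar>T k - t\<bar> * \<bar>T k - t\<bar>" for k
  proof -
    have "\<bar>X (T k) y - X t y\<bar> \<le> \<bar>X (T k) y - X t y - (T k - t) * V t y\<bar> + \<bar>(T k - t) * V t y\<bar>" by arith
    then show ?thesis using X_time_dist[OF assms(1,2), of k y] unfolding abs_mult[of _ "V t y"] by linarith
  qed
  have "(\<lambda>k. \<bar>T k - t\<bar> * \<bar>V t y\<bar> + energy / 4 * \<bar>T k - t\<bar> * \<bar>T k - t\<bar>) \<longlonglongrightarrow> \<bar>t - t\<bar> * \<bar>V t y\<bar> +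
    energy / 4 * \<bar>t - t\<bar> * \<bar>t - t\<bar>"
    by (intro tendsto_intros assms)
  then have lim: "(\<lambda>k. \<bar>T k - t\<bar> * \<bar>V t y\<bar> + energy / 4 * \<bar>T k - t\<bar> * \<bar>T k - t\<bar>) \<longlonglongrightarrow> 0"
    by simp
  have "(\<lambda>k. X (T k) y - X t y) \<longlonglongrightarrow> 0"
    by (rule Lim_null_comparison[OF _ lim]) (simp only: real_norm_def * eventually_True)
  then show ?thesis by (rule LIM_zero_cancel)
qed

lemma compact_support_bounded:
  fixes g :: "real \<Rightarrow> real"
  assumes "continuous_on UNIV g" "\<And>x. R < \<bar>x\<bar> \<Longrightarrow> g x = 0"
  obtains B where "0 \<le> B" "\<And>x. \<bar>g x\<bar> \<le> B"
proof -
  have "compact (g ` {-R..R})"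
    using assms(1) by (intro compact_continuous_image) (auto intro: continuous_on_subset)
  then obtain B where B: "\<forall>x\<in>{-R..R}. \<bar>g x\<bar> \<le> B"
    using compact_imp_bounded[of "g ` {-R..R}"] unfolding bounded_iff by auto
  have "\<bar>g x\<bar> \<le> max 0 B" for x
    using bspec[OF B, of x] assms(2)[of x] by (cases "\<bar>x\<bar> \<le> R") (auto simp: abs_le_iff)
  then show ?thesis using that[of "max 0 B"] by auto
qed

lemma compact_support_integrable:
  fixes g :: "real \<Rightarrow> real"
  assumes "continuous_on UNIV g" "\<And>x. R < \<bar>x\<bar> \<Longrightarrow> g x = 0"
  shows "integrable lborel g"
proof -
  obtain B where B: "0 \<le> B" "\<And>x. \<bar>g x\<bar> \<le> B"
    by (rule compact_support_bounded[of g R]) (use assms in auto)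
  have i: "integrable lborel (\<lambda>x. B * indicator {-R..R} x)"
    by (intro integrable_mult_right integrable_indicator_Icc)
  show ?thesis
  proof (rule Bochner_Integration.integrable_bound[OF i])
    show "g \<in> borel_measurable lborel" using borel_measurable_continuous_onI[OF assms(1)] by simp
    have "\<bar>g x\<bar> \<le> B * indicator {-R..R} x" for x
      using B(2)[of x] assms(2)[of x] by (cases "x \<in> {-R..R}") auto
    then show "AE x in lborel. norm (g x) \<le> norm (B * indicator {-R..R} x)"
      using B(1) by auto
  qed
qed

abbreviation "lagrangian_error g t y \<equiv> (g (X t y))\<^sup>2 * (q t y)\<^sup>2 - 2 * (a y * q t y) * g (X t y)"

text \<open>In Lagrangian variables all but the first summand of the distance is continuous in time.\<close>

lemma L2_dist_test:
  fixes g :: "real \<Rightarrow> real"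
  assumes t: "0 \<le> t" and g: "continuous_on UNIV g" "\<And>x. R < \<bar>x\<bar> \<Longrightarrow> g x = 0"
  shows "integrable lborel (\<lambda>x. (ux t x - g x)\<^sup>2)"
    and "(LBINT x. (ux t x - g x)\<^sup>2)
      = M t + (LBINT y. lagrangian_error g t y)"
proof -
  have [measurable]: "X t \<in> borel_measurable borel" "ux t \<in> borel_measurable borel" "g \<in> borel_measurable borel"
    by (rule X_meas[OF t], rule ux_meas[OF t], rule borel_measurable_continuous_onI[OF g(1)])
  have g2: "integrable lborel (\<lambda>x. (g x)\<^sup>2)"
    by (rule compact_support_integrable[of _ R]) (use g in \<open>auto intro!: continuous_intros\<close>)
  have d: "integrable lborel (\<lambda>x. 2 * (ux t x)\<^sup>2 + 2 * (g x)\<^sup>2)"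
    using ux_sq_integrable[OF t] g2 by auto
  show i: "integrable lborel (\<lambda>x. (ux t x - g x)\<^sup>2)"
    by (rule Bochner_Integration.integrable_bound[OF d])
      (use power2_add_le[of "ux t _" "- g _"] in \<open>auto simp: intro!: AE_I2\<close>)
  have "integrable lborel (\<lambda>x. (ux t x - g x)\<^sup>2 - (ux t x)\<^sup>2)"
    using i ux_sq_integrable[OF t] by (rule Bochner_Integration.integrable_diff)
  also have "(\<lambda>x. (ux t x - g x)\<^sup>2 - (ux t x)\<^sup>2) = (\<lambda>x. (g x)\<^sup>2 - 2 * ux t x * g x)"
    by (auto simp: fun_eq_iff power2_diff)
  finally have j: "integrable lborel (\<lambda>x. (g x)\<^sup>2 - 2 * ux t x * g x)" .
  have "(LBINT x. (ux t x - g x)\<^sup>2) = (LBINT x. (ux t x)\<^sup>2 + ((g x)\<^sup>2 - 2 * ux t x * g x))"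
    by (intro Bochner_Integration.integral_cong) (auto simp: power2_diff)
  also have "\<dots> = M t + (LBINT x. (g x)\<^sup>2 - 2 * ux t x * g x)"
    using ux_sq_integrable[OF t] j by (simp add: ux_sq_integral[OF t])
  also have "(LBINT x. (g x)\<^sup>2 - 2 * ux t x * g x)
      = (LBINT y. (q t y)\<^sup>2 * ((g (X t y))\<^sup>2 - 2 * ux t (X t y) * g (X t y)))"
    by (rule integral_X(2)[OF t]) measurable
  also have "\<dots> = (LBINT y. lagrangian_error g t y)"
  proof (rule integral_cong_AE)
    show "AE y in lborel. (q t y)\<^sup>2 * ((g (X t y))\<^sup>2 - 2 * ux t (X t y) * g (X t y))
        = lagrangian_error g t y"
      using ux_X[OF t]
    proof eventually_elim
      fix y assume *: "0 < q t y \<longrightarrow> ux t (X t y) = a y / q t y"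
      \<comment> \<open>Also true where q = 0, whatever value \<open>ux t\<close> takes there, since
        both sides vanish.\<close>
      have "(q t y)\<^sup>2 * ux t (X t y) = a y * q t y"
      proof (cases "0 < q t y")
        case True then show ?thesis using * by (simp add: power2_eq_square)
      next
        case False then show ?thesis using q_nonneg[of t y] by (simp add: less_le)
      qed
      then show "(q t y)\<^sup>2 * ((g (X t y))\<^sup>2 - 2 * ux t (X t y) * g (X t y))
        = lagrangian_error g t y"
        by (simp add: right_diff_distrib mult.assoc[symmetric] mult.commute[of _ 2])
    qed
  qed measurable
  finally show "(LBINT x. (ux t x - g x)\<^sup>2)
      = M t + (LBINT y. lagrangian_error g t y)" .
qed

text \<open>Dominated convergence in the label variable. By \<open>X_growth\<close> the labels whose
  positions meet the support of \<open>g\<close> stay in one bounded interval for all times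
  considered, and q^2 and a*q have majorants of the form constant plus multiple of a^2. Only
  \<open>M\<close> can jump, and its convergence is assumed.\<close>

lemma L2_dist_test_tendsto:
  fixes g :: "real \<Rightarrow> real"
  assumes T: "\<And>k. 0 \<le> T k" "T \<longlonglongrightarrow> t" "(\<lambda>k. M (T k)) \<longlonglongrightarrow> M t"
    and g: "continuous_on UNIV g" "\<And>x. R < \<bar>x\<bar> \<Longrightarrow> g x = 0"
  shows "(\<lambda>k. LBINT x. (ux (T k) x - g x)\<^sup>2) \<longlonglongrightarrow> (LBINT x. (ux t x - g x)\<^sup>2)"
proof -
  have t: "0 \<le> t" using T(1,2) by (intro LIMSEQ_le_const) auto
  obtain S where S: "\<And>k. T k \<le> S" "0 \<le> S"
  proof -
    obtain S where "\<And>k. \<bar>T k\<bar> \<le> S"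
      using convergent_imp_Bseq[of T] T(2) unfolding Bseq_def convergent_def by auto
    then show ?thesis using that[of S] T(1) abs_le_D1 by (metis abs_ge_zero order_trans)
  qed
  obtain B where B: "0 \<le> B" "\<And>x. \<bar>g x\<bar> \<le> B"
    by (rule compact_support_bounded[of g R]) (use g in auto)
  obtain C where C: "\<And>s y. 0 \<le> s \<Longrightarrow> s \<le> S \<Longrightarrow> \<bar>y\<bar> \<le> 2 * (C + \<bar>X s y\<bar>)"
    using X_growth[OF S(2)] by metis
  \<comment> \<open>A label outside [-Y, Y] is beyond the support of \<open>g\<close> at every time
    s <= S.\<close>
  define Y where "Y = 2 * (C + \<bar>R\<bar>)"
  have supp: "g (X s y) = 0" if "0 \<le> s" "s \<le> S" "y \<notin> {-Y..Y}" for s y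
  proof (rule g(2))
    have "Y < \<bar>y\<bar>" using that(3) by auto
    then show "R < \<bar>X s y\<bar>" using C[OF that(1,2), of y] by (simp add: Y_def)
  qed
  define w where "w y = indicator {-Y..Y} y *\<^sub>R (B\<^sup>2 * (2 + S\<^sup>2 / 2 * (a y)\<^sup>2) + 2 * (1 + (1 +
    S / 2) * (a y)\<^sup>2) * B)" for y
  have wi: "integrable lborel w"
    using set_integrable_dom[of "\<lambda>y. B\<^sup>2 * (2 + S\<^sup>2 / 2 * (a y)\<^sup>2) + 2 * (1 + (1 + S / 2) * (a y)\<^sup>2) * B"
        "2 * B\<^sup>2 + 2 * B" "B\<^sup>2 * (S\<^sup>2 / 2) + 2 * (1 + S / 2) * B" "-Y" Y] B(1) S(2)
    unfolding w_def set_integrable_def by (simp add: algebra_simps)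
  have [measurable]: "g \<in> borel_measurable borel" by (rule borel_measurable_continuous_onI[OF g(1)])
  have Xm: "X s \<in> borel_measurable borel" if "0 \<le> s" for s by (rule X_meas[OF that])
  let ?f = "lagrangian_error g"
  have fm: "?f s \<in> borel_measurable lborel" if "0 \<le> s" for s
  proof -
    have [measurable]: "X s \<in> borel_measurable borel" by (rule Xm[OF that])
    show ?thesis by measurable
  qed
  have bound: "\<bar>?f s y\<bar> \<le> w y" if s: "0 \<le> s" "s \<le> S" for s y
  proof (cases "y \<in> {-Y..Y}")
    case True
    have "s\<^sup>2 / 2 * (a y)\<^sup>2 \<le> S\<^sup>2 / 2 * (a y)\<^sup>2"
      using s by (intro mult_right_mono divide_right_mono power_mono) auto
    then have q2: "(q s y)\<^sup>2 \<le> 2 + S\<^sup>2 / 2 * (a y)\<^sup>2" using q_sq_bound[OF s(1), of y] by linarith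
    have "(1 + s / 2) * (a y)\<^sup>2 \<le> (1 + S / 2) * (a y)\<^sup>2"
      using s by (intro mult_right_mono) auto
    then have aq: "\<bar>a y * q s y\<bar> \<le> 1 + (1 + S / 2) * (a y)\<^sup>2"
      by (intro order_trans[OF a_q_bound[OF s(1)]] add_left_mono)
    have g2: "(g (X s y))\<^sup>2 \<le> B\<^sup>2" using power_mono[OF B(2) abs_ge_zero, of "X s y"
      2] by (simp only: power2_abs)
    have "\<bar>?f s y\<bar> \<le> \<bar>(g (X s y))\<^sup>2 * (q s y)\<^sup>2\<bar> + \<bar>2 * (a y * q s y) * g (X s y)\<bar>" by (rule abs_triangle_ineq4)
    also have "\<dots> = (g (X s y))\<^sup>2 * (q s y)\<^sup>2 + 2 * \<bar>a y * q s y\<bar> * \<bar>g (X s y)\<bar>" by (simp add: abs_mult)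
    also have "\<dots> \<le> B\<^sup>2 * (2 + S\<^sup>2 / 2 * (a y)\<^sup>2) + 2 * (1 + (1 + S / 2) * (a y)\<^sup>2) * B"
    proof (rule add_mono)
      show "(g (X s y))\<^sup>2 * (q s y)\<^sup>2 \<le> B\<^sup>2 * (2 + S\<^sup>2 / 2 * (a y)\<^sup>2)"
        by (rule mult_mono[OF g2 q2 zero_le_power2 zero_le_power2])
      have "0 \<le> 1 + (1 + S / 2) * (a y)\<^sup>2" using aq abs_ge_zero order_trans by blast
      from mult_nonneg_nonneg[OF zero_le_numeral this]
      show "2 * \<bar>a y * q s y\<bar> * \<bar>g (X s y)\<bar> \<le> 2 * (1 + (1 + S / 2) * (a y)\<^sup>2) * B"
        by (rule mult_mono[OF mult_left_mono[OF aq zero_le_numeral] B(2) _ abs_ge_zero])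
    qed
    finally show ?thesis unfolding w_def indicator_simps(1)[OF True] scaleR_one .
  qed (use supp[OF s] in \<open>auto simp: w_def\<close>)
  have "(\<lambda>k. LBINT y. ?f (T k) y) \<longlonglongrightarrow> (LBINT y. ?f t y)"
  proof (rule integral_dominated_convergence[where w = w])
    show "AE y in lborel. (\<lambda>k. ?f (T k) y) \<longlonglongrightarrow> ?f t y"
    proof (rule AE_I2)
      fix y
      have "isCont g (X t y)" using g(1) by (simp add: continuous_on_eq_continuous_at)
      then have "(\<lambda>k. g (X (T k) y)) \<longlonglongrightarrow> g (X t y)"
        using X_time_tendsto[OF T(1) t T(2)] by (rule isCont_tendsto_compose)
      moreover have "(\<lambda>k. q (T k) y) \<longlonglongrightarrow> q t y"
        unfolding q_def by (intro tendsto_intros T; simp)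
      ultimately show "(\<lambda>k. ?f (T k) y) \<longlonglongrightarrow> ?f t y" by (intro tendsto_intros)
    qed
    show "AE y in lborel. norm (?f (T k) y) \<le> w y" for k
      using bound[OF T(1) S(1)] by simp
  qed (use wi fm t T(1) in auto)
  moreover have "(LBINT x. (ux s x - g x)\<^sup>2) = M s + (LBINT y. ?f s y)" if "0 \<le> s" for s
    by (rule L2_dist_test(2)[where R = R]) (use that g in auto)
  ultimately show ?thesis
    using tendsto_add[OF T(3)] T(1) t by simp
qed

lemma ux_approx:
  assumes t: "0 \<le> t" and "0 < \<epsilon>"
  obtains g R where "continuous_on UNIV g" "\<And>x. R < \<bar>x\<bar> \<Longrightarrow> g x = 0" "(LBINT x. (ux t x - g x)\<^sup>2) < \<epsilon>"
proof -
  show ?thesis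
  proof (rule continuous_compact_support_dense[OF ux_meas[OF t], of 2 \<epsilon>])
    fix g R assume "continuous_on UNIV g" "\<And>x. R < \<bar>x\<bar> \<Longrightarrow> g x = (0::real)" "(LBINT x. \<bar>ux t x - g x\<bar> ^ 2) < \<epsilon>"
    then show thesis by (intro that[of g R]) auto
  qed (use ux_sq_integrable[OF t] \<open>0 < \<epsilon>\<close> in auto)
qed

text \<open>If the distance of \<open>ux t\<close> to a test function is small, the distances of
  \<open>ux (T k)\<close> to the same function become small too, since they converge to it. The
  triangle inequality finishes.\<close>

lemma ux_L2_tendsto:
  assumes T: "\<And>k. 0 \<le> T k" "T \<longlonglongrightarrow> t" "(\<lambda>k. M (T k)) \<longlonglongrightarrow> M t"
  shows "(\<lambda>k. LBINT x. (ux (T k) x - ux t x)\<^sup>2) \<longlonglongrightarrow> 0"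
proof (rule LIMSEQ_I)
  fix \<epsilon> :: real assume "0 < \<epsilon>"
  have t: "0 \<le> t" using T(1,2) by (intro LIMSEQ_le_const) auto
  \<comment> \<open>A quarter of \<epsilon>, because each of the two squared distances enters
    doubled.\<close>
  obtain g R where g: "continuous_on UNIV g" "\<And>x. R < \<bar>x\<bar> \<Longrightarrow> g x = (0::real)"
    and small: "(LBINT x. (ux t x - g x)\<^sup>2) < \<epsilon> / 4"
    by (rule ux_approx[OF t, of "\<epsilon> / 4"]) (use \<open>0 < \<epsilon>\<close> in auto)
  have "eventually (\<lambda>k. (LBINT x. (ux (T k) x - g x)\<^sup>2) < \<epsilon> / 4) sequentially"
    by (rule order_tendstoD(2)[OF L2_dist_test_tendsto[where R = R] small]) (use T g in auto)
  then obtain K where K: "\<And>k. K \<le> k \<Longrightarrow> (LBINT x. (ux (T k) x - g x)\<^sup>2) < \<epsilon> / 4"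
    by (auto simp: eventually_sequentially)
  have "norm ((LBINT x. (ux (T k) x - ux t x)\<^sup>2) - 0) < \<epsilon>" if "K \<le> k" for k
  proof -
    have [measurable]: "ux (T k) \<in> borel_measurable borel" "ux t \<in> borel_measurable borel"
      using T(1) t by (auto intro: ux_meas)
    have i: "integrable lborel (\<lambda>x. (ux (T k) x - g x)\<^sup>2)" "integrable lborel (\<lambda>x. (ux t x - g x)\<^sup>2)"
      by (rule L2_dist_test(1)[where R = R], use T(1) t g in auto)+
    have le: "(ux (T k) x - ux t x)\<^sup>2 \<le> 2 * (ux (T k) x - g x)\<^sup>2 + 2 * (ux t x - g x)\<^sup>2" for x
      using power2_add_le[of "ux (T k) x - g x" "g x - ux t x"] by (simp add: power2_commute)
    have ir: "integrable lborel (\<lambda>x. 2 * (ux (T k) x - g x)\<^sup>2 + 2 * (ux t x - g x)\<^sup>2)"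
      using i by auto
    have il: "integrable lborel (\<lambda>x. (ux (T k) x - ux t x)\<^sup>2)"
      by (rule Bochner_Integration.integrable_bound[OF ir]) (use le in auto)
    have "(LBINT x. (ux (T k) x - ux t x)\<^sup>2) \<le> (LBINT x. 2 * (ux (T k) x - g x)\<^sup>2 + 2 * (ux t x - g x)\<^sup>2)"
      by (intro integral_mono il ir le)
    also have "\<dots> = 2 * (LBINT x. (ux (T k) x - g x)\<^sup>2) + 2 * (LBINT x. (ux t x - g x)\<^sup>2)"
      using i by simp
    also have "\<dots> < \<epsilon>" using K[OF that] small by simp
    finally show ?thesis by (simp add: integral_nonneg_AE)
  qed
  then show "\<exists>K. \<forall>k\<ge>K. norm ((LBINT x. (ux (T k) x - ux t x)\<^sup>2) - 0) < \<epsilon>" by blast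
qed

lemma AE_isCont_M: "AE t in lborel. 0 < t \<longrightarrow> isCont M t"
proof -
  \<comment> \<open>\<open>M\<close> decreases on nonnegative times, so it is frozen before 0 and
    negated to become a monotone function on the line; such a function has only countably many
    discontinuities.\<close>
  define f where "f t = - M (max 0 t)" for t
  have "mono f" by (auto simp: mono_def f_def intro!: M_antimono)
  then have "countable {t. \<not> isCont f t}" by (rule mono_ctble_discont)
  then have "AE t in lborel. t \<notin> {t. \<not> isCont f t}"
    by (intro AE_not_in countable_imp_null_set_lborel)
  then show ?thesis
  proof eventually_elim
    fix t assume t: "t \<notin> {t. \<not> isCont f t}"
    show "0 < t \<longrightarrow> isCont M t"
    proof
      assume "0 < t"
      have "isCont (\<lambda>t. - f t) t" using t by (intro continuous_intros) auto
      moreover have "eventually (\<lambda>s. - f s = M s) (nhds t)"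
        using eventually_nhds_in_open[of "{0<..}" t] \<open>0 < t\<close>
        by (auto simp: f_def elim!: eventually_mono)
      ultimately show "isCont M t" using isCont_cong by fast
    qed
  qed
qed

text \<open>Freezing the time at the left grid point gives simple functions, which converge at every
  t > 0 where \<open>M\<close> is continuous.\<close>

lemma Linf_L2_ux: "Linf_L2 {0..T} (\<lambda>t. deriv (u t))"
  unfolding Linf_L2_def
proof (intro conjI exI[of _ "sqrt energy"])
  show "AE t in lebesgue. t \<in> {0..T} \<longrightarrow> deriv (u t) \<in> L2 UNIV"
    by (auto intro: deriv_u_L2)
  show "AE t in lebesgue. t \<in> {0..T} \<longrightarrow> L2norm UNIV (deriv (u t)) \<le> sqrt energy"
    using M_bounds by (auto simp: deriv_u_L2norm)
  show "L2_strongly_measurable_on {0..T} (\<lambda>t. deriv (u t))"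
    unfolding L2_strongly_measurable_on_def
  proof (intro exI conjI allI)
    define d where "d k i = real i / real (Suc k)" for k i :: nat
    \<comment> \<open>Cells of length 1/(k + 1) up to an end beyond T, so that t = T also lies in a
      half-open cell.\<close>
    define n where "n k = Suc k * Suc (nat \<lceil>T\<rceil>)" for k :: nat
    define s where "s k t x = (\<Sum>i<n k. indicator {d k i..<d k (Suc i)} t * deriv (u (d k i)) x)" for k t x
    have d0: "0 \<le> d k i" for k i by (simp add: d_def)
    show "L2_simple (s k)" for k
      unfolding L2_simple_def
      by (rule exI[of _ "n k"], rule exI[of _ "\<lambda>i. {d k i..<d k (Suc i)}"], rule exI[of _ "\<lambda>i. deriv (u
        (d k i))"])
        (auto simp: s_def fun_eq_iff intro!: deriv_u_L2 d0)
    define j where "j k t = nat \<lfloor>t * real (Suc k)\<rfloor>" for k t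
    have j: "s k t = deriv (u (d k (j k t)))" "\<bar>d k (j k t) - t\<bar> \<le> 1 / real (Suc k)" if t: "0 \<le> t" "t \<le>
      T" for k t
    proof -
      have j1: "real (j k t) \<le> t * real (Suc k)" "t * real (Suc k) < real (j k t) + 1"
        using t by (auto simp: j_def)
      then have in_iff: "t \<in> {d k i..<d k (Suc i)} \<longleftrightarrow> i = j k t" for i
      proof -
        have "t \<in> {d k i..<d k (Suc i)} \<longleftrightarrow> real i \<le> t * real (Suc k) \<and> t * real (Suc k) < real (Suc i)"
          by (simp add: d_def field_simps)
        also have "\<dots> \<longleftrightarrow> i = j k t" using j1 by (auto simp: of_nat_Suc)
        finally show ?thesis .
      qed
      have "t < real (Suc (nat \<lceil>T\<rceil>))" using t by (simp add: less_eq_real_def) linarith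
      then have "t * real (Suc k) < real (n k)"
        unfolding n_def of_nat_mult mult.commute[of t] by (intro mult_strict_left_mono) auto
      then have "real (j k t) < real (n k)" using j1(1) by linarith
      then have jn: "j k t < n k" by simp
      have ind: "indicator {d k i..<d k (Suc i)} t = (if i = j k t then 1 else 0 :: real)" for i
        using in_iff by (simp add: indicator_def)
      have "s k t x = (\<Sum>i<n k. if i = j k t then deriv (u (d k i)) x else 0)" for x
        unfolding s_def by (intro sum.cong refl) (simp add: ind)
      then show "s k t = deriv (u (d k (j k t)))" using jn by (simp add: fun_eq_iff)
      have "t \<in> {d k (j k t)..<d k (Suc (j k t))}" using in_iff by blast
      moreover have "d k (Suc i) = d k i + 1 / real (Suc k)" for i by (simp add: d_def add_divide_distrib)
      ultimately show "\<bar>d k (j k t) - t\<bar> \<le> 1 / real (Suc k)" by auto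
    qed
    have "AE t in lborel. t \<noteq> 0" by (rule AE_lborel_singleton)
    then have "AE t in lborel. t \<in> {0..T} \<longrightarrow> (\<lambda>k. L2dist UNIV (s k t) (deriv (u t))) \<longlonglongrightarrow> 0"
      using AE_isCont_M
    proof eventually_elim
      fix t :: real assume t0: "t \<noteq> 0" "0 < t \<longrightarrow> isCont M t"
      show "t \<in> {0..T} \<longrightarrow> (\<lambda>k. L2dist UNIV (s k t) (deriv (u t))) \<longlonglongrightarrow> 0"
      proof
        assume "t \<in> {0..T}"
        then have t: "0 \<le> t" "t \<le> T" "isCont M t" using t0 by auto
        let ?T = "\<lambda>k. d k (j k t)"
        have lim: "?T \<longlonglongrightarrow> t"
        proof (rule LIM_zero_cancel, rule Lim_null_comparison)
          show "\<forall>\<^sub>F k in sequentially. norm (?T k - t) \<le> 1 / real (Suc k)" using j(2)[OF t(1,2)] by simp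
          show "(\<lambda>k. 1 / real (Suc k)) \<longlonglongrightarrow> 0" using LIMSEQ_inverse_real_of_nat by (simp add: inverse_eq_divide)
        qed
        then have "(\<lambda>k. M (?T k)) \<longlonglongrightarrow> M t" by (rule isCont_tendsto_compose[OF t(3)])
        from tendsto_real_sqrt[OF ux_L2_tendsto[OF d0 lim this]]
        show "(\<lambda>k. L2dist UNIV (s k t) (deriv (u t))) \<longlonglongrightarrow> 0"
          using j(1)[OF t(1,2)] by (simp add: deriv_u_L2dist d0 t(1))
      qed
    qed
    then show "AE t in lebesgue. t \<in> {0..T} \<longrightarrow> (\<lambda>k. L2dist UNIV (s k t) (deriv (u t))) \<longlonglongrightarrow> 0"
      by (rule AE_completion)
  qed
qed

end

section \<open>Regularity in time\<close>

lemma set_integral_Cauchy_Schwarz: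
  fixes h :: "real \<Rightarrow> real"
  assumes [measurable]: "h \<in> borel_measurable borel" and "l \<le> r"
    and h2: "set_integrable lborel {l..r} (\<lambda>z. (h z)\<^sup>2)"
  shows "set_integrable lborel {l..r} h"
    and "(LBINT z:{l..r}. \<bar>h z\<bar>)\<^sup>2 \<le> (r - l) * (LBINT z:{l..r}. (h z)\<^sup>2)"
proof -
  note ic = set_integrable_const_Icc[of l r] and cst = set_integral_const_Icc[OF \<open>l \<le> r\<close>]
  have b: "\<bar>b\<bar> \<le> 1 + (b::real)\<^sup>2" for b
    using sum_squares_bound[of "\<bar>b\<bar>" 1] by (auto simp: power2_eq_square)
  show i: "set_integrable lborel {l..r} h"
  proof (rule set_integrable_bound)
    show "set_integrable lborel {l..r} (\<lambda>z. 1 + (h z)\<^sup>2)" by (intro set_integral_add ic h2)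
    show "set_borel_measurable lborel {l..r} h" unfolding set_borel_measurable_def by measurable
    show "AE x in lborel. x \<in> {l..r} \<longrightarrow> norm (h x) \<le> norm (1 + (h x)\<^sup>2)" using b by simp
  qed
  define I Q where "I = (LBINT z:{l..r}. \<bar>h z\<bar>)" and "Q = (LBINT z:{l..r}. (h z)\<^sup>2)"
  have Q: "0 \<le> Q" unfolding Q_def by (rule set_integral_nonneg_real) simp
  have *: "0 \<le> Q - 2 * c * I + c\<^sup>2 * (r - l)" for c
  proof -
    have "0 \<le> (LBINT z:{l..r}. (\<bar>h z\<bar> - c)\<^sup>2)"
      by (rule set_integral_nonneg_real) simp
    also have "(LBINT z:{l..r}. (\<bar>h z\<bar> - c)\<^sup>2) = (LBINT z:{l..r}. (h z)\<^sup>2 - 2 * c * \<bar>h z\<bar> + c\<^sup>2)"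
      by (simp add: power2_diff algebra_simps)
    also have "\<dots> = Q - 2 * c * I + c\<^sup>2 * (r - l)"
      using set_integrable_abs[OF i] h2 ic
      by (simp add: set_integral_add set_integral_diff cst I_def Q_def)
    finally show ?thesis .
  qed
  have "I\<^sup>2 \<le> (r - l) * Q"
  proof (cases "l = r")
    case True
    then have "I = 0" unfolding I_def by (subst set_integral_Icc_Ioo) (simp add: set_lebesgue_integral_def)
    then show ?thesis using True by simp
  next
    case False
    then have lr: "0 < r - l" using \<open>l \<le> r\<close> by simp
    \<comment> \<open>The mean of |h| minimises the quadratic polynomial in c.\<close>
    have "Q - 2 * (I / (r - l)) * I + (I / (r - l))\<^sup>2 * (r - l) = Q - I\<^sup>2 / (r - l)"
      using lr by (simp add: power2_eq_square)
    with *[of "I / (r - l)"] have "I\<^sup>2 / (r - l) \<le> Q" by simp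
    then show ?thesis using lr by (simp add: pos_divide_le_eq mult.commute)
  qed
  then show "(LBINT z:{l..r}. \<bar>h z\<bar>)\<^sup>2 \<le> (r - l) * (LBINT z:{l..r}. (h z)\<^sup>2)"
    by (simp add: I_def Q_def)
qed

text \<open>The local energy \<open>B x = \<integral>\<^bsub>[x-K,x+K]\<^esub> h\<^sup>2\<close> controls all increments of a primitive of \<open>h\<close> from \<open>x\<close> to
  points at distance at most \<open>K\<close>, even if the end points depend on \<open>x\<close>.\<close>

lemma increment_L2_bound:
  fixes h F :: "real \<Rightarrow> real"
  assumes [measurable]: "h \<in> borel_measurable borel" and h2: "integrable lborel (\<lambda>x. (h x)\<^sup>2)" and "0 \<le> K"
    and F: "\<And>x z. x \<le> z \<Longrightarrow> F z - F x = (LBINT w:{x..z}. h w)"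
  obtains B where "integrable lborel B" "\<And>x. 0 \<le> B x"
    "integral\<^sup>L lborel B = 2 * K * (LBINT x. (h x)\<^sup>2)"
    "\<And>x z. \<bar>z - x\<bar> \<le> K \<Longrightarrow> (F z - F x)\<^sup>2 \<le> K * B x"
proof -
  \<comment> \<open>The local energy is written as an integral over shifts w, so that Fubini and
    translation invariance give its total mass.\<close>
  define f where "f w x = indicator {-K..K} w * (h (x + w))\<^sup>2" for w x
  define B where "B x = (LBINT w. f w x)" for x
  have shift: "integrable lborel (\<lambda>x. (h (x + w))\<^sup>2)" "(LBINT x. (h (x + w))\<^sup>2) = (LBINT x. (h x)\<^sup>2)" for w
    using lborel_integrable_real_affine[OF h2, of 1 w] lborel_integral_real_affine[of 1 "\<lambda>x. (h x)\<^sup>2" w]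
    by (simp_all add: add.commute)
  have pi: "integrable (lborel \<Otimes>\<^sub>M lborel) (\<lambda>(w, x). f w x)"
  proof (rule lborel_pair.Fubini_integrable)
    show "(\<lambda>(w, x). f w x) \<in> borel_measurable (lborel \<Otimes>\<^sub>M lborel)" unfolding f_def by measurable
    have "(LBINT x. norm (f w x)) = indicator {-K..K} w * (LBINT x. (h x)\<^sup>2)" for w
      using shift(2)[of w] by (simp add: f_def abs_mult)
    then show "integrable lborel (\<lambda>w. LBINT x. norm (case (w, x) of (w, x) \<Rightarrow> f w x))"
      using integrable_indicator_Icc by simp
    show "AE w in lborel. integrable lborel (\<lambda>x. case (w, x) of (w, x) \<Rightarrow> f w x)"
      using shift(1) by (simp add: f_def)
  qed
  have 1: "integrable lborel B"
    unfolding B_def using lborel_pair.integrable_snd[OF pi] by simp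
  have 2: "integral\<^sup>L lborel B = 2 * K * (LBINT x. (h x)\<^sup>2)"
  proof -
    have "integral\<^sup>L lborel B = (LBINT w. LBINT x. f w x)"
      unfolding B_def using lborel_pair.Fubini_integral[OF pi] by simp
    also have "\<dots> = (LBINT w. indicator {-K..K} w * (LBINT x. (h x)\<^sup>2))"
      by (simp add: f_def shift(2))
    also have "\<dots> = 2 * K * (LBINT x. (h x)\<^sup>2)" using \<open>0 \<le> K\<close> by simp
    finally show ?thesis .
  qed
  have Beq: "B x = (LBINT z:{x - K..x + K}. (h z)\<^sup>2)" for x
  proof -
    have "(LBINT z:{x - K..x + K}. (h z)\<^sup>2) = (LBINT w. indicator {x - K..x + K} (x + w) * (h (x + w))\<^sup>2)"
      unfolding set_lebesgue_integral_def
      using lborel_integral_real_affine[of 1 "\<lambda>z. indicator {x - K..x + K} z *\<^sub>R (h z)\<^sup>2" x] by simp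
    also have "\<dots> = B x"
      unfolding B_def f_def by (intro Bochner_Integration.integral_cong) (auto simp: indicator_def)
    finally show ?thesis ..
  qed
  note si = set_integrable_lborel[OF h2]
  have 0: "0 \<le> B x" for x
    unfolding Beq by (rule set_integral_nonneg_real) simp
  have *: "(F r - F l)\<^sup>2 \<le> K * B x" if "l \<le> r" "r - l \<le> K" "x - K \<le> l" "r \<le> x + K" for l r x
  proof -
    have "\<bar>F r - F l\<bar> \<le> (LBINT z:{l..r}. \<bar>h z\<bar>)"
      unfolding F[OF that(1)] by (rule abs_set_integral_le)
    then have "(F r - F l)\<^sup>2 \<le> (LBINT z:{l..r}. \<bar>h z\<bar>)\<^sup>2"
      using power_mono[of "\<bar>F r - F l\<bar>" _ 2] by simp
    also have "\<dots> \<le> (r - l) * (LBINT z:{l..r}. (h z)\<^sup>2)"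
      by (rule set_integral_Cauchy_Schwarz(2)[OF assms(1) that(1) si]) simp
    also have "\<dots> \<le> K * B x"
    proof (rule mult_mono[OF that(2)])
      show "(LBINT z:{l..r}. (h z)\<^sup>2) \<le> B x"
        unfolding Beq set_lebesgue_integral_def
        using si[of "{l..r}"] si[of "{x - K..x + K}"] that
        by (intro integral_mono) (auto simp: set_integrable_def indicator_def)
      show "0 \<le> (LBINT z:{l..r}. (h z)\<^sup>2)"
        by (rule set_integral_nonneg_real) simp
    qed (use \<open>0 \<le> K\<close> in auto)
    finally show ?thesis .
  qed
  have "(F z - F x)\<^sup>2 \<le> K * B x" if "\<bar>z - x\<bar> \<le> K" for x z
    using *[of x z x] *[of z x x] that \<open>0 \<le> K\<close> by (cases "x \<le> z") (auto simp: power2_commute)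
  with 1 0 2 show ?thesis by (rule that)
qed

lemma compact_support_primitive:
  fixes g :: "real \<Rightarrow> real"
  assumes "integrable lborel g"
  obtains P where "\<And>x z. x \<le> z \<Longrightarrow> P z - P x = (LBINT w:{x..z}. g w)"
proof
  fix x z :: real assume "x \<le> z"
  note i = set_integrable_lborel[OF assms]
  have "{..z} = {..x} \<union> {x..z}" using \<open>x \<le> z\<close> by auto
  moreover have "AE w in lborel. w \<noteq> x" by (rule AE_lborel_singleton)
  ultimately have "(LBINT w:{..z}. g w) = (LBINT w:{..x}. g w) + (LBINT w:{x..z}. g w)"
    by (simp only:) (rule set_integral_Un_AE, auto simp: i elim!: eventually_mono)
  \<comment> \<open>The witness, the integral from minus infinity, is fixed only here by
    unification.\<close>
  then show "(LBINT w:{..z}. g w) - (LBINT w:{..x}. g w) = (LBINT w:{x..z}. g w)" by simp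
qed

lemma compact_support_uniformly_continuous:
  fixes g :: "real \<Rightarrow> real"
  assumes "continuous_on UNIV g" "\<And>x. R < \<bar>x\<bar> \<Longrightarrow> g x = 0" "0 < \<epsilon>"
  obtains \<delta> where "0 < \<delta>" "\<And>x z. \<bar>z - x\<bar> < \<delta> \<Longrightarrow> \<bar>g z - g x\<bar> \<le> \<epsilon>"
proof -
  have "uniformly_continuous_on {-(R+1)..R+1} g"
    using assms(1) by (intro compact_uniformly_continuous) (auto intro: continuous_on_subset)
  then obtain \<delta> where \<delta>: "0 < \<delta>"
    "\<forall>x\<in>{-(R+1)..R+1}. \<forall>z\<in>{-(R+1)..R+1}. dist z x < \<delta> \<longrightarrow> dist (g z) (g x) < \<epsilon>"
    using \<open>0 < \<epsilon>\<close> unfolding uniformly_continuous_on_def by blast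
  \<comment> \<open>The collar of width 1 ensures that if one point leaves the compact interval,
    both are beyond R, where \<open>g\<close> vanishes.\<close>
  have "\<bar>g z - g x\<bar> \<le> \<epsilon>" if "\<bar>z - x\<bar> < min \<delta> 1" for x z
  proof (cases "x \<in> {-(R+1)..R+1} \<and> z \<in> {-(R+1)..R+1}")
    case True
    then show ?thesis using \<delta>(2) that by (auto simp: dist_real_def less_imp_le)
  next
    case False
    then have "R < \<bar>x\<bar>" "R < \<bar>z\<bar>" using that by auto
    then show ?thesis using assms(2)[of x] assms(2)[of z] \<open>0 < \<epsilon>\<close> by simp
  qed
  with \<delta>(1) show ?thesis using that[of "min \<delta> 1"] by auto
qed

context hunter_saxton_data
begin

lemma u_bounded:
  obtains B where "0 \<le> B" "\<And>t x. 0 \<le> t \<Longrightarrow> t \<le> T \<Longrightarrow> l \<le> x \<Longrightarrow> x \<le> r \<Longrightarrow> \<bar>u t x\<bar> \<le> B"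
proof -
  have "continuous_on ({0..T} \<times> {l..r}) (\<lambda>(t, x). u t x)"
    by (rule continuous_on_subset[OF u_joint_cont]) auto
  then have "compact ((\<lambda>(t, x). u t x) ` ({0..T} \<times> {l..r}))"
    by (rule compact_continuous_image) (intro compact_Times compact_Icc)
  then obtain B where B: "\<forall>v\<in>(\<lambda>(t, x). u t x) ` ({0..T} \<times> {l..r}). norm v \<le> B"
    by (metis compact_imp_bounded bounded_iff)
  have "\<bar>u t x\<bar> \<le> max 0 B" if "0 \<le> t" "t \<le> T" "l \<le> x" "x \<le> r" for t x
  proof -
    have "u t x \<in> (\<lambda>(t, x). u t x) ` ({0..T} \<times> {l..r})"
      using that by (intro image_eqI[of _ _ "(t, x)"]) auto
    then show ?thesis using bspec[OF B, of "u t x"] by simp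
  qed
  then show ?thesis using that[of "max 0 B"] by auto
qed

lemma flow_dist_le:
  assumes "0 \<le> s" "s \<le> T" "0 \<le> t" "t \<le> T" "\<bar>u t x\<bar> \<le> B"
  shows "\<bar>flow s t x - x\<bar> \<le> \<bar>s - t\<bar> * (B + energy / 4 * T)"
proof -
  have "\<bar>flow s t x - x\<bar> \<le> \<bar>flow s t x - x - (s - t) * u t x\<bar> + \<bar>(s - t) * u t x\<bar>" by arith
  also have "\<dots> \<le> energy / 4 * \<bar>s - t\<bar> * \<bar>s - t\<bar> + \<bar>s - t\<bar> * B"
    unfolding abs_mult using assms by (intro add_mono flow_dist mult_left_mono) auto
  also have "energy / 4 * \<bar>s - t\<bar> * \<bar>s - t\<bar> \<le> energy / 4 * \<bar>s - t\<bar> * T"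
    using assms energy_nonneg by (intro mult_left_mono) auto
  finally show ?thesis by (simp add: algebra_simps)
qed

text \<open>\<open>u s x\<close> is compared with \<open>u s\<close> at the point reached from x by
  the flow, which \<open>increment_L2_bound\<close> controls in the mean, and that value with
  \<open>u t x\<close>, which is Lipschitz along the characteristic.\<close>

lemma u_L2_lipschitz:
  assumes "0 \<le> T"
  obtains C where "0 \<le> C"
    "\<And>s t. 0 \<le> s \<Longrightarrow> s \<le> T \<Longrightarrow> 0 \<le> t \<Longrightarrow> t \<le> T \<Longrightarrow> L2dist {l..r} (u s) (u t) \<le> C * \<bar>s - t\<bar>"
proof -
  obtain Bu where Bu: "0 \<le> Bu" "\<And>t x. 0 \<le> t \<Longrightarrow> t \<le> T \<Longrightarrow> l \<le> x \<Longrightarrow> x \<le> r \<Longrightarrow> \<bar>u t x\<bar> \<le> Bu"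
    using u_bounded[of T l r] by blast
  \<comment> \<open>Bounds the speed at which \<open>flow\<close> leaves x, as in
    \<open>flow_dist_le\<close>.\<close>
  define K0 where "K0 = Bu + energy / 4 * T"
  have K0: "0 \<le> K0" using Bu(1) assms energy_nonneg by (simp add: K0_def)
  define R where "R = measure lborel {l..r}"
  \<comment> \<open>Both terms of the pointwise bound integrate to multiples of h^2: the mass of
    \<open>B\<close> supplies a second factor h * K0 to the first.\<close>
  define C2 where "C2 = 4 * K0\<^sup>2 * energy + 2 * (energy / 4)\<^sup>2 * R"
  have C2: "0 \<le> C2" using energy_nonneg by (simp add: C2_def R_def)
  have "L2dist {l..r} (u s) (u t) \<le> sqrt C2 * \<bar>s - t\<bar>" if st: "0 \<le> s" "s \<le> T" "0 \<le> t" "t \<le> T" for s t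
  proof -
    have [measurable]: "u s \<in> borel_measurable borel" "u t \<in> borel_measurable borel"
      using st by (auto intro: u_meas)
    define h where "h = \<bar>s - t\<bar>"
    have h: "0 \<le> h" "0 \<le> h * K0" using K0 by (auto simp: h_def)
    obtain B where B: "integrable lborel B" "\<And>x. 0 \<le> B x"
      "integral\<^sup>L lborel B = 2 * (h * K0) * (LBINT x. (ux s x)\<^sup>2)"
      "\<And>x z. \<bar>z - x\<bar> \<le> h * K0 \<Longrightarrow> (u s z - u s x)\<^sup>2 \<le> h * K0 * B x"
      using increment_L2_bound[OF ux_meas[OF st(1)] ux_sq_integrable[OF st(1)] h(2) u_diff[OF st(1)]] by blast
    have pt: "(u s x - u t x)\<^sup>2 \<le> 2 * (h * K0) * B x + 2 * (energy / 4 * h)\<^sup>2" if x: "x \<in> {l..r}" for x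
    proof -
      have "(u s x - u t x)\<^sup>2 \<le> 2 * (u s x - u s (flow s t x))\<^sup>2 + 2 * (u s (flow s t x) - u t x)\<^sup>2"
        using power2_add_le[of "u s x - u s (flow s t x)" "u s (flow s t x) - u t x"] by simp
      moreover have "(u s x - u s (flow s t x))\<^sup>2 \<le> h * K0 * B x"
      proof -
        have "\<bar>flow s t x - x\<bar> \<le> h * K0"
          unfolding h_def K0_def using x st Bu(2) by (intro flow_dist_le) auto
        from B(4)[OF this] show ?thesis by (simp add: power2_commute)
      qed
      moreover have "(u s (flow s t x) - u t x)\<^sup>2 \<le> (energy / 4 * h)\<^sup>2"
        using power_mono[OF u_flow_dist[OF st(1,3)] abs_ge_zero, of x 2] by (simp add: h_def)
      ultimately show ?thesis by (simp add: mult.assoc)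
    qed
    have ir: "set_integrable lborel {l..r} (\<lambda>x. 2 * (h * K0) * B x + 2 * (energy / 4 * h)\<^sup>2)"
      by (intro set_integral_add set_integrable_mult_right set_integrable_lborel[OF B(1)]
        set_integrable_const_Icc) simp
    have il: "set_integrable lborel {l..r} (\<lambda>x. (u s x - u t x)\<^sup>2)"
      by (rule set_integrable_bound[OF ir])
        (use pt abs_ge_self order_trans in \<open>auto simp: set_borel_measurable_def intro!: AE_I2, blast\<close>)
    have "(LBINT x:{l..r}. (u s x - u t x)\<^sup>2) \<le> (LBINT x:{l..r}. 2 * (h * K0) * B x + 2 * (energy / 4 * h)\<^sup>2)"
      by (rule set_integral_mono[OF il ir pt])
    also have "\<dots> \<le> 2 * (h * K0) * integral\<^sup>L lborel B + 2 * (energy / 4 * h)\<^sup>2 * R"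
    proof -
      have e1: "(LBINT x:{l..r}. 2 * (h * K0) * B x + 2 * (energy / 4 * h)\<^sup>2)
          = 2 * (h * K0) * (LBINT x:{l..r}. B x) + (LBINT x:{l..r}. 2 * (energy / 4 * h)\<^sup>2)"
        using set_integrable_lborel[OF B(1)] set_integrable_const_Icc by (subst set_integral_add(2)) auto
      have le: "(LBINT x:{l..r}. B x) \<le> integral\<^sup>L lborel B"
        by (rule set_integral_le_integral[OF B(1,2)]) simp
      have "(LBINT x:{l..r}. d) = d * R" for d :: real
        by (simp add: set_lebesgue_integral_def R_def)
      then show ?thesis
        unfolding e1 using h by (simp only:) (intro add_right_mono mult_left_mono le, simp)
    qed
    also have "\<dots> \<le> 2 * (h * K0) * (2 * (h * K0) * energy) + 2 * (energy / 4 * h)\<^sup>2 * R"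
      unfolding B(3) ux_sq_integral[OF st(1)] using M_bounds(2) h by (intro add_right_mono mult_left_mono) auto
    also have "\<dots> = C2 * h\<^sup>2"
      by (simp add: C2_def power2_eq_square algebra_simps)
    finally have "(LBINT x:{l..r}. (u s x - u t x)\<^sup>2) \<le> C2 * h\<^sup>2" .
    then have "sqrt (LBINT x:{l..r}. (u s x - u t x)\<^sup>2) \<le> sqrt (C2 * h\<^sup>2)" by (rule real_sqrt_le_mono)
    also have "\<dots> = sqrt C2 * \<bar>s - t\<bar>" using h by (simp add: real_sqrt_mult h_def)
    finally show ?thesis
      unfolding L2dist_def by (subst L2norm_AE[of "\<lambda>x. u s x - u t x"]) auto
  qed
  then show ?thesis using that[of "sqrt C2"] C2 by auto
qed

lemma u_L2:
  assumes "0 \<le> t" shows "u t \<in> L2 {l..r}"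
proof (rule L2I_AE[OF u_meas[OF assms]])
  show "set_integrable lborel {l..r} (\<lambda>x. (u t x)\<^sup>2)"
    by (intro borel_integrable_atLeastAtMost' continuous_on_power continuous_on_subset[OF u_cont[OF
      assms]] subset_UNIV)
qed auto

lemma u_abs_cont_L2loc:
  assumes "0 \<le> T" shows "abs_cont_L2loc {0..T} u"
  unfolding abs_cont_L2loc_def
proof (intro allI conjI ballI)
  fix l r t :: real assume "t \<in> {0..T}"
  then show "u t \<in> L2 {l..r}" by (auto intro: u_L2)
next
  fix l r :: real
  obtain C where C: "0 \<le> C"
    "\<And>s t. 0 \<le> s \<Longrightarrow> s \<le> T \<Longrightarrow> 0 \<le> t \<Longrightarrow> t \<le> T \<Longrightarrow> L2dist {l..r} (u s) (u t) \<le> C * \<bar>s - t\<bar>"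
    using u_L2_lipschitz[OF assms, of l r] by blast
  show "abs_cont_on (L2dist {l..r}) {0..T} u"
    unfolding abs_cont_on_iff
  proof (intro allI impI)
    fix \<epsilon> :: real assume "0 < \<epsilon>"
    have "abs_cont_modulus (L2dist {l..r}) {0..T} u \<epsilon> (\<epsilon> / (C + 1))"
      unfolding abs_cont_modulus_def
    proof (intro allI impI)
      fix n p q assume *: "interval_family {..<n::nat} p q" "\<forall>i<n. p i \<in> {0..T} \<and> q i \<in> {0..T}"
        "(\<Sum>i<n. q i - p i) < \<epsilon> / (C + 1)"
      have pq: "p i \<le> q i" if "i < n" for i using *(1) that by (auto simp: interval_family_def)
      have "(\<Sum>i<n. L2dist {l..r} (u (p i)) (u (q i))) \<le> (\<Sum>i<n. (C + 1) * (q i - p i))"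
      proof (rule sum_mono)
        fix i assume i: "i \<in> {..<n}"
        then have "L2dist {l..r} (u (p i)) (u (q i)) \<le> C * \<bar>p i - q i\<bar>" using *(2) by (intro C) auto
        also have "\<dots> \<le> (C + 1) * (q i - p i)" using pq[of i] i by (simp add: algebra_simps)
        finally show "L2dist {l..r} (u (p i)) (u (q i)) \<le> (C + 1) * (q i - p i)" .
      qed
      also have "\<dots> = (C + 1) * (\<Sum>i<n. q i - p i)" by (simp add: sum_distrib_left)
      also have "\<dots> < \<epsilon>" using *(3) C(1) by (simp add: pos_less_divide_eq mult.commute)
      finally show "(\<Sum>i<n. L2dist {l..r} (u (p i)) (u (q i))) < \<epsilon>" .
    qed
    then show "\<exists>\<delta>>0. abs_cont_modulus (L2dist {l..r}) {0..T} u \<epsilon> \<delta>"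
      using \<open>0 < \<epsilon>\<close> C(1) by (intro exI[of _ "\<epsilon> / (C + 1)"]) auto
  qed
qed

lemma rhs_meas:
  assumes "0 \<le> t" shows "(\<lambda>x. \<phi> t (label t x)) \<in> borel_measurable borel"
  by (rule borel_measurable_mono) (auto simp: mono_def intro!: phi_mono label_mono[OF assms])

text \<open>\<open>phi_time_diff\<close> under the time integral, with monotonicity of
  \<open>M\<close> bounding the intermediate times by the end points. Where \<open>M\<close> is
  continuous the remainder is of smaller order than |s - t|, uniformly in \<open>y\<close>.\<close>

lemma V_time_diff_quot:
  assumes "0 \<le> s" "0 \<le> t"
  shows "\<bar>V s y - V t y - (s - t) * \<phi> t y\<bar> \<le> \<bar>M s - M t\<bar> / 4 * \<bar>s - t\<bar>"
proof (cases "s \<le> t")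
  case True
  have "\<bar>(LBINT r:{s..t}. \<phi> r y) - (t - s) * \<phi> t y\<bar> \<le> (M s - M t) / 4 * (t - s)"
  proof (rule set_integral_const_dist[OF True phi_set_integrable])
    fix r assume r: "s \<le> r" "r \<le> t"
    then have "\<bar>\<phi> r y - \<phi> t y\<bar> \<le> (M r - M t) / 4" using assms by (intro phi_time_diff) auto
    also have "\<dots> \<le> (M s - M t) / 4" using M_antimono[OF assms(1) r(1)] by simp
    finally show "\<bar>\<phi> r y - \<phi> t y\<bar> \<le> (M s - M t) / 4" .
  qed
  moreover have "V s y - V t y - (s - t) * \<phi> t y = - ((LBINT r:{s..t}. \<phi> r y) - (t - s) * \<phi> t y)"
    using V_time_diff[OF assms(1) True, of y] by (simp add: algebra_simps)
  moreover have "\<bar>M s - M t\<bar> = M s - M t" "\<bar>s - t\<bar> = t - s" using M_antimono[OF assms(1) True] True by auto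
  ultimately show ?thesis by (simp only: abs_minus_cancel)
next
  case False
  then have ts: "t \<le> s" by simp
  have "\<bar>(LBINT r:{t..s}. \<phi> r y) - (s - t) * \<phi> t y\<bar> \<le> (M t - M s) / 4 * (s - t)"
  proof (rule set_integral_const_dist[OF ts phi_set_integrable])
    fix r assume r: "t \<le> r" "r \<le> s"
    then have "\<bar>\<phi> t y - \<phi> r y\<bar> \<le> (M t - M r) / 4" using assms by (intro phi_time_diff) auto
    also have "\<dots> \<le> (M t - M s) / 4" using M_antimono[of r s] r assms by simp
    finally show "\<bar>\<phi> r y - \<phi> t y\<bar> \<le> (M t - M s) / 4" by (simp only: abs_minus_commute)
  qed
  moreover have "V s y - V t y = (LBINT r:{t..s}. \<phi> r y)" by (rule V_time_diff[OF assms(2) ts])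
  moreover have "\<bar>M s - M t\<bar> = M t - M s" "\<bar>s - t\<bar> = s - t" using M_antimono[OF assms(2) ts] ts by auto
  ultimately show ?thesis by (simp only:)
qed

text \<open>The time derivative dictated by the equation in nonconservative form: source minus
  transport.\<close>

definition "ut t x = \<phi> t (label t x) - u t x * ux t x"

abbreviation "quot_error s t x \<equiv> (u s x - u t x) / (s - t) - ut t x"

lemma four_squares: "((p1::real) - (p2 + p3 + p4))\<^sup>2 \<le> 4 * (p1\<^sup>2 + p2\<^sup>2 + p3\<^sup>2 + p4\<^sup>2)"
proof -
  have eq: "p1 - (p2 + p3 + p4) = (p1 - p2) + - (p3 + p4)" by simp
  have "((p1 - p2) + - (p3 + p4))\<^sup>2 \<le> 2 * (p1 - p2)\<^sup>2 + 2 * (p3 + p4)\<^sup>2"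
    using power2_add_le[of "p1 - p2" "- (p3 + p4)"] unfolding power2_minus .
  moreover have "(p1 - p2)\<^sup>2 \<le> 2 * p1\<^sup>2 + 2 * p2\<^sup>2" using power2_add_le[of p1 "- p2"] by simp
  moreover have "(p3 + p4)\<^sup>2 \<le> 2 * p3\<^sup>2 + 2 * p4\<^sup>2" by (rule power2_add_le)
  moreover have "A \<le> 2 * B + 2 * C \<Longrightarrow> B \<le> 2 * p + 2 * q \<Longrightarrow> C \<le> 2 * r + 2 * s \<Longrightarrow> A \<le> 4 * (p + q + r + s)"
    for A B C p q r s :: real unfolding distrib_left by linarith
  ultimately show ?thesis unfolding eq by blast
qed

text \<open>With \<open>x' = flow s t x\<close> and \<open>P\<close> a primitive of a test function \<open>g\<close> near \<open>ux t\<close>, the difference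
  quotient splits as
  \<open>(u s x - u t x)/(s-t) = (V s y - V t y)/(s-t) - (u s x' - u s x)/(s-t)\<close>, where \<open>u s - P\<close> has small
  derivative in \<open>L\<^sup>2\<close>.\<close>

lemma difference_quotient_bound:
  fixes g P :: "real \<Rightarrow> real"
  assumes st: "0 \<le> s" "s \<le> T" "0 \<le> t" "t \<le> T" "s \<noteq> t"
    and Bu: "\<And>x. l \<le> x \<Longrightarrow> x \<le> r \<Longrightarrow> \<bar>u t x\<bar> \<le> Bu" "0 \<le> Bu"
    and K0: "K0 = Bu + energy / 4 * T"
    and g: "continuous_on UNIV g" "\<And>x. R < \<bar>x\<bar> \<Longrightarrow> g x = 0" "\<And>x. \<bar>g x\<bar> \<le> Bg" "0 \<le> Bg"
    and P: "\<And>x z. x \<le> z \<Longrightarrow> P z - P x = (LBINT w:{x..z}. g w)"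
    and mod: "\<And>x z. \<bar>z - x\<bar> \<le> \<bar>s - t\<bar> * K0 \<Longrightarrow> \<bar>g z - g x\<bar> \<le> e"
  shows "(LBINT x:{l..r}. (quot_error s t x)\<^sup>2) \<le>
    4 * (measure lborel {l..r} * (\<bar>M s - M t\<bar> / 4)\<^sup>2 + 2 * K0\<^sup>2 * (LBINT x. (ux s x - g x)\<^sup>2)
      + measure lborel {l..r} * (e * K0 + Bg * (energy / 4) * \<bar>s - t\<bar>)\<^sup>2 + Bu\<^sup>2 * (LBINT x. (ux t x - g x)\<^sup>2))"
proof -
  have T: "0 \<le> T" using st by simp
  have K0n: "0 \<le> K0" using Bu(2) T energy_nonneg by (simp add: K0)
  have e: "0 \<le> e" using mod[of 0 0] K0n by simp
  define h where "h = \<bar>s - t\<bar>"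
  have h: "0 < h" using st by (simp add: h_def)
  define \<alpha> c where "\<alpha> = \<bar>M s - M t\<bar> / 4" and "c = e * K0 + Bg * (energy / 4) * h"
  have [measurable]: "u s \<in> borel_measurable borel" "u t \<in> borel_measurable borel"
    "ux s \<in> borel_measurable borel"
    "ux t \<in> borel_measurable borel" "g \<in> borel_measurable borel"
      "(\<lambda>x. \<phi> t (label t x)) \<in> borel_measurable borel"
    using st g(1) by (auto intro: u_meas ux_meas rhs_meas borel_measurable_continuous_onI)
  have gs: "set_integrable lborel {x..z} g" for x z
    by (rule set_integrable_lborel[OF compact_support_integrable[of g R]]) (use g in auto)
  have di: "integrable lborel (\<lambda>x. (ux s x - g x)\<^sup>2)" "integrable lborel (\<lambda>x. (ux t x - g x)\<^sup>2)"
    by (rule L2_dist_test(1)[where R = R]; use st g in auto)+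
  have Pd: "(u s z - P z) - (u s x - P x) = (LBINT w:{x..z}. ux s w - g w)" if "x \<le> z" for x z
    using u_diff[OF st(1) that] P[OF that] ux_set_integrable[OF st(1)] gs by simp
  have m: "(\<lambda>x. ux s x - g x) \<in> borel_measurable borel" by measurable
  have hK: "0 \<le> h * K0" using h K0n by simp
  obtain B where B: "integrable lborel B" "\<And>x. 0 \<le> B x"
    "integral\<^sup>L lborel B = 2 * (h * K0) * (LBINT x. (ux s x - g x)\<^sup>2)"
    "\<And>x z. \<bar>z - x\<bar> \<le> h * K0 \<Longrightarrow> ((u s z - P z) - (u s x - P x))\<^sup>2 \<le> h * K0 * B x"
    using increment_L2_bound[OF m di(1) hK Pd] by blast
  have pt: "(quot_error s t x)\<^sup>2 \<le> 4 * (\<alpha>\<^sup>2 + K0 / h * B x + c\<^sup>2 + Bu\<^sup>2 * (ux t x - g x)\<^sup>2)"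
    if x: "x \<in> {l..r}" for x
  proof -
    define y x' where "y = label t x" and "x' = flow s t x"
    have fd: "\<bar>x' - x\<bar> \<le> h * K0"
      unfolding x'_def h_def K0 using x st Bu by (intro flow_dist_le) auto
    \<comment> \<open>\<open>p1\<close> is the error of the derivative along the characteristic,
      \<open>p2\<close> the increment of u - P, \<open>p3\<close> the first order error of P along
      the flow, and \<open>p4\<close> the price of exchanging \<open>ux\<close> for
      \<open>g\<close>.\<close>
    define p1 p2 p3 p4 where "p1 = (V s y - V t y) / (s - t) - \<phi> t y"
      and "p2 = ((u s x' - P x') - (u s x - P x)) / (s - t)"
      and "p3 = (P x' - P x) / (s - t) - u t x * g x"
      and "p4 = u t x * (g x - ux t x)"
    have uV: "u s x' = V s y" "u t x = V t y" using u_flow[OF st(1)] by (auto simp: x'_def y_def u_def)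
    have "(u s x - u t x) / (s - t) - ut t x = p1 - (p2 + p3 + p4)"
      unfolding p1_def p2_def p3_def p4_def ut_def y_def[symmetric] using uV
      by (simp add: diff_divide_distrib add_divide_distrib algebra_simps)
    then have "(quot_error s t x)\<^sup>2 \<le> 4 * (p1\<^sup>2 + p2\<^sup>2 + p3\<^sup>2 + p4\<^sup>2)"
      using four_squares by simp
    moreover have "p1\<^sup>2 \<le> \<alpha>\<^sup>2"
    proof -
      have "p1 = (V s y - V t y - (s - t) * \<phi> t y) / (s - t)"
        using st(5) by (simp add: p1_def diff_divide_distrib)
      then have "\<bar>p1\<bar> \<le> \<alpha>"
        using V_time_diff_quot[OF st(1,3), of y] h by (simp add: abs_divide \<alpha>_def h_def pos_divide_le_eq)
      then show ?thesis using power_mono[of "\<bar>p1\<bar>" \<alpha> 2] by simp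
    qed
    \<comment> \<open>The factor 1/h is compensated after integration, since the mass of
      \<open>B\<close> is proportional to h.\<close>
    moreover have "p2\<^sup>2 \<le> K0 / h * B x"
    proof -
      have "p2\<^sup>2 = ((u s x' - P x') - (u s x - P x))\<^sup>2 / h\<^sup>2" by (simp add: p2_def power_divide h_def)
      also have "\<dots> \<le> h * K0 * B x / h\<^sup>2" using B(4)[OF fd] by (intro divide_right_mono) auto
      also have "\<dots> = K0 / h * B x" using h by (simp add: power2_eq_square)
      finally show ?thesis .
    qed
    moreover have "p3\<^sup>2 \<le> c\<^sup>2"
    proof -
      have 1: "\<bar>P x' - P x - (x' - x) * g x\<bar> \<le> e * \<bar>x' - x\<bar>"
      proof (cases "x \<le> x'")
        case True
        have "\<bar>(LBINT w:{x..x'}. g w) - (x' - x) * g x\<bar> \<le> e * (x' - x)"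
          by (rule set_integral_const_dist[OF True gs]) (use fd True in \<open>auto intro!: mod simp:
            h_def[symmetric]\<close>)
        then show ?thesis using P[OF True] True by simp
      next
        case False
        then have F: "x' \<le> x" by simp
        have "\<bar>(LBINT w:{x'..x}. g w) - (x - x') * g x\<bar> \<le> e * (x - x')"
          by (rule set_integral_const_dist[OF F gs]) (use fd F in \<open>auto intro!: mod simp: h_def[symmetric]\<close>)
        moreover have "P x' - P x - (x' - x) * g x = - ((LBINT w:{x'..x}. g w) - (x - x') * g x)"
          using P[OF F] by (simp add: algebra_simps)
        moreover have "\<bar>x' - x\<bar> = x - x'" using F by simp
        ultimately show ?thesis by (simp only: abs_minus_cancel)
      qed
      have 2: "\<bar>x' - x - (s - t) * u t x\<bar> \<le> energy / 4 * h * h"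
        using flow_dist[OF st(1,3), of x] by (simp add: x'_def h_def)
      have "\<bar>P x' - P x - (s - t) * u t x * g x\<bar>
          \<le> \<bar>P x' - P x - (x' - x) * g x\<bar> + \<bar>(x' - x - (s - t) * u t x) * g x\<bar>"
        using abs_triangle_ineq[of "P x' - P x - (x' - x) * g x" "(x' - x - (s - t) * u t x) * g x"]
        by (simp add: algebra_simps)
      also have "\<dots> \<le> e * (h * K0) + (energy / 4 * h * h) * Bg"
        unfolding abs_mult using 1 2 fd e g(3)[of x] energy_nonneg h
        by (intro add_mono mult_mono order_trans[OF 1 mult_left_mono[OF fd e]]) auto
      also have "\<dots> = c * h" by (simp add: c_def algebra_simps)
      finally have "\<bar>P x' - P x - (s - t) * u t x * g x\<bar> \<le> c * h" .
      moreover have "p3 = (P x' - P x - (s - t) * u t x * g x) / (s - t)"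
        using st(5) by (simp add: p3_def diff_divide_distrib)
      ultimately have "\<bar>p3\<bar> \<le> c" using h by (simp add: abs_divide h_def pos_divide_le_eq)
      then show ?thesis using power_mono[of "\<bar>p3\<bar>" c 2] by simp
    qed
    moreover have "p4\<^sup>2 \<le> Bu\<^sup>2 * (ux t x - g x)\<^sup>2"
    proof -
      have "(u t x)\<^sup>2 \<le> Bu\<^sup>2" using power_mono[OF Bu(1), of x 2] x by simp
      then have "(u t x)\<^sup>2 * (ux t x - g x)\<^sup>2 \<le> Bu\<^sup>2 * (ux t x - g x)\<^sup>2" by (rule mult_right_mono) simp
      then show ?thesis by (simp add: p4_def power_mult_distrib power2_commute)
    qed
    moreover have "A \<le> 4 * (b1 + b2 + b3 + b4) \<Longrightarrow> b1 \<le> c1 \<Longrightarrow> b2 \<le> c2 \<Longrightarrow> b3 \<le> c3 \<Longrightarrow> b4 \<le> c4 \<Longrightarrow>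
      A \<le> 4 * (c1 + c2 + c3 + c4)" for A b1 b2 b3 b4 c1 c2 c3 c4 :: real unfolding distrib_left by linarith
    ultimately show ?thesis by blast
  qed
  note sc = set_integrable_const_Icc[of l r]
  have cst: "(LBINT x:{l..r}. d) = measure lborel {l..r} * d" for d :: real
    by (simp add: set_lebesgue_integral_def)
  let ?f = "\<lambda>x. 4 * (\<alpha>\<^sup>2 + K0 / h * B x + c\<^sup>2 + Bu\<^sup>2 * (ux t x - g x)\<^sup>2)"
  have i: "set_integrable lborel {l..r} (\<lambda>x. K0 / h * B x)" "set_integrable lborel {l..r} (\<lambda>x. Bu\<^sup>2 *
    (ux t x - g x)\<^sup>2)"
    by (intro set_integrable_mult_right set_integrable_lborel B(1) di(2); simp)+
  have ir: "set_integrable lborel {l..r} ?f"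
    by (rule set_integrable_mult_right) (intro set_integral_add i sc)
  have il: "set_integrable lborel {l..r} (\<lambda>x. (quot_error s t x)\<^sup>2)"
  proof (rule set_integrable_bound[OF ir])
    show "set_borel_measurable lborel {l..r} (\<lambda>x. (quot_error s t x)\<^sup>2)"
      unfolding set_borel_measurable_def ut_def by measurable
    have "(quot_error s t x)\<^sup>2 \<le> \<bar>?f x\<bar>" if "x \<in> {l..r}" for x
      using pt[OF that] by (rule order_trans[OF _ abs_ge_self])
    then show "AE x in lborel. x \<in> {l..r} \<longrightarrow> norm ((quot_error s t x)\<^sup>2) \<le> norm (?f x)"
      by simp
  qed
  have "(LBINT x:{l..r}. (quot_error s t x)\<^sup>2) \<le> (LBINT x:{l..r}. ?f x)"
    by (rule set_integral_mono[OF il ir pt])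
  also have "\<dots> = 4 * ((LBINT x:{l..r}. \<alpha>\<^sup>2) + (LBINT x:{l..r}. K0 / h * B x) + (LBINT x:{l..r}. c\<^sup>2)
      + (LBINT x:{l..r}. Bu\<^sup>2 * (ux t x - g x)\<^sup>2))"
    using i sc by (simp only: set_integral_mult_right set_integral_add)
  also have "\<dots> \<le> 4 * (measure lborel {l..r} * \<alpha>\<^sup>2 + K0 / h * (2 * (h * K0) * (LBINT x. (ux s x - g x)\<^sup>2))
      + measure lborel {l..r} * c\<^sup>2 + Bu\<^sup>2 * (LBINT x. (ux t x - g x)\<^sup>2))"
  proof -
    have "(LBINT x:{l..r}. K0 / h * B x) \<le> K0 / h * (2 * (h * K0) * (LBINT x. (ux s x - g x)\<^sup>2))"
      unfolding set_integral_mult_right B(3)[symmetric] using K0n h by (intro mult_left_mono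
        set_integral_le_integral B) auto
    moreover have "(LBINT x:{l..r}. Bu\<^sup>2 * (ux t x - g x)\<^sup>2) \<le> Bu\<^sup>2 * (LBINT x. (ux t x - g x)\<^sup>2)"
      unfolding set_integral_mult_right by (intro mult_left_mono set_integral_le_integral di) auto
    ultimately show ?thesis unfolding cst by (intro mult_left_mono add_mono order_refl) auto
  qed
  also have "K0 / h * (2 * (h * K0) * (LBINT x. (ux s x - g x)\<^sup>2)) = 2 * K0\<^sup>2 * (LBINT x. (ux s x - g x)\<^sup>2)"
    using h by (simp add: power2_eq_square)
  finally show ?thesis by (simp only: \<alpha>_def c_def h_def)
qed

text \<open>In the limit the bound retains only the distance of \<open>ux t\<close> to
  \<open>g\<close> and the tolerance \<open>e\<close> for the oscillation of \<open>g\<close>. Both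
  are made small before k is sent to infinity; then the displacement also falls below the radius
  \<delta> that belongs to \<open>g\<close> and \<open>e\<close>.\<close>

lemma difference_quotient_tendsto:
  assumes t: "0 \<le> t" "t \<le> T" and S: "\<And>k. 0 \<le> S k" "\<And>k. S k \<le> T" "\<And>k. S k \<noteq> t" "S \<longlonglongrightarrow> t"
    and MS: "(\<lambda>k. M (S k)) \<longlonglongrightarrow> M t"
  shows "(\<lambda>k. LBINT x:{l..r}. (quot_error (S k) t x)\<^sup>2) \<longlonglongrightarrow> 0"
proof (rule LIMSEQ_I)
  fix \<epsilon> :: real assume "0 < \<epsilon>"
  obtain Bu where Bu: "0 \<le> Bu" "\<And>t x. 0 \<le> t \<Longrightarrow> t \<le> T \<Longrightarrow> l \<le> x \<Longrightarrow> x \<le> r \<Longrightarrow> \<bar>u t x\<bar> \<le> Bu"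
    using u_bounded[of T l r] by blast
  define K0 where "K0 = Bu + energy / 4 * T"
  have K0: "0 \<le> K0" using Bu(1) t energy_nonneg by (simp add: K0_def)
  define m where "m = measure lborel {l..r}"
  have m: "0 \<le> m" by (simp add: m_def)
  \<comment> \<open>8 * K0^2 + 4 * Bu^2 is the total coefficient of \<gamma> in the limit of the
    bound; the 1 keeps \<open>D\<close> positive.\<close>
  define D where "D = 8 * K0\<^sup>2 + 4 * Bu\<^sup>2 + 1"
  have D: "0 < D" by (simp add: D_def add_nonneg_pos)
  have "0 < \<epsilon> / (2 * D)" using \<open>0 < \<epsilon>\<close> D by simp
  obtain g R where g: "continuous_on UNIV g" "\<And>x. R < \<bar>x\<bar> \<Longrightarrow> g x = (0::real)"
    and small: "(LBINT x. (ux t x - g x)\<^sup>2) < \<epsilon> / (2 * D)"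
    by (rule ux_approx[OF t(1) \<open>0 < \<epsilon> / (2 * D)\<close>]) auto
  obtain Bg where Bg: "0 \<le> Bg" "\<And>x. \<bar>g x\<bar> \<le> Bg"
    by (rule compact_support_bounded[of g R]) (use g in auto)
  have gi: "integrable lborel g"
    by (rule compact_support_integrable[of g R]) (use g in auto)
  obtain P where P: "\<And>x z. x \<le> z \<Longrightarrow> P z - P x = (LBINT w:{x..z}. g w)"
    using compact_support_primitive[OF gi] by blast
  \<comment> \<open>Makes 4 * m * K0^2 * e^2 at most \<epsilon>/2, using e^2 <= e for e <=
    1.\<close>
  define E where "E = 8 * (m * K0\<^sup>2 + 1)"
  have E: "0 < E" using m by (simp add: E_def add_nonneg_pos)
  define e where "e = min 1 (\<epsilon> / E)"
  have e: "0 < e" "e \<le> 1" "e \<le> \<epsilon> / E" using \<open>0 < \<epsilon>\<close> E by (auto simp: e_def)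
  obtain \<delta> where \<delta>: "0 < \<delta>" "\<And>x z. \<bar>z - x\<bar> < \<delta> \<Longrightarrow> \<bar>g z - g x\<bar> \<le> e"
    by (rule compact_support_uniformly_continuous[of g R e]) (use g e in auto)
  define \<gamma> where "\<gamma> = (LBINT x. (ux t x - g x)\<^sup>2)"
  have \<gamma>: "0 \<le> \<gamma>" by (simp add: \<gamma>_def integral_nonneg_AE)
  let ?rhs = "\<lambda>k. 4 * (m * (\<bar>M (S k) - M t\<bar> / 4)\<^sup>2 + 2 * K0\<^sup>2 * (LBINT x. (ux (S k) x - g x)\<^sup>2)
      + m * (e * K0 + Bg * (energy / 4) * \<bar>S k - t\<bar>)\<^sup>2 + Bu\<^sup>2 * \<gamma>)"
  have J: "(\<lambda>k. LBINT x. (ux (S k) x - g x)\<^sup>2) \<longlonglongrightarrow> \<gamma>"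
    unfolding \<gamma>_def by (rule L2_dist_test_tendsto[where R = R]) (use S MS g in auto)
  have "?rhs \<longlonglongrightarrow> 4 * (m * (\<bar>M t - M t\<bar> / 4)\<^sup>2 + 2 * K0\<^sup>2 * \<gamma> + m * (e * K0 +
    Bg * (energy / 4) * \<bar>t - t\<bar>)\<^sup>2 + Bu\<^sup>2 * \<gamma>)"
    by (intro tendsto_intros MS J S; simp)
  moreover have "4 * (m * (\<bar>M t - M t\<bar> / 4)\<^sup>2 + 2 * K0\<^sup>2 * \<gamma> + m * (e * K0 +
    Bg * (energy / 4) * \<bar>t - t\<bar>)\<^sup>2 + Bu\<^sup>2 * \<gamma>) < \<epsilon>"
  proof -
    have "4 * (m * (\<bar>M t - M t\<bar> / 4)\<^sup>2 + 2 * K0\<^sup>2 * \<gamma> + m * (e * K0 + Bg * (energy / 4) * \<bar>t - t\<bar>)\<^sup>2 + Bu\<^sup>2 * \<gamma>)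
        = (8 * K0\<^sup>2 + 4 * Bu\<^sup>2) * \<gamma> + 4 * (m * K0\<^sup>2) * e\<^sup>2"
      by (simp add: power_mult_distrib algebra_simps)
    also have "(8 * K0\<^sup>2 + 4 * Bu\<^sup>2) * \<gamma> \<le> D * \<gamma>"
      using \<gamma> by (intro mult_right_mono) (auto simp: D_def)
    also have "D * \<gamma> < \<epsilon> / 2" using small D by (simp add: \<gamma>_def field_simps)
    also have "4 * (m * K0\<^sup>2) * e\<^sup>2 \<le> \<epsilon> / 2"
    proof -
      have "e\<^sup>2 \<le> e" using e by (simp add: power2_eq_square mult_left_le)
      then have "4 * (m * K0\<^sup>2) * e\<^sup>2 \<le> (E / 2) * (\<epsilon> / E)"
        using e m by (intro mult_mono) (auto simp: E_def)
      then show ?thesis using E by simp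
    qed
    finally show ?thesis by simp
  qed
  ultimately have ev: "\<forall>\<^sub>F k in sequentially. ?rhs k < \<epsilon>" by (rule order_tendstoD(2))
  have "(\<lambda>k. \<bar>S k - t\<bar> * K0) \<longlonglongrightarrow> \<bar>t - t\<bar> * K0" by (intro tendsto_intros S)
  then have "\<forall>\<^sub>F k in sequentially. \<bar>S k - t\<bar> * K0 < \<delta>" by (rule order_tendstoD(2)) (use \<delta>(1) in simp)
  with ev have "\<forall>\<^sub>F k in sequentially. norm ((LBINT x:{l..r}. (quot_error (S k) t x)\<^sup>2) - 0) < \<epsilon>"
  proof eventually_elim
    fix k assume k: "?rhs k < \<epsilon>" "\<bar>S k - t\<bar> * K0 < \<delta>"
    have "(LBINT x:{l..r}. (quot_error (S k) t x)\<^sup>2) \<le> ?rhs k"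
      unfolding m_def \<gamma>_def
    proof (rule difference_quotient_bound[OF S(1,2) t S(3) _ Bu(1) K0_def g(1) _ Bg(2) Bg(1) P])
      show "\<And>x. l \<le> x \<Longrightarrow> x \<le> r \<Longrightarrow> \<bar>u t x\<bar> \<le> Bu" by (rule Bu(2)[OF t])
      show "\<And>x. R < \<bar>x\<bar> \<Longrightarrow> g x = 0" by (rule g(2))
      show "\<bar>g z - g x\<bar> \<le> e" if "\<bar>z - x\<bar> \<le> \<bar>S k - t\<bar> * K0" for x z
        using that k(2) by (intro \<delta>(2)) linarith
    qed
    moreover have "0 \<le> (LBINT x:{l..r}. (quot_error (S k) t x)\<^sup>2)"
      by (rule set_integral_nonneg_real) simp
    ultimately show "norm ((LBINT x:{l..r}. (quot_error (S k) t x)\<^sup>2) - 0) < \<epsilon>"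
      using k(1) by simp
  qed
  then show "\<exists>K. \<forall>k\<ge>K. norm ((LBINT x:{l..r}. (quot_error (S k) t x)\<^sup>2) - 0) < \<epsilon>"
    by (simp only: eventually_sequentially)
qed

text \<open>At a continuity point of \<open>M\<close> every sequence of admissible times satisfies
  the assumptions of \<open>difference_quotient_tendsto\<close>, and sequences determine the
  limit.\<close>

lemma u_has_L2loc_derivative:
  assumes t: "0 \<le> t" "t \<le> T" and cont: "isCont M t"
  shows "has_L2loc_derivative {0..T} u t (ut t)"
  unfolding has_L2loc_derivative_def
proof (intro allI conjI)
  fix l r :: real
  have [measurable]: "u t \<in> borel_measurable borel" "ux t \<in> borel_measurable borel"
    "(\<lambda>x. \<phi> t (label t x)) \<in> borel_measurable borel"
    using t by (auto intro: u_meas ux_meas rhs_meas)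
  have utm [measurable]: "ut t \<in> borel_measurable borel" unfolding ut_def by measurable
  obtain Bu where Bu: "0 \<le> Bu" "\<And>t x. 0 \<le> t \<Longrightarrow> t \<le> T \<Longrightarrow> l \<le> x \<Longrightarrow> x \<le> r \<Longrightarrow> \<bar>u t x\<bar> \<le> Bu"
    using u_bounded[of T l r] by blast
  show "ut t \<in> L2 {l..r}"
  proof (rule L2I_AE[OF utm])
    have i: "set_integrable lborel {l..r} (\<lambda>x. 2 * (energy / 4)\<^sup>2 + 2 * Bu\<^sup>2 * (ux t x)\<^sup>2)"
      by (intro set_integral_add set_integrable_mult_right set_integrable_lborel ux_sq_integrable t
        set_integrable_const_Icc) simp
    have le: "(ut t x)\<^sup>2 \<le> 2 * (energy / 4)\<^sup>2 + 2 * Bu\<^sup>2 * (ux t x)\<^sup>2" if "x \<in> {l..r}" for x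
    proof -
      have "(ut t x)\<^sup>2 \<le> 2 * (\<phi> t (label t x))\<^sup>2 + 2 * (u t x * ux t x)\<^sup>2"
        using power2_add_le[of "\<phi> t (label t x)" "- (u t x * ux t x)"] by (simp add: ut_def)
      moreover have "(\<phi> t (label t x))\<^sup>2 \<le> (energy / 4)\<^sup>2"
        using power_mono[OF phi_abs abs_ge_zero, of t "label t x" 2] by (simp only: power2_abs)
      moreover have "(u t x * ux t x)\<^sup>2 \<le> Bu\<^sup>2 * (ux t x)\<^sup>2"
        unfolding power_mult_distrib using power_mono[OF Bu(2)[OF t], of x 2] that by (intro
          mult_right_mono) auto
      ultimately show ?thesis by linarith
    qed
    show "set_integrable lborel {l..r} (\<lambda>x. (ut t x)\<^sup>2)"
    proof (rule set_integrable_bound[OF i])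
      show "set_borel_measurable lborel {l..r} (\<lambda>x. (ut t x)\<^sup>2)"
        unfolding set_borel_measurable_def by measurable
      show "AE x in lborel. x \<in> {l..r} \<longrightarrow> norm ((ut t x)\<^sup>2) \<le> norm (2 * (energy / 4)\<^sup>2 + 2 * Bu\<^sup>2 * (ux t x)\<^sup>2)"
        using order_trans[OF le abs_ge_self] by simp
    qed
  qed auto
  show "((\<lambda>s. L2dist {l..r} (\<lambda>x. (u s x - u t x) / (s - t)) (ut t)) \<longlongrightarrow> 0) (at t within {0..T})"
    unfolding tendsto_at_iff_sequentially
  proof (intro allI impI)
    fix S assume S: "\<forall>i. S i \<in> {0..T} - {t}" "S \<longlonglongrightarrow> t"
    have eq: "L2dist {l..r} (\<lambda>x. (u (S k) x - u t x) / (S k - t)) (ut t)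
        = sqrt (LBINT x:{l..r}. (quot_error (S k) t x)\<^sup>2)" for k
    proof -
      have [measurable]: "u (S k) \<in> borel_measurable borel" using S(1) by (auto intro: u_meas)
      show ?thesis unfolding L2dist_def
        by (subst L2norm_AE[of "\<lambda>x. (u (S k) x - u t x) / (S k - t) - ut t x"]) auto
    qed
    have "(\<lambda>k. M (S k)) \<longlonglongrightarrow> M t" by (rule isCont_tendsto_compose[OF cont S(2)])
    then have "(\<lambda>k. LBINT x:{l..r}. (quot_error (S k) t x)\<^sup>2) \<longlonglongrightarrow> 0"
      using S by (intro difference_quotient_tendsto[OF t]) auto
    from tendsto_real_sqrt[OF this]
    show "((\<lambda>s. L2dist {l..r} (\<lambda>x. (u s x - u t x) / (s - t)) (ut t)) \<circ> S) \<longlonglongrightarrow> 0"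
      by (simp add: o_def eq)
  qed
qed

lemma HS_rhs_eq:
  assumes "0 \<le> t" shows "HS_rhs (u t) x = \<phi> t (label t x)"
proof -
  have [measurable]: "ux t \<in> borel_measurable borel" by (rule ux_meas[OF assms])
  have "(LINT z:A|lebesgue. (deriv (u t) z)\<^sup>2) = (LBINT z:A. (ux t z)\<^sup>2)"
    if [measurable]: "A \<in> sets borel" for A
    unfolding set_lebesgue_integral_def
    by (rule integral_lebesgue_cong_AE) (use deriv_u_AE[OF assms] in \<open>auto elim!: eventually_mono\<close>)
  then show ?thesis unfolding HS_rhs_def using rhs_eq_phi[OF assms, of x] by simp
qed

lemma HS_solution_u:
  assumes "0 < T" shows "HS_solution T ubar u"
  unfolding HS_solution_def
proof (intro conjI allI ballI)
  show "continuous_on ({0..T} \<times> UNIV) (\<lambda>(t, x). u t x)"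
    by (rule continuous_on_subset[OF u_joint_cont]) auto
  show "u 0 x = ubar x" for x
    using u_X[of 0 x] by (simp add: X_0 V_0)
  show "abs_cont (u t)" "deriv (u t) \<in> L2 UNIV" if "t \<in> {0..T}" for t
    using that by (auto intro: u_abs_cont deriv_u_L2)
  show "Linf_L2 {0..T} (\<lambda>t. deriv (u t))" by (rule Linf_L2_ux)
  show "abs_cont_L2loc {0..T} u" using assms by (intro u_abs_cont_L2loc) auto
  \<comment> \<open>Time 0 is discarded because \<open>AE_isCont_M\<close> speaks of positive
    times.\<close>
  have "AE t in lborel. t \<noteq> 0" by (rule AE_lborel_singleton)
  then have "AE t in lborel. t \<in> {0..T} \<longrightarrow>
     (\<exists>u_t. has_L2loc_derivative {0..T} u t u_t \<and>
       (AE x in lebesgue. u_t x + deriv (\<lambda>z. (u t z)\<^sup>2 / 2) x = HS_rhs (u t) x))"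
    using AE_isCont_M
  proof eventually_elim
    fix t :: real assume t0: "t \<noteq> 0" "0 < t \<longrightarrow> isCont M t"
    show "t \<in> {0..T} \<longrightarrow> (\<exists>u_t. has_L2loc_derivative {0..T} u t u_t \<and>
       (AE x in lebesgue. u_t x + deriv (\<lambda>z. (u t z)\<^sup>2 / 2) x = HS_rhs (u t) x))"
    proof (intro impI exI conjI)
      assume "t \<in> {0..T}"
      then have t: "0 \<le> t" "t \<le> T" "isCont M t" using t0 by auto
      show "has_L2loc_derivative {0..T} u t (ut t)" by (rule u_has_L2loc_derivative[OF t])
      have "AE x in lborel. ut t x + deriv (\<lambda>z. (u t z)\<^sup>2 / 2) x = HS_rhs (u t) x"
        using u_has_derivative[OF t(1)]
      proof eventually_elim
        fix x assume "(u t has_real_derivative ux t x) (at x)"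
        then have "((\<lambda>z. (u t z)\<^sup>2 / 2) has_real_derivative u t x * ux t x) (at x)"
          by (auto intro!: derivative_eq_intros)
        then have "deriv (\<lambda>z. (u t z)\<^sup>2 / 2) x = u t x * ux t x" by (rule DERIV_imp_deriv)
        then show "ut t x + deriv (\<lambda>z. (u t z)\<^sup>2 / 2) x = HS_rhs (u t) x"
          by (simp add: ut_def HS_rhs_eq[OF t(1)])
      qed
      then show "AE x in lebesgue. ut t x + deriv (\<lambda>z. (u t z)\<^sup>2 / 2) x = HS_rhs (u t) x"
        by (rule AE_completion)
    qed
  qed
  then show "AE t in lebesgue. t \<in> {0..T} \<longrightarrow>
     (\<exists>u_t. has_L2loc_derivative {0..T} u t u_t \<and>
       (AE x in lebesgue. u_t x + deriv (\<lambda>z. (u t z)\<^sup>2 / 2) x = HS_rhs (u t) x))"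
    by (rule AE_completion)
qed

end

section \<open>Dissipation\<close>

lemma C1c_test_cont:
  assumes "C1c_test \<psi> \<psi>t \<psi>x"
  shows "continuous_on ({0..} \<times> UNIV) (\<lambda>(t, x). \<psi> t x)"
proof (rule has_derivative_continuous_on)
  fix p :: "real \<times> real" assume "p \<in> {0..} \<times> UNIV"
  then show "((\<lambda>(t, x). \<psi> t x) has_derivative (\<lambda>(h, k). \<psi>t (fst p) (snd p) * h + \<psi>x (fst p) (snd p) * k))
      (at p within {0..} \<times> UNIV)"
    using assms unfolding C1c_test_def by (cases p) auto
qed

text \<open>Near such a point \<psi> vanishes on an open set, and uniqueness of the derivative
  applies. Positivity of t places the neighbourhood inside the half-plane, where the derivative is
  two-sided.\<close>

lemma C1c_test_deriv_zero:
  assumes test: "C1c_test \<psi> \<psi>t \<psi>x" and K: "compact K" "\<forall>t\<ge>0. \<forall>x. (t, x) \<notin> K \<longrightarrow> \<psi> t x = 0"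
    and t: "0 < t" "(t, x) \<notin> K"
  shows "\<psi>t t x = 0 \<and> \<psi>x t x = 0"
proof -
  define U where "U = {0<..} \<times> UNIV - K"
  have U: "open U" "(t, x) \<in> U"
    using t compact_imp_closed[OF K(1)] by (auto simp: U_def intro!: open_Diff open_Times)
  have "((\<lambda>(s, y). \<psi> s y) has_derivative (\<lambda>(h, k). \<psi>t t x * h + \<psi>x t x * k)) (at (t, x) within {0..} \<times> UNIV)"
    using test t(1) unfolding C1c_test_def by auto
  then have 1: "((\<lambda>(s, y). \<psi> s y) has_derivative (\<lambda>(h, k). \<psi>t t x * h + \<psi>x t x * k)) (at (t, x) within U)"
    by (rule has_derivative_subset) (auto simp: U_def)
  have "((\<lambda>_. 0) has_derivative (\<lambda>(h, k). \<psi>t t x * h + \<psi>x t x * k)) (at (t, x) within U)"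
    by (rule has_derivative_transform[OF U(2) _ 1]) (use K(2) in \<open>auto simp: U_def\<close>)
  then have "((\<lambda>_. 0::real) has_derivative (\<lambda>(h, k). \<psi>t t x * h + \<psi>x t x * k)) (at (t, x))"
    using at_within_open[OF U(2,1)] by simp
  moreover have "((\<lambda>_. 0::real) has_derivative (\<lambda>_. 0)) (at (t, x))" by simp
  ultimately have eq: "(\<lambda>(h, k). \<psi>t t x * h + \<psi>x t x * k) = (\<lambda>_. 0)" by (rule has_derivative_unique)
  from fun_cong[OF eq, of "(1, 0)"] fun_cong[OF eq, of "(0, 1)"] show ?thesis by simp
qed

context hunter_saxton_data
begin

lemma X_has_derivative:
  assumes "0 \<le> t" "S \<subseteq> {0..}"
  shows "((\<lambda>s. X s y) has_real_derivative V t y) (at t within S)"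
  unfolding has_field_derivative_iff
proof (rule LIM_zero_cancel, rule Lim_null_comparison)
  show "\<forall>\<^sub>F s in at t within S. norm ((X s y - X t y) / (s - t) - V t y) \<le> energy / 4 * \<bar>s - t\<bar>"
    unfolding eventually_at_filter
  proof (intro always_eventually allI impI)
    fix s assume s: "s \<noteq> t" "s \<in> S"
    then have h: "0 < \<bar>s - t\<bar>" by simp
    have "(X s y - X t y) / (s - t) - V t y = (X s y - X t y - (s - t) * V t y) / (s - t)"
      using s by (simp add: diff_divide_distrib)
    moreover have "\<bar>X s y - X t y - (s - t) * V t y\<bar> \<le> energy / 4 * \<bar>s - t\<bar> * \<bar>s - t\<bar>"
      using s assms by (intro X_time_dist) auto
    ultimately show "norm ((X s y - X t y) / (s - t) - V t y) \<le> energy / 4 * \<bar>s - t\<bar>"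
      using h by (simp only: real_norm_def abs_divide pos_divide_le_eq)
  qed
  have "((\<lambda>s. energy / 4 * \<bar>s - t\<bar>) \<longlongrightarrow> energy / 4 * \<bar>t - t\<bar>) (at t within S)"
    by (intro tendsto_intros)
  then show "((\<lambda>s. energy / 4 * \<bar>s - t\<bar>) \<longlongrightarrow> 0) (at t within S)" by simp
qed

lemma X_time_cont: "continuous_on {0..} (\<lambda>s. X s y)"
  by (auto simp: continuous_on_eq_continuous_within intro!: DERIV_continuous X_has_derivative)

text \<open>\<open>X\<close> is continuous in \<open>t\<close> and measurable in \<open>y\<close>, hence a limit of functions piecewise constant in \<open>t\<close>.\<close>

lemma X_joint_meas: "(\<lambda>(t, y). X (max 0 t) y) \<in> borel_measurable (borel \<Otimes>\<^sub>M borel)"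
proof -
  \<comment> \<open>Rounding up to the grid of mesh 1/(k + 1); \<open>nat\<close> sends negative
    times to 0, which produces \<open>max 0 t\<close> in the limit.\<close>
  define T where "T k t = real (nat \<lceil>t * real (Suc k)\<rceil>) / real (Suc k)" for k and t :: real
  have T0: "0 \<le> T k t" for k t by (simp add: T_def)
  have lim: "(\<lambda>k. T k t) \<longlonglongrightarrow> max 0 t" for t
  proof (rule LIM_zero_cancel, rule Lim_null_comparison)
    have "\<bar>T k t - max 0 t\<bar> \<le> 1 / real (Suc k)" for k
    proof (cases "0 \<le> t")
      case True
      then have "t * real (Suc k) \<le> real (nat \<lceil>t * real (Suc k)\<rceil>)" "real (nat \<lceil>t * real (Suc k)\<rceil>) \<le>
        t * real (Suc k) + 1"
        by (auto intro: real_nat_ceiling_ge of_nat_ceiling)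
      then have "t \<le> T k t" "T k t \<le> t + 1 / real (Suc k)"
        by (simp_all add: T_def pos_divide_le_eq pos_le_divide_eq distrib_right del: of_nat_Suc)
      then show ?thesis using True by simp
    next
      case False
      then have "t * real (Suc k) \<le> 0" by (simp add: mult_nonpos_nonneg)
      then have "\<lceil>t * real (Suc k)\<rceil> \<le> 0" by (simp only: ceiling_le_zero)
      then show ?thesis using False by (simp add: T_def)
    qed
    then show "\<forall>\<^sub>F k in sequentially. norm (T k t - max 0 t) \<le> 1 / real (Suc k)" by simp
    show "(\<lambda>k. 1 / real (Suc k)) \<longlonglongrightarrow> 0" using LIMSEQ_inverse_real_of_nat by (simp add: inverse_eq_divide)
  qed
  show ?thesis
  proof (rule borel_measurable_LIMSEQ_metric)
    fix k
    have "(\<lambda>p. (\<lambda>i p. X (real i / real (Suc k)) (snd p)) (nat \<lceil>fst p * real (Suc k)\<rceil>) p)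
        \<in> borel_measurable (borel \<Otimes>\<^sub>M borel :: (real \<times> real) measure)"
    proof (rule measurable_compose_countable[where f = "\<lambda>i p. X (real i / real (Suc k)) (snd p)"
          and g = "\<lambda>p. nat \<lceil>fst p * real (Suc k)\<rceil>"])
      fix i :: nat
      show "(\<lambda>p :: real \<times> real. X (real i / real (Suc k)) (snd p)) \<in> borel_measurable (borel \<Otimes>\<^sub>M borel)"
        by (rule measurable_compose[OF measurable_snd X_meas]) simp
      show "(\<lambda>p :: real \<times> real. nat \<lceil>fst p * real (Suc k)\<rceil>) \<in> borel \<Otimes>\<^sub>M borel \<rightarrow>\<^sub>M count_space UNIV"
        by measurable
    qed
    then show "(\<lambda>(t, y). X (T k t) y) \<in> borel_measurable (borel \<Otimes>\<^sub>M borel)"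
      by (simp add: T_def case_prod_beta')
  next
    fix p :: "real \<times> real"
    show "(\<lambda>k. case p of (t, y) \<Rightarrow> X (T k t) y) \<longlonglongrightarrow> (case p of (t, y) \<Rightarrow> X (max 0 t) y)"
      using X_time_tendsto[OF T0 _ lim] by (cases p) auto
  qed
qed

lemma alive_zero_later: "alive s y = 0 \<Longrightarrow> 0 \<le> s \<Longrightarrow> s \<le> t \<Longrightarrow> alive t y = 0"
  using alive_antimono[of s t y] alive_bounds(1)[of t y] by simp

text \<open>Along each characteristic \<psi> changes by the time integral of \<open>H\<close>,
  because \<open>X\<close> moves with velocity \<open>u\<close>. Weighted with a^2 and integrated
  over living labels this would be an equality; labels that collapse between t1 and t2 leave a term
  at their collapse time that has to be dropped.\<close>

lemma HS_dissipative_u: "HS_dissipative u"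
  unfolding HS_dissipative_def
proof (intro allI impI, elim conjE)
  fix t1 t2 :: real and \<psi> \<psi>t \<psi>x :: "real \<Rightarrow> real \<Rightarrow> real"
  assume t12: "0 < t1" "t1 < t2" and test: "C1c_test \<psi> \<psi>t \<psi>x" and nn: "\<forall>t\<ge>0. \<forall>x. 0 \<le> \<psi> t x"
  let ?F = "\<lambda>t x. (deriv (u t) x)\<^sup>2 * \<psi>t t x + u t x * (deriv (u t) x)\<^sup>2 * \<psi>x t x"
  obtain K where K: "compact K" "K \<subseteq> {0..} \<times> UNIV" "\<forall>t\<ge>0. \<forall>x. (t, x) \<notin> K \<longrightarrow> \<psi> t x = 0"
    using test unfolding C1c_test_def by auto
  have c\<psi>: "continuous_on ({0..} \<times> UNIV) (\<lambda>(t, x). \<psi> t x)" by (rule C1c_test_cont[OF test])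
  have ct: "continuous_on ({0..} \<times> UNIV) (\<lambda>(t, x). \<psi>t t x)" and cx: "continuous_on ({0..} \<times> UNIV) (\<lambda>(t,
    x). \<psi>x t x)"
    using test unfolding C1c_test_def by auto
  define h where "h t x = \<psi>t t x + u t x * \<psi>x t x" for t x
  have ch: "continuous_on ({0..} \<times> UNIV) (\<lambda>(t, x). h t x)"
  proof -
    have "continuous_on ({0..} \<times> UNIV) (\<lambda>p. (\<lambda>(t, x). \<psi>t t x) p + (\<lambda>(t, x). u t x) p * (\<lambda>(t, x). \<psi>x t x) p)"
      by (intro continuous_on_add continuous_on_mult ct cx u_joint_cont)
    then show ?thesis by (simp add: h_def case_prod_beta')
  qed
  have slice: "continuous_on UNIV (f t)" if "continuous_on ({0..} \<times> UNIV) (\<lambda>(t, x). f t x)" "0 \<le> t"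
    for f :: "real \<Rightarrow> real \<Rightarrow> real" and t
  proof -
    have "continuous_on UNIV (\<lambda>x. (\<lambda>(t, x). f t x) (t, x))"
      by (rule continuous_on_compose2[OF that(1), where f = "\<lambda>x. (t, x)"])
        (intro continuous_intros, use that(2) in auto)
    then show ?thesis by simp
  qed
  have bounded: "\<exists>C\<ge>0. \<forall>t x. (t, x) \<in> K \<longrightarrow> \<bar>f t x\<bar> \<le> C"
    if "continuous_on ({0..} \<times> UNIV) (\<lambda>(t, x). f t x)" for f :: "real \<Rightarrow> real \<Rightarrow> real"
  proof -
    have "compact ((\<lambda>(t, x). f t x) ` K)"
      by (intro compact_continuous_image continuous_on_subset[OF that K(2)] K(1))
    then obtain C where C: "\<forall>v\<in>(\<lambda>(t, x). f t x) ` K. norm v \<le> C"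
      by (metis compact_imp_bounded bounded_iff)
    have "\<bar>f t x\<bar> \<le> max 0 C" if "(t, x) \<in> K" for t x
      using bspec[OF C, of "f t x"] that by force
    then show ?thesis by (intro exI[of _ "max 0 C"]) auto
  qed
  obtain C where C: "0 \<le> C" "\<And>t x. 0 < t \<Longrightarrow> \<bar>h t x\<bar> \<le> C"
  proof -
    obtain C where C: "0 \<le> C" "\<forall>t x. (t, x) \<in> K \<longrightarrow> \<bar>h t x\<bar> \<le> C" using bounded[OF ch] by blast
    have "\<bar>h t x\<bar> \<le> C" if "0 < t" for t x
      using C C1c_test_deriv_zero[OF test K(1,3) that, of x] by (cases "(t, x) \<in> K") (auto simp: h_def)
    then show ?thesis using that C(1) by blast
  qed
  obtain D where D: "0 \<le> D" "\<And>t x. 0 \<le> t \<Longrightarrow> \<bar>\<psi> t x\<bar> \<le> D"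
  proof -
    obtain D where D: "0 \<le> D" "\<forall>t x. (t, x) \<in> K \<longrightarrow> \<bar>\<psi> t x\<bar> \<le> D" using bounded[OF c\<psi>] by blast
    have "\<bar>\<psi> t x\<bar> \<le> D" if "0 \<le> t" for t x
      using D K(3) that by (cases "(t, x) \<in> K") auto
    then show ?thesis using that D(1) by blast
  qed
  define H where "H t y = h t (X t y)" for t y

  have FTC: "(LBINT t:{t1..\<tau>}. H t y) = \<psi> \<tau> (X \<tau> y) - \<psi> t1 (X t1 y)" if \<tau>: "t1 \<le> \<tau>" for \<tau> y
  proof -
    have sub: "{t1..\<tau>} \<subseteq> {0..}" using t12 by auto
    have "integral\<^sup>L lborel (\<lambda>t. indicator {t1..\<tau>} t *\<^sub>R H t y) = \<psi> \<tau> (X \<tau> y) - \<psi> t1 (X t1 y)"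
    proof (rule integral_FTC_atLeastAtMost[OF \<tau>])
      fix t assume t: "t1 \<le> t" "t \<le> \<tau>"
      then have t0: "0 \<le> t" using t12 by simp
      have "((\<lambda>s. X s y) has_derivative (\<lambda>k. V t y * k)) (at t within {t1..\<tau>})"
        using X_has_derivative[OF t0 sub, of y] by (simp add: has_field_derivative_def)
      then have 1: "((\<lambda>s. (s, X s y)) has_derivative (\<lambda>k. (k, V t y * k))) (at t within {t1..\<tau>})"
        by (intro has_derivative_Pair has_derivative_ident)
      have 2: "((\<lambda>(s, y). \<psi> s y) has_derivative (\<lambda>(h, k). \<psi>t t (X t y) * h + \<psi>x t (X t y) * k))
          (at (t, X t y) within (\<lambda>s. (s, X s y)) ` {t1..\<tau>})"
        by (rule has_derivative_subset[of _ _ _ "{0..} \<times> UNIV"])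
          (use test t0 t12 in \<open>auto simp: C1c_test_def\<close>)
      have "((\<lambda>s. \<psi> s (X s y)) has_derivative (\<lambda>k. \<psi>t t (X t y) * k +
        \<psi>x t (X t y) * (V t y * k))) (at t within {t1..\<tau>})"
        using has_derivative_in_compose[OF 1 2] by simp
      also have "(\<lambda>k. \<psi>t t (X t y) * k + \<psi>x t (X t y) * (V t y * k)) = (\<lambda>k. k *\<^sub>R H t y)"
        using u_X[OF t0, of y] by (auto simp: fun_eq_iff H_def h_def algebra_simps)
      finally show "((\<lambda>s. \<psi> s (X s y)) has_vector_derivative H t y) (at t within {t1..\<tau>})"
        by (simp add: has_vector_derivative_def)
    next
      have "continuous_on {t1..\<tau>} (\<lambda>t. (\<lambda>(t, x). h t x) (t, X t y))"
        by (rule continuous_on_compose2[OF ch, where f = "\<lambda>t. (t, X t y)"])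
          (intro continuous_on_Pair continuous_on_id continuous_on_subset[OF X_time_cont sub], use sub in auto)
      then show "continuous_on {t1..\<tau>} (\<lambda>t. H t y)" by (simp add: H_def)
    qed
    then show ?thesis by (simp add: set_lebesgue_integral_def)
  qed

  have pt: "alive t2 y * \<psi> t2 (X t2 y) - alive t1 y * \<psi> t1 (X t1 y) \<le>
    (LBINT t:{t1..t2}. alive t y * H t y)" for y
  proof -
    \<comment> \<open>Collapsed throughout, alive throughout, or collapsing in between.\<close>
    consider "alive t1 y = 0" | "alive t2 y = 1" | "alive t1 y = 1" "alive t2 y = 0"
      using alive_cases by blast
    then show ?thesis
    proof cases
      case 1
      then have z: "alive t y = 0" if "t1 \<le> t" for t using alive_zero_later t12 that by force
      have "(LBINT t:{t1..t2}. alive t y * H t y) = (LBINT t:{t1..t2}. 0)"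
        by (rule set_lebesgue_integral_cong) (use z in auto)
      then show ?thesis using z[of t1] z[of t2] t12 by simp
    next
      case 2
      have o: "alive t y = 1" if "t1 \<le> t" "t \<le> t2" for t
        using alive_zero_later[of t y t2] alive_cases[of t y] 2 t12 that by auto
      have "(LBINT t:{t1..t2}. alive t y * H t y) = (LBINT t:{t1..t2}. H t y)"
        by (rule set_lebesgue_integral_cong) (use o in auto)
      then show ?thesis using o[of t1] o[of t2] t12 FTC[of t2 y] by simp
    next
      case 3
      have neg: "a y < 0"
      proof (rule ccontr)
        assume "\<not> a y < 0"
        then have "0 < 1 + t2 * a y / 2" using t12 by (simp add: add_pos_nonneg)
        then show False using 3(2) by (simp add: alive_def)
      qed
      define \<tau> where "\<tau> = -2 / a y"
      have alive: "alive t y = (if t < \<tau> then 1 else 0)" for t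
        using neg by (simp add: alive_def \<tau>_def field_simps)
      have \<tau>: "t1 < \<tau>" "\<tau> \<le> t2" using 3 alive[of t1] alive[of t2] by (auto split: if_splits)
      \<comment> \<open>At \<tau> itself the label already counts as collapsed; a single time does
        not affect the integral.\<close>
      have "(LBINT t:{t1..t2}. alive t y * H t y) = (LBINT t:{t1..\<tau>}. H t y)"
        unfolding set_lebesgue_integral_def
        by (rule integral_discrete_difference[where X = "{\<tau>}"]) (use \<tau> in \<open>auto simp: alive indicator_def\<close>)
      also have "\<dots> = \<psi> \<tau> (X \<tau> y) - \<psi> t1 (X t1 y)" using FTC[of \<tau> y] \<tau> by simp
      \<comment> \<open>The dropped value of \<psi> at time \<tau>, weighted with a^2, is the
        dissipated energy; its sign is where nonnegativity of \<psi> enters.\<close>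
      also have "\<dots> \<ge> - \<psi> t1 (X t1 y)" using nn \<tau> t12 by simp
      finally show ?thesis using 3 by simp
    qed
  qed

  have side: "(LINT x|lebesgue. (deriv (u t) x)\<^sup>2 * f x) = (LBINT y. alive t y * (a y)\<^sup>2 * f (X t y))"
    if "0 \<le> t" "continuous_on UNIV f" for t f
  proof -
    have [measurable]: "f \<in> borel_measurable borel" "ux t \<in> borel_measurable borel"
      using that by (auto intro: borel_measurable_continuous_onI ux_meas)
    have "(LINT x|lebesgue. (deriv (u t) x)\<^sup>2 * f x) = (LBINT x. (ux t x)\<^sup>2 * f x)"
      by (rule integral_lebesgue_cong_AE) (use deriv_u_AE[OF that(1)] in \<open>auto elim!: eventually_mono\<close>)
    also have "\<dots> = (LBINT y. alive t y * (a y)\<^sup>2 * f (X t y))"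
      by (rule integral_ux_sq(2)[OF that(1)]) measurable
    finally show ?thesis .
  qed
  have int: "integrable lborel (\<lambda>y. alive t y * (a y)\<^sup>2 * \<psi> t (X t y))" if "0 \<le> t" for t
  proof (rule Bochner_Integration.integrable_bound[OF integrable_mult_right[OF a_sq, of D]])
    have [measurable]: "\<psi> t \<in> borel_measurable borel" "X t \<in> borel_measurable borel"
      using that slice[OF c\<psi>] by (auto intro: borel_measurable_continuous_onI X_meas)
    show "(\<lambda>y. alive t y * (a y)\<^sup>2 * \<psi> t (X t y)) \<in> borel_measurable lborel" by measurable
    have "\<bar>alive t y * (a y)\<^sup>2 * \<psi> t (X t y)\<bar> \<le> D * (a y)\<^sup>2" for y
    proof -
      have "alive t y * (a y)\<^sup>2 * \<bar>\<psi> t (X t y)\<bar> \<le> 1 * (a y)\<^sup>2 * D"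
        using D that alive_bounds by (intro mult_mono) auto
      then show ?thesis using alive_bounds by (simp add: abs_mult mult.commute)
    qed
    then show "AE y in lborel. norm (alive t y * (a y)\<^sup>2 * \<psi> t (X t y)) \<le> norm (D * (a y)\<^sup>2)"
      using D(1) by simp
  qed

  define f where "f t y = indicator {t1..t2} t * (alive t y * (a y)\<^sup>2 * H t y)" for t y
  \<comment> \<open>Continuity of \<open>h\<close> and measurability of \<open>X\<close> are known
    for nonnegative times; the indicators and \<open>max 0\<close> restrict to these without
    changing the product, since t1 > 0.\<close>
  have Hm: "(\<lambda>(t, y). indicator {t1..t2} t * H t y) \<in> borel_measurable (borel \<Otimes>\<^sub>M borel)"
  proof -
    have "(\<lambda>p. indicator ({0..} \<times> UNIV) p *\<^sub>R (\<lambda>(t, x). h t x) p) \<in> borel_measurable borel"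
      by (rule borel_measurable_continuous_on_indicator[OF _ ch]) (intro borel_closed closed_Times; simp)
    then have 1: "(\<lambda>p. indicator ({0..} \<times> UNIV) p *\<^sub>R (\<lambda>(t, x). h t x) p) \<in> borel_measurable (borel \<Otimes>\<^sub>M borel)"
      by (simp add: borel_prod)
    have 2: "(\<lambda>p. (fst p, (\<lambda>(t, y). X (max 0 t) y) p)) \<in> borel \<Otimes>\<^sub>M borel \<rightarrow>\<^sub>M borel \<Otimes>\<^sub>M borel"
      by (intro measurable_Pair measurable_fst X_joint_meas)
    have "(\<lambda>p. indicator {t1..t2} (fst p) * (indicator ({0..} \<times> UNIV) (fst p, (\<lambda>(t, y). X (max 0 t) y) p) *\<^sub>R
        (\<lambda>(t, x). h t x) (fst p, (\<lambda>(t, y). X (max 0 t) y) p))) \<in> borel_measurable (borel \<Otimes>\<^sub>M borel)"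
      by (intro borel_measurable_times measurable_compose[OF 2 1]) measurable
    also have "(\<lambda>p. indicator {t1..t2} (fst p) * (indicator ({0..} \<times> UNIV) (fst p, (\<lambda>(t, y). X (max 0 t)
      y) p) *\<^sub>R
        (\<lambda>(t, x). h t x) (fst p, (\<lambda>(t, y). X (max 0 t) y) p))) = (\<lambda>(t, y). indicator {t1..t2} t * H t y)"
      using t12 by (auto simp: fun_eq_iff H_def indicator_def max_def)
    finally show ?thesis .
  qed
  have fm: "(\<lambda>(t, y). f t y) \<in> borel_measurable (lborel \<Otimes>\<^sub>M lborel)"
  proof -
    have "(\<lambda>p. (\<lambda>(t, y). indicator {t1..t2} t * H t y) p * ((\<lambda>(t, y). alive t y) p * (a (snd p))\<^sup>2))
        \<in> borel_measurable (borel \<Otimes>\<^sub>M borel)"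
      by (intro borel_measurable_times Hm alive_meas) measurable
    also have "(\<lambda>p. (\<lambda>(t, y). indicator {t1..t2} t * H t y) p * ((\<lambda>(t, y). alive t y) p * (a (snd
      p))\<^sup>2)) = (\<lambda>(t, y). f t y)"
      by (auto simp: fun_eq_iff f_def)
    finally show ?thesis
      by (subst measurable_cong_sets[OF sets_pair_measure_cong[OF sets_lborel sets_lborel] refl])
  qed
  have fb: "\<bar>f t y\<bar> \<le> (C * indicator {t1..t2} t) * (a y)\<^sup>2" for t y
  proof (cases "t \<in> {t1..t2}")
    case True
    have "alive t y * (a y)\<^sup>2 * \<bar>H t y\<bar> \<le> 1 * (a y)\<^sup>2 * C"
      using C True t12 alive_bounds by (intro mult_mono) (auto simp: H_def)
    then show ?thesis using alive_bounds True by (simp add: f_def abs_mult mult.commute)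
  qed (simp add: f_def)
  note fub = fubini_dominated[OF fm integrable_mult_right[OF integrable_indicator_Icc] a_sq fb]

  have rhs: "(LINT t:{t1..t2}|lebesgue. (LINT x|lebesgue. ?F t x)) = (LBINT y. LBINT t. f t y)"
  proof -
    have "(LINT t:{t1..t2}|lebesgue. (LINT x|lebesgue. ?F t x)) = (LBINT t. LBINT y. f t y)"
      unfolding set_lebesgue_integral_def
    proof (rule integral_lebesgue_cong_AE)
      show "(\<lambda>t. LBINT y. f t y) \<in> borel_measurable borel"
        using borel_measurable_integrable[OF fub(1)] by simp
      have "indicator {t1..t2} t *\<^sub>R (LINT x|lebesgue. ?F t x)
          = (LBINT y. f t y)" for t
      proof (cases "t \<in> {t1..t2}")
        case True
        then have t0: "0 \<le> t" using t12 by simp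
        have "(LINT x|lebesgue. ?F t x)
            = (LINT x|lebesgue. (deriv (u t) x)\<^sup>2 * h t x)"
          by (intro Bochner_Integration.integral_cong) (auto simp: h_def algebra_simps)
        also have "\<dots> = (LBINT y. alive t y * (a y)\<^sup>2 * h t (X t y))"
          by (rule side[OF t0 slice[OF ch t0]])
        finally show ?thesis using True by (simp add: f_def H_def)
      qed (simp add: f_def)
      then show "AE t in lborel. indicator {t1..t2} t *\<^sub>R (LINT x|lebesgue. ?F t x)
          = (LBINT y. f t y)" by simp
    qed
    also have "\<dots> = (LBINT y. LBINT t. f t y)" by (rule fub(3))
    finally show ?thesis .
  qed
  have t0: "0 \<le> t1" "0 \<le> t2" using t12 by auto
  have "(LINT x|lebesgue. (deriv (u t2) x)\<^sup>2 * \<psi> t2 x) - (LINT x|lebesgue. (deriv (u t1) x)\<^sup>2 * \<psi> t1 x)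
      = (LBINT y. alive t2 y * (a y)\<^sup>2 * \<psi> t2 (X t2 y) - alive t1 y * (a y)\<^sup>2 * \<psi> t1 (X t1 y))"
    unfolding side[OF t0(1) slice[OF c\<psi> t0(1)]] side[OF t0(2) slice[OF c\<psi> t0(2)]] using int t0 by simp
  also have "\<dots> \<le> (LBINT y. LBINT t. f t y)"
  proof (intro integral_mono Bochner_Integration.integrable_diff int t0 fub(2))
    fix y
    have "(LBINT t. f t y) = (LBINT t. (a y)\<^sup>2 * (indicator {t1..t2} t * (alive t y * H t y)))"
      by (intro Bochner_Integration.integral_cong) (auto simp: f_def)
    also have "\<dots> = (a y)\<^sup>2 * (LBINT t:{t1..t2}. alive t y * H t y)"
      by (simp only: integral_mult_right_zero set_lebesgue_integral_def real_scaleR_def)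
    finally have "(LBINT t. f t y) = (a y)\<^sup>2 * (LBINT t:{t1..t2}. alive t y * H t y)" .
    moreover have "(a y)\<^sup>2 * (alive t2 y * \<psi> t2 (X t2 y) - alive t1 y * \<psi> t1 (X t1 y))
        \<le> (a y)\<^sup>2 * (LBINT t:{t1..t2}. alive t y * H t y)"
      by (intro mult_left_mono pt) simp
    ultimately show "alive t2 y * (a y)\<^sup>2 * \<psi> t2 (X t2 y) - alive t1 y * (a y)\<^sup>2 * \<psi> t1 (X t1 y) \<le>
      (LBINT t. f t y)"
      by (simp add: algebra_simps)
  qed
  finally show "(LINT x|lebesgue. (deriv (u t2) x)\<^sup>2 * \<psi> t2 x) - (LINT x|lebesgue. (deriv (u t1) x)\<^sup>2 * \<psi> t1 x)
      \<le> (LINT t:{t1..t2}|lebesgue. (LINT x|lebesgue. ?F t x))"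
    by (simp only: rhs)
qed

end

section \<open>Identification with the formulas of the statement\<close>

lemma hunter_saxton_data_borel_deriv:
  assumes ac: "abs_cont ubar" and L2: "deriv ubar \<in> L2 UNIV"
  shows "hunter_saxton_data ubar (borel_deriv ubar)"
    and "AE x in lborel. deriv ubar x = borel_deriv ubar x"
proof -
  have "isCont ubar x" for x
  proof -
    have "continuous_on {x - 1..x + 1} ubar"
      using ac unfolding abs_cont_def by (blast intro: abs_cont_on_imp_continuous_on)
    then show ?thesis by (rule continuous_on_interior) (auto simp: interior_atLeastAtMost_real)
  qed
  then have m: "borel_deriv ubar \<in> borel_measurable borel"
    by (intro borel_measurable_borel_deriv) (simp add: continuous_at_imp_continuous_on)
  show ae: "AE x in lborel. deriv ubar x = borel_deriv ubar x"
    using abs_cont_FTC(1)[OF ac] by (auto elim!: eventually_mono intro: DERIV_imp_deriv)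
  have "integrable lebesgue (\<lambda>x. (deriv ubar x)\<^sup>2)"
    using L2 by (simp add: L2_def set_integrable_def)
  moreover have "integrable lebesgue (\<lambda>x. (deriv ubar x)\<^sup>2) \<longleftrightarrow> integrable lborel (\<lambda>x. (borel_deriv ubar x)\<^sup>2)"
    by (rule integrable_lebesgue_cong_AE) (use m ae in \<open>auto elim!: eventually_mono\<close>)
  ultimately show "hunter_saxton_data ubar (borel_deriv ubar)"
    by unfold_locales (use m abs_cont_FTC(3)[OF ac] in auto)
qed

context hunter_saxton_data
begin

text \<open>For t > 0 the condition b > -2/t amounts to 0 < 1 + t*b/2. At t = 0 the latter always
  holds, so \<open>alive\<close> covers both cases of \<open>HS_phi\<close>.\<close>

lemma HS_phi_eq:
  assumes ae: "AE x in lborel. deriv ubar x = a x" and "0 \<le> t"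
  shows "HS_phi ubar t y = \<phi> t y"
proof (cases "t = 0")
  case True
  have "(LINT x|lebesgue. sgn (y - x) * (deriv ubar x)\<^sup>2) = (LBINT x. alive 0 x * (sgn (y - x) * (a x)\<^sup>2))"
    by (rule integral_lebesgue_cong_AE) (use ae in \<open>auto simp: alive_def elim!: eventually_mono\<close>)
  then show ?thesis by (simp add: HS_phi_def \<phi>_def True)
next
  case False
  then have t: "0 < t" using \<open>0 \<le> t\<close> by simp
  have iff: "b > - 2 / t \<longleftrightarrow> 0 < 1 + t * b / 2" for b
    using t by (auto simp: field_simps)
  have "(LINT x:{x. deriv ubar x > - 2 / t}|lebesgue. sgn (y - x) * (deriv ubar x)\<^sup>2)
      = (LBINT x. alive t x * (sgn (y - x) * (a x)\<^sup>2))"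
    unfolding set_lebesgue_integral_def
  proof (rule integral_lebesgue_cong_AE)
    show "AE x in lborel. indicator {x. deriv ubar x > - 2 / t} x *\<^sub>R (sgn (y - x) * (deriv ubar x)\<^sup>2)
        = alive t x * (sgn (y - x) * (a x)\<^sup>2)"
      using ae by eventually_elim (simp only: indicator_def mem_Collect_eq iff alive_def real_scaleR_def
        of_bool_def)
  qed measurable
  then show ?thesis using False by (simp add: HS_phi_def \<phi>_def)
qed

lemma HS_value_eq:
  assumes "AE x in lborel. deriv ubar x = a x" and "0 \<le> t"
  shows "HS_value ubar t y = V t y"
proof -
  have "(LINT s:{0..t}|lebesgue. HS_phi ubar s y) = (LBINT s:{0..t}. \<phi> s y)"
    unfolding set_lebesgue_integral_def
    by (rule integral_lebesgue_cong_AE) (auto simp: HS_phi_eq[OF assms(1)] indicator_def)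
  then show ?thesis by (simp add: HS_value_def V_def)
qed

lemma HS_xi_eq:
  assumes "AE x in lborel. deriv ubar x = a x" and "0 \<le> t"
  shows "HS_xi ubar t y = X t y"
proof -
  have "(LINT s:{0..t}|lebesgue. (t - s) * HS_phi ubar s y) = (LBINT s:{0..t}. (t - s) * \<phi> s y)"
    unfolding set_lebesgue_integral_def
    by (rule integral_lebesgue_cong_AE) (auto simp: HS_phi_eq[OF assms(1)] indicator_def)
  then show ?thesis by (simp add: HS_xi_def X_def)
qed

end

theorem theorem1:
  fixes ubar :: "real \<Rightarrow> real"
  assumes "abs_cont ubar"
    and "deriv ubar \<in> L2 UNIV"
  shows "(\<forall>t\<ge>0. \<forall>x. \<exists>!v. \<exists>y. HS_xi ubar t y = x \<and> HS_value ubar t y = v) \<and>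
    (\<exists>u :: real \<Rightarrow> real \<Rightarrow> real.
       (\<forall>t\<ge>0. \<forall>y. u t (HS_xi ubar t y) = HS_value ubar t y) \<and>
       HS_global_solution ubar u \<and> HS_dissipative u)"
proof -
  interpret hunter_saxton_data ubar "borel_deriv ubar"
    by (rule hunter_saxton_data_borel_deriv(1)[OF assms])
  note eqs = HS_xi_eq[OF hunter_saxton_data_borel_deriv(2)[OF assms]]
    HS_value_eq[OF hunter_saxton_data_borel_deriv(2)[OF assms]]
  have "\<exists>!v. \<exists>y. HS_xi ubar t y = x \<and> HS_value ubar t y = v" if t: "0 \<le> t" for t x
  \<comment> \<open>All labels over x carry the same value by \<open>u_X\<close>, and
    \<open>label t x\<close> is one of them.\<close>
  proof (rule ex1I[of _ "u t x"])
    show "\<exists>y. HS_xi ubar t y = x \<and> HS_value ubar t y = u t x"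
      using X_label[OF t, of x] by (intro exI[of _ "label t x"]) (simp add: eqs t u_def)
    show "v = u t x" if "\<exists>y. HS_xi ubar t y = x \<and> HS_value ubar t y = v" for v
      using that u_X[OF t] by (auto simp: eqs t)
  qed
  moreover have "u t (HS_xi ubar t y) = HS_value ubar t y" if "0 \<le> t" for t y
    using that by (simp add: eqs u_X)
  moreover have "HS_global_solution ubar u"
    unfolding HS_global_solution_def by (auto intro: HS_solution_u)
  ultimately show ?thesis using HS_dissipative_u by blast
qed

end
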